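(* For $|q|<1$, $$\mathrm{C}\Phi_9(q)=324q\frac{(q^3;q^3)_\infty^8}{(q;q)_\infty^9}+19683q^4\frac{(q^9;q^9)_\infty^{12}}{(q;q)_\infty^9(q^3;q^3)_\infty^4}-240q\frac{(q^9;q^9)_\infty^3}{(q^3;q^3)_\infty^4}-1458q^2\frac{(q^9;q^9)_\infty^6}{(q;q)_\infty^3(q^3;q^3)_\infty^4}+\frac{(q;q)_\infty^3}{(q^3;q^3)_\infty^4}$$ $$=\frac{1}{(q;q)_\infty^9}\Big(81E_{9,1}-84E_{9,2}+243E_{9,3}-3E_{9,4}-6q(q^3;q^3)_\infty^8\Big),$$ where $E_{9,1}=\frac1{240}+\sum_{k\ge1}\frac{k^3q^k}{1-q^k}$, $E_{9,2}=\frac1{240}+\sum_{k\ge1}\frac{k^3q^{3k}}{1-q^{3k}}$, $E_{9,3}=\frac1{240}+\sum_{k\ge1}\frac{k^3q^{9k}}{1-q^{9k}}$, and $E_{9,4}=\sum_{n\ge1}\big(\frac n3\big)\sum_{d\mid n}d^3q^n$.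
   Context: A $k$-colored generalized Frobenius symbol is a two-row array with $d\ge 0$ columns whose entries are colored nonnegative integers $\ell_c$ ($\ell\ge 0$, color $c\in\{1,\dots,k\}$), each row strictly decreasing with respect to the total order $0_1\prec 0_2\prec\cdots\prec 0_k\prec 1_1\prec\cdots\prec 1_k\prec 2_1\prec\cdots$. It is a $k$-colored generalized Frobenius partition of $n=d+\sum(\text{integer values of all entries})$. $c\phi_k(n)$ is the number of such partitions of $n$ (with $c\phi_k(0)=1$), and $\mathrm{C}\Phi_k(q)=\sum_{n\ge0}c\phi_k(n)q^n$. $(a;q)_\infty=\prod_{j\ge1}(1-aq^{j-1})$; $\left(\frac n3\right)$ is the Legendre symbol. *)

theory Defs
  imports "HOL-Analysis.Analysis" "HOL-Number_Theory.Number_Theory"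
begin

text \<open>A colored nonnegative integer \<open>\<ell>\<^sub>c\<close> is encoded as the pair \<open>(\<ell>, c)\<close>.\<close>

type_synonym colored_nat = "nat \<times> nat"

definition colored_less :: "colored_nat \<Rightarrow> colored_nat \<Rightarrow> bool" where
  "colored_less x y \<longleftrightarrow> fst x < fst y \<or> fst x = fst y \<and> snd x < snd y"

definition frobenius_row :: "nat \<Rightarrow> colored_nat list \<Rightarrow> bool" where
  "frobenius_row k xs \<longleftrightarrow>
     (\<forall>x \<in> set xs. snd x \<in> {1..k}) \<and> sorted_wrt (\<lambda>x y. colored_less y x) xs"

definition frobenius_symbol :: "nat \<Rightarrow> colored_nat list \<times> colored_nat list \<Rightarrow> bool" where
  "frobenius_symbol k s \<longleftrightarrow>
     length (fst s) = length (snd s) \<and> frobenius_row k (fst s) \<and> frobenius_row k (snd s)"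

definition frobenius_size :: "colored_nat list \<times> colored_nat list \<Rightarrow> nat" where
  "frobenius_size s =
     length (fst s) + sum_list (map fst (fst s)) + sum_list (map fst (snd s))"

definition frobenius_partitions :: "nat \<Rightarrow> nat \<Rightarrow> (colored_nat list \<times> colored_nat list) set" where
  "frobenius_partitions k n = {s. frobenius_symbol k s \<and> frobenius_size s = n}"

definition cphi :: "nat \<Rightarrow> nat \<Rightarrow> nat" where
  "cphi k n = card (frobenius_partitions k n)"

definition CPhi :: "nat \<Rightarrow> complex \<Rightarrow> complex" where
  "CPhi k q = (\<Sum>n. of_nat (cphi k n) * q ^ n)"

definition qpoch_inf :: "complex \<Rightarrow> complex \<Rightarrow> complex" where
  "qpoch_inf a q = (\<Prod>j. 1 - a * q ^ j)"

definition E91 :: "complex \<Rightarrow> complex" where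
  "E91 q = 1 / 240 + (\<Sum>k. of_nat (Suc k) ^ 3 * q ^ Suc k / (1 - q ^ Suc k))"

definition E92 :: "complex \<Rightarrow> complex" where
  "E92 q = 1 / 240 + (\<Sum>k. of_nat (Suc k) ^ 3 * q ^ (3 * Suc k) / (1 - q ^ (3 * Suc k)))"

definition E93 :: "complex \<Rightarrow> complex" where
  "E93 q = 1 / 240 + (\<Sum>k. of_nat (Suc k) ^ 3 * q ^ (9 * Suc k) / (1 - q ^ (9 * Suc k)))"

definition E94 :: "complex \<Rightarrow> complex" where
  "E94 q = (\<Sum>n. of_int (Legendre (int (Suc n)) 3)
                   * (\<Sum>d | d dvd Suc n. of_nat d ^ 3 * q ^ Suc n))"


text \<open>The set counted by \<open>cphi\<close> is finite, and the generating function and the infinite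
  products converge on the unit disc, so \<open>card\<close>, \<open>suminf\<close> and \<open>prodinf\<close> in \<open>cphi\<close>, \<open>CPhi\<close> and
  \<open>qpoch_inf\<close> do not take default values.\<close>

lemma frobenius_row_distinct:
  assumes "frobenius_row k xs"
  shows "distinct xs"
proof -
  have "sorted_wrt (\<lambda>x y. colored_less y x) xs"
    using assms by (simp add: frobenius_row_def)
  then show ?thesis
    by (induction xs) (auto simp: colored_less_def)
qed

lemma frobenius_row_unique:
  assumes "frobenius_row k xs" "frobenius_row k ys" "set xs = set ys"
  shows "xs = ys"
proof -
  have "sorted_wrt (\<lambda>x y. colored_less y x) xs" "sorted_wrt (\<lambda>x y. colored_less y x) ys"
    using assms by (simp_all add: frobenius_row_def)
  then show ?thesis using assms(3)
  proof (induction xs arbitrary: ys)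
    case Nil
    then show ?case by simp
  next
    case (Cons x xs)
    then obtain y ys' where ys: "ys = y # ys'" by (cases ys) auto
    have asym: "\<not> (colored_less a b \<and> colored_less b a)" for a b
      by (auto simp: colored_less_def)
    have x: "\<forall>a\<in>set xs. colored_less a x" and y: "\<forall>a\<in>set ys'. colored_less a y"
      using Cons.prems ys by auto
    have "x = y"
      using x y asym Cons.prems(3) ys by (metis list.set_intros(1) set_ConsD)
    moreover have "x \<notin> set xs" "y \<notin> set ys'"
      using x y asym by blast+
    ultimately have "set xs = set ys'"
      using Cons.prems(3) ys by (auto dest: insert_ident)
    then show ?case
      using Cons ys \<open>x = y\<close> by auto
  qed
qed

lemma frobenius_symbol_entries:
  assumes "frobenius_symbol k s" "frobenius_size s \<le> N"
  shows "set (fst s) \<subseteq> {..N} \<times> {1..k}" "set (snd s) \<subseteq> {..N} \<times> {1..k}"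
proof -
  have le: "fst x \<in> {..N}" if "x \<in> set (fst s) \<or> x \<in> set (snd s)" for x
  proof -
    have "fst x \<le> sum_list (map fst (fst s)) \<or> fst x \<le> sum_list (map fst (snd s))"
      using that member_le_sum_list[of "fst x" "map fst (fst s)"]
        member_le_sum_list[of "fst x" "map fst (snd s)"] by auto
    then show ?thesis
      using assms(2) by (auto simp: frobenius_size_def)
  qed
  have col: "snd x \<in> {1..k}" if "x \<in> set (fst s) \<or> x \<in> set (snd s)" for x
    using that assms(1) by (auto simp: frobenius_symbol_def frobenius_row_def)
  show "set (fst s) \<subseteq> {..N} \<times> {1..k}" "set (snd s) \<subseteq> {..N} \<times> {1..k}"
    unfolding subset_eq mem_Times_iff using le col by blast+
qed

lemma inj_on_frobenius_sets:
  "inj_on (\<lambda>s. (set (fst s), set (snd s))) {s. frobenius_symbol k s}"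
proof (rule inj_onI)
  fix s t
  assume s: "s \<in> {s. frobenius_symbol k s}" and t: "t \<in> {s. frobenius_symbol k s}"
    and eq: "(set (fst s), set (snd s)) = (set (fst t), set (snd t))"
  have "fst s = fst t"
    by (rule frobenius_row_unique[of k]) (use s t eq in \<open>simp_all add: frobenius_symbol_def\<close>)
  moreover have "snd s = snd t"
    by (rule frobenius_row_unique[of k]) (use s t eq in \<open>simp_all add: frobenius_symbol_def\<close>)
  ultimately show "s = t" by (rule prod_eqI)
qed

lemma finite_frobenius_le: "finite {s. frobenius_symbol k s \<and> frobenius_size s \<le> N}"
proof (rule inj_on_finite)
  show "inj_on (\<lambda>s. (set (fst s), set (snd s))) {s. frobenius_symbol k s \<and> frobenius_size s \<le> N}"
    by (rule inj_on_subset[OF inj_on_frobenius_sets]) auto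
  show "(\<lambda>s. (set (fst s), set (snd s))) ` {s. frobenius_symbol k s \<and> frobenius_size s \<le> N}
          \<subseteq> Pow ({..N} \<times> {1..k}) \<times> Pow ({..N} \<times> {1..k})"
    by (intro image_subsetI) (simp add: frobenius_symbol_entries del: One_nat_def)
qed auto

lemma finite_frobenius_partitions: "finite (frobenius_partitions k n)"
  by (rule finite_subset[OF _ finite_frobenius_le[of k n]]) (auto simp: frobenius_partitions_def)

lemma cphi_0: "cphi k 0 = 1"
proof -
  have "frobenius_partitions k 0 = {([], [])}"
    by (auto simp: frobenius_partitions_def frobenius_symbol_def frobenius_size_def
        frobenius_row_def)
  then show ?thesis by (simp add: cphi_def)
qed

lemma sum_Pow_power_le:
  fixes r :: real and f :: "'a \<Rightarrow> nat"
  assumes "finite U" "0 \<le> r"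
  shows "(\<Sum>A\<in>Pow U. r ^ (\<Sum>x\<in>A. f x)) \<le> exp (\<Sum>x\<in>U. r ^ f x)"
proof -
  have "(\<Sum>A\<in>Pow U. r ^ (\<Sum>x\<in>A. f x)) = (\<Prod>x\<in>U. r ^ f x + 1)"
    using prod_add[OF assms(1), of "\<lambda>x. r ^ f x" "\<lambda>_. 1"]
    by (simp add: power_sum)
  also have "\<dots> \<le> (\<Prod>x\<in>U. exp (r ^ f x))"
    using assms(2) by (intro prod_mono) (auto simp: add.commute intro: exp_ge_add_one_self)
  also have "\<dots> = exp (\<Sum>x\<in>U. r ^ f x)"
    using assms(1) by (simp add: exp_sum)
  finally show ?thesis .
qed

lemma summable_cphi_real:
  fixes r :: real
  assumes r: "0 \<le> r" "r < 1"
  shows "summable (\<lambda>n. real (cphi k n) * r ^ n)"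
proof (rule summableI_nonneg_bounded)
  show "0 \<le> real (cphi k n) * r ^ n" for n using r by simp
  fix N
  let ?S = "{s. frobenius_symbol k s \<and> frobenius_size s \<le> N}"
  let ?U = "{..N} \<times> {1..k}"
  let ?g = "\<lambda>(A, B). r ^ (\<Sum>x\<in>A. Suc (fst x)) * r ^ (\<Sum>x\<in>B. fst x)"
  have geo: "(\<Sum>l\<le>N. r ^ l) \<le> 1 / (1 - r)"
    using sum_le_suminf[OF summable_geometric, of r "{..N}"] r by (simp add: suminf_geometric)
  have U: "(\<Sum>x\<in>?U. r ^ fst x) \<le> k / (1 - r)"
  proof -
    have "(\<Sum>x\<in>?U. r ^ fst x) = (\<Sum>l\<le>N. \<Sum>c\<in>{1..k}. r ^ l)"
      by (subst sum.cartesian_product) (auto intro!: sum.cong)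
    also have "\<dots> = k * (\<Sum>l\<le>N. r ^ l)" by (simp add: sum_distrib_left)
    also have "\<dots> \<le> k * (1 / (1 - r))" by (intro mult_left_mono geo) auto
    finally show ?thesis by simp
  qed
  have U': "(\<Sum>x\<in>?U. r ^ Suc (fst x)) \<le> k / (1 - r)"
  proof -
    have "(\<Sum>x\<in>?U. r ^ Suc (fst x)) \<le> (\<Sum>x\<in>?U. r ^ fst x)"
      using r by (intro sum_mono power_decreasing) auto
    then show ?thesis using U by linarith
  qed
  have g: "?g (set (fst s), set (snd s)) = r ^ frobenius_size s" if "frobenius_symbol k s" for s
  proof -
    have "distinct (fst s)" "distinct (snd s)"
      using that frobenius_row_distinct by (auto simp: frobenius_symbol_def)
    moreover have "length (fst s) = (\<Sum>x\<in>set (fst s). 1)"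
      using calculation(1) by (simp add: distinct_card)
    ultimately have "frobenius_size s =
        (\<Sum>x\<in>set (fst s). 1) + (\<Sum>x\<in>set (fst s). fst x) + (\<Sum>x\<in>set (snd s). fst x)"
      by (simp only: frobenius_size_def sum_list_distinct_conv_sum_set)
    also have "\<dots> = (\<Sum>x\<in>set (fst s). Suc (fst x)) + (\<Sum>x\<in>set (snd s). fst x)"
      by (simp only: sum.distrib[symmetric] plus_1_eq_Suc)
    finally show ?thesis by (simp only: power_add prod.case)
  qed
  have "(\<Sum>n<N. real (cphi k n) * r ^ n) = (\<Sum>n<N. \<Sum>s\<in>frobenius_partitions k n. r ^ frobenius_size s)"
    by (intro sum.cong) (auto simp: cphi_def frobenius_partitions_def)
  also have "\<dots> = (\<Sum>s\<in>(\<Union>n<N. frobenius_partitions k n). r ^ frobenius_size s)"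
    by (subst sum.UNION_disjoint)
       (use finite_frobenius_partitions in \<open>auto simp: frobenius_partitions_def\<close>)
  also have "\<dots> \<le> (\<Sum>s\<in>?S. r ^ frobenius_size s)"
    using r finite_frobenius_le by (intro sum_mono2) (auto simp: frobenius_partitions_def)
  also have "\<dots> = (\<Sum>s\<in>?S. ?g (set (fst s), set (snd s)))"
    using g by (intro sum.cong) auto
  also have "\<dots> = sum ?g ((\<lambda>s. (set (fst s), set (snd s))) ` ?S)"
    by (subst sum.reindex) (auto intro: inj_on_subset[OF inj_on_frobenius_sets])
  also have "\<dots> \<le> sum ?g (Pow ?U \<times> Pow ?U)"
  proof (rule sum_mono2)
    show "(\<lambda>s. (set (fst s), set (snd s))) ` ?S \<subseteq> Pow ?U \<times> Pow ?U"
      by (intro image_subsetI) (simp add: frobenius_symbol_entries del: One_nat_def)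
  qed (use r in auto)
  also have "\<dots> = (\<Sum>A\<in>Pow ?U. r ^ (\<Sum>x\<in>A. Suc (fst x))) * (\<Sum>B\<in>Pow ?U. r ^ (\<Sum>x\<in>B. fst x))"
    by (simp only: sum_product sum.cartesian_product)
  also have "\<dots> \<le> exp (\<Sum>x\<in>?U. r ^ Suc (fst x)) * exp (\<Sum>x\<in>?U. r ^ fst x)"
    using r by (intro mult_mono sum_Pow_power_le sum_nonneg) auto
  also have "\<dots> \<le> exp (k / (1 - r)) * exp (k / (1 - r))"
    using U U' by (intro mult_mono) auto
  finally show "(\<Sum>n<N. real (cphi k n) * r ^ n) \<le> exp (k / (1 - r)) * exp (k / (1 - r))" .
qed

lemma summable_CPhi:
  fixes q :: complex
  assumes "norm q < 1"
  shows "summable (\<lambda>n. of_nat (cphi k n) * q ^ n)"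
proof (rule summable_norm_cancel)
  show "summable (\<lambda>n. norm (of_nat (cphi k n) * q ^ n))"
    using summable_cphi_real[of "norm q" k] assms by (simp add: norm_mult norm_power)
qed

lemma convergent_prod_qpoch_inf:
  fixes a q :: complex
  assumes "norm q < 1"
  shows "convergent_prod (\<lambda>j. 1 - a * q ^ j)"
proof -
  have "summable (\<lambda>j. norm a * norm q ^ j)"
    using assms by (intro summable_mult summable_geometric) simp
  then have "abs_convergent_prod (\<lambda>j. 1 - a * q ^ j)"
    by (simp add: abs_convergent_prod_conv_summable norm_mult norm_power)
  then show ?thesis by (rule abs_convergent_prod_imp_convergent_prod)
qed

end

theory Submission
  imports Defs "HOL-Complex_Analysis.Complex_Analysis"
begin

text \<open>
  Write \<open>E\<^sub>n\<close> for the product \<open>(q\<^sup>n; q\<^sup>n)\<^sub>\<infinity>\<close>. A \<open>9\<close>-coloured Frobenius symbol is a pair of finite sets of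
  coloured numbers of equal cardinality, so by the Jacobi triple product \<open>E\<^sub>1\<^sup>9\<close> times the generating
  function is the coefficient of \<open>z\<^sup>0\<close> in the ninth power of the theta series \<open>\<Sum> q\<^bsup>n(n-1)/2\<^esup> z\<^sup>n\<close>, that is,
  the theta series of the lattice \<open>A\<^sub>8\<close>. Cubing twice and splitting by residues modulo \<open>3\<close> expresses
  it through the theta series \<open>a(q)\<close> of \<open>A\<^sub>2\<close> and its cosets, and all of these are polynomials in
  \<open>b = E\<^sub>1\<^sup>3 / E\<^sub>3\<close> and \<open>k = q E\<^sub>9\<^sup>3 / E\<^sub>3\<close>: for instance \<open>a(q) = b + 9k\<close> and \<open>a(q\<^sup>3) = b + 3k\<close>. The only further
  relation is the modular equation obtained from the \<open>3\<close>-dissection of Jacobi's series for \<open>E\<^sub>1\<^sup>3\<close>.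

  For the Eisenstein series, the modular equation is differentiated logarithmically. This shows that
  the weight \<open>2\<close> Eisenstein series of level \<open>3\<close> divided by \<open>a(q)\<^sup>2\<close> is invariant under \<open>q \<mapsto> q\<^sup>3\<close>, hence
  equal to \<open>1\<close>. Ramanujan's equation for the derivative of the weight \<open>2\<close> series then gives
  \<open>Q(q) - 9 Q(q\<^sup>3) = - 8 a\<^sup>4 + 16 a (a\<^sup>3 - b\<^sup>3)\<close> for the weight \<open>4\<close> series \<open>Q\<close>. The function \<open>a\<^sup>4 + 8 a (a\<^sup>3 - b\<^sup>3)\<close>
  satisfies the same relation, and a power series \<open>D\<close> with \<open>D(q) = 9 D(q\<^sup>3)\<close> vanishes.
\<close>

hide_const (open) Module.smult up_ring.coeff

section \<open>A finite form of the Jacobi triple product\<close>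

text \<open>Evaluated at a given z it becomes the Jacobi triple product; its coefficients of w^0,
  w^1, w^2 become Jacobi's series for E_1^3 and two moments of that series, and these moments
  replace the differentiation of an infinite product. Identities between Eisenstein series and theta
  functions are pinned down by their behaviour under q -> q^3, which contracts the disc towards 0,
  where all values are known. The form \<open>cubic_w\<close>, that is b^2 + 9 b k + 27 k^2, recurs
  because a^3 - b^3 = 27 k w; its multiples by b and by k are products of Euler functions, so it
  links lattice sums with products. The twisted series \<open>E94\<close> needs no separate theory:
  a(q^3) is a series in q^3 and k is q times such a series, so replacing q by omega q only
  multiplies k by omega.\<close>

abbreviation euler :: "complex \<Rightarrow> complex" where "euler q \<equiv> qpoch_inf q q"

lemma one_minus_power_neq_0:
  fixes q :: complex
  assumes "norm q < 1" "k > 0"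
  shows "1 - q ^ k \<noteq> 0"
proof
  assume "1 - q ^ k = 0"
  then have "norm q ^ k = 1" by (metis eq_iff_diff_eq_0 norm_one norm_power)
  moreover have "norm q ^ k < 1" using assms power_strict_mono[of "norm q" 1 k] by simp
  ultimately show False by simp
qed

definition qfact :: "complex \<Rightarrow> nat \<Rightarrow> complex" where
  "qfact q n = (\<Prod>k<n. 1 - q * q ^ k)"

lemma qfact_0 [simp]: "qfact q 0 = 1"
  by (simp add: qfact_def)

lemma qfact_Suc: "qfact q (Suc n) = qfact q n * (1 - q ^ Suc n)"
  by (simp add: qfact_def)

lemma qfact_neq_0: "norm q < 1 \<Longrightarrow> qfact q n \<noteq> 0"
  by (induction n) (use one_minus_power_neq_0 in \<open>auto simp: qfact_Suc simp del: power_Suc\<close>)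

lemma qpoch_inf_tendsto:
  assumes "norm q < 1"
  shows "(\<lambda>n. \<Prod>k<n. 1 - a * q ^ k) \<longlonglongrightarrow> qpoch_inf a q"
  unfolding qpoch_inf_def using convergent_prod_qpoch_inf[OF assms]
  by (intro has_prod_imp_tendsto' convergent_prod_has_prod)

lemma qfact_tendsto: "norm q < 1 \<Longrightarrow> qfact q \<longlonglongrightarrow> euler q"
  unfolding qfact_def[abs_def] by (rule qpoch_inf_tendsto)

lemma euler_neq_0:
  assumes "norm q < 1" shows "euler q \<noteq> 0"
  unfolding qpoch_inf_def
proof (rule prodinf_nonzero[OF convergent_prod_qpoch_inf[OF assms]])
  show "1 - q * q ^ i \<noteq> 0" for i
    using one_minus_power_neq_0[OF assms, of "Suc i"] by simp
qed

text \<open>The Gaussian binomial coefficient \<open>[2N + 1, N - n]\<close>.\<close>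

definition qbinom :: "complex \<Rightarrow> nat \<Rightarrow> nat \<Rightarrow> complex" where
  "qbinom q N n = (if n \<le> N then qfact q (2 * N + 1) / (qfact q (N - n) * qfact q (N + 1 + n)) else 0)"

lemma qbinom_gt: "n > N \<Longrightarrow> qbinom q N n = 0"
  by (simp add: qbinom_def)

lemma qbinom_diag: "norm q < 1 \<Longrightarrow> qbinom q N N = 1"
  by (simp add: qbinom_def qfact_neq_0 mult_2)

lemma qbinom_Suc_right:
  assumes q: "norm q < 1" and n: "n \<le> N"
  shows "qbinom q N (Suc n) * (1 - q ^ (N + 2 + n)) = qbinom q N n * (1 - q ^ (N - n))"
proof (cases "n = N")
  case True
  then show ?thesis by (simp add: qbinom_gt)
next
  case False
  with n have lt: "Suc n \<le> N" by simp
  have 1: "qfact q (N - n) = qfact q (N - Suc n) * (1 - q ^ (N - n))"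
    using qfact_Suc[of q "N - Suc n"] lt by (simp add: Suc_diff_Suc)
  have 2: "qfact q (N + 1 + Suc n) = qfact q (N + 1 + n) * (1 - q ^ (N + 2 + n))"
    using qfact_Suc[of q "N + 1 + n"] by simp
  have nz: "1 - q ^ (N - n) \<noteq> 0" "1 - q ^ (N + 2 + n) \<noteq> 0"
    using one_minus_power_neq_0[OF q, of "N - n"] one_minus_power_neq_0[OF q, of "N + 2 + n"] lt by auto
  show ?thesis
    unfolding qbinom_def 1 2 using n lt nz qfact_neq_0[OF q] by (simp add: divide_simps)
qed

lemma qbinom_Suc_left:
  assumes q: "norm q < 1" and n: "n \<le> N"
  shows "qbinom q (Suc N) n * ((1 - q ^ (N + 1 - n)) * (1 - q ^ (N + 2 + n)))
         = qbinom q N n * ((1 - q ^ (2 * N + 2)) * (1 - q ^ (2 * N + 3)))"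
proof -
  have 1: "qfact q (Suc N - n) = qfact q (N - n) * (1 - q ^ (N + 1 - n))"
    using qfact_Suc[of q "N - n"] n by (simp add: Suc_diff_le)
  have 2: "qfact q (Suc N + 1 + n) = qfact q (N + 1 + n) * (1 - q ^ (N + 2 + n))"
    using qfact_Suc[of q "N + 1 + n"] by simp
  have 3: "qfact q (2 * Suc N + 1) = qfact q (2 * N + 1) * (1 - q ^ (2 * N + 2)) * (1 - q ^ (2 * N + 3))"
    using qfact_Suc[of q "2 * N + 1"] qfact_Suc[of q "2 * N + 2"] by (simp add: eval_nat_numeral)
  have nz: "1 - q ^ (N + 1 - n) \<noteq> 0" "1 - q ^ (N + 2 + n) \<noteq> 0"
    using one_minus_power_neq_0[OF q, of "N + 1 - n"] one_minus_power_neq_0[OF q, of "N + 2 + n"] n by auto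
  show ?thesis
    unfolding qbinom_def 1 2 3 using n nz qfact_neq_0[OF q] by (simp add: divide_simps)
qed

text \<open>What \<open>qbinom_rec\<close> becomes once every coefficient is expressed through
  \<open>qbinom q N (Suc n)\<close> and the denominators are cleared. There
  \<open>x = q ^ (N - Suc n)\<close> and \<open>y = q ^ (N + 2 + n)\<close>, so
  \<open>q * x * y = q ^ (2 * N + 2)\<close>.\<close>

lemma qbinom_step_aux:
  fixes x y q :: complex
  shows "(1 + q * x * y) * ((1 - q * x) * (1 - q * y)) + q * x * ((1 - y) * (1 - q * y))
           + q * y * ((1 - x) * (1 - q * x))
         = (1 - q * x * y) * (1 - q\<^sup>2 * x * y)"
  by (simp add: algebra_simps power2_eq_square)

text \<open>Two steps of the q-Pascal rule at once, from upper index 2N+1 to 2N+3. Keeping the upper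
  index odd matches the pair of factors in z and 1/z by which the product grows.\<close>

lemma qbinom_rec:
  assumes q: "norm q < 1" and n: "n \<le> N"
  shows "qbinom q (Suc N) (Suc n) = (1 + q ^ (2 * N + 2)) * qbinom q N (Suc n)
            + q ^ (N - n) * qbinom q N n + q ^ (N + 3 + n) * qbinom q N (Suc (Suc n))"
proof (cases "n = N")
  case True
  then show ?thesis using q by (simp add: qbinom_gt qbinom_diag)
next
  case False
  with n have lt: "Suc n \<le> N" by simp
  define x y where "x = q ^ (N - Suc n)" and "y = q ^ (N + 2 + n)"
  have pw: "q ^ (N - n) = q * x" "q ^ (N + 1 - Suc n) = q * x"
      "q ^ (N + 2 + Suc n) = q * y" "q ^ (N + 3 + n) = q * y"
    using lt by (simp_all add: x_def y_def eval_nat_numeral Suc_diff_Suc flip: power_Suc)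
  have "2 * N + 1 = (N - Suc n) + (N + 2 + n)" using lt by simp
  then have "q ^ (2 * N + 1) = x * y" unfolding x_def y_def by (simp only: power_add)
  then have pw2: "q ^ (2 * N + 2) = q * x * y" "q ^ (2 * N + 3) = q\<^sup>2 * x * y"
    by (simp_all add: eval_nat_numeral)
  have nz: "1 - q * x \<noteq> 0" "1 - q * y \<noteq> 0"
    using one_minus_power_neq_0[OF q, of "N - n"] one_minus_power_neq_0[OF q, of "N + 3 + n"] lt pw by auto
  have a: "qbinom q N (Suc (Suc n)) * (1 - q * y) = qbinom q N (Suc n) * (1 - x)"
    using qbinom_Suc_right[OF q lt] unfolding pw x_def[symmetric] .
  have b: "qbinom q N (Suc n) * (1 - y) = qbinom q N n * (1 - q * x)"
    using qbinom_Suc_right[OF q n] unfolding pw y_def[symmetric] .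
  have c: "qbinom q (Suc N) (Suc n) * ((1 - q * x) * (1 - q * y))
      = qbinom q N (Suc n) * ((1 - q * x * y) * (1 - q\<^sup>2 * x * y))"
    using qbinom_Suc_left[OF q lt] unfolding pw pw2 .
  have "qbinom q (Suc N) (Suc n) * ((1 - q * x) * (1 - q * y))
      = ((1 + q * x * y) * qbinom q N (Suc n) + q * x * qbinom q N n + q * y * qbinom q N (Suc (Suc n)))
         * ((1 - q * x) * (1 - q * y))"
  proof -
    have b': "q * x * qbinom q N n * ((1 - q * x) * (1 - q * y))
        = qbinom q N (Suc n) * (q * x * ((1 - y) * (1 - q * y)))"
      using arg_cong[OF b, of "\<lambda>t. q * x * t * (1 - q * y)"] by (simp only: mult_ac)
    have a': "q * y * qbinom q N (Suc (Suc n)) * ((1 - q * x) * (1 - q * y))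
        = qbinom q N (Suc n) * (q * y * ((1 - x) * (1 - q * x)))"
      using arg_cong[OF a, of "\<lambda>t. q * y * t * (1 - q * x)"] by (simp only: mult_ac)
    show ?thesis
      unfolding c qbinom_step_aux[symmetric] distrib_right[of _ _ "(1 - q * x) * (1 - q * y)"]
        distrib_left[of "qbinom q N (Suc n)"] a' b' by (simp only: mult_ac) (simp add: algebra_simps)
  qed
  then show ?thesis unfolding pw pw2 using nz by simp
qed

text \<open>At the boundary the neighbour of index -1 is [2N+1, N+1], which by symmetry equals
  [2N+1, N]; hence \<open>qbinom q N 0\<close> occurs twice on the right.\<close>

lemma qbinom_rec_0:
  assumes q: "norm q < 1"
  shows "qbinom q (Suc N) 0 = (1 + q ^ (2 * N + 2)) * qbinom q N 0
            + q ^ (N + 1) * qbinom q N 0 + q ^ (N + 2) * qbinom q N (Suc 0)"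
proof -
  define x where "x = q ^ N"
  have "2 * N + 2 = (N + 1) + (N + 1)" "2 * N + 3 = (N + 1) + (N + 2)" by simp_all
  then have sq: "q ^ (2 * N + 2) = q ^ (N + 1) * q ^ (N + 1)" "q ^ (2 * N + 3) = q ^ (N + 1) * q ^ (N + 2)"
    by (simp_all only: power_add)
  have pw1: "q ^ (N + 1) = q * x" "q ^ (N + 2) = q * (q * x)"
    by (simp_all add: x_def)
  have pw: "q ^ (N + 1) = q * x" "q ^ (N + 2) = q * (q * x)"
    "q ^ (2 * N + 2) = q * x * (q * x)" "q ^ (2 * N + 3) = q\<^sup>2 * x * (q * x)"
    unfolding sq pw1 by (simp_all add: power2_eq_square)
  have nz: "1 - q * x \<noteq> 0" "1 - q * (q * x) \<noteq> 0"
    using one_minus_power_neq_0[OF q, of "N + 1"] one_minus_power_neq_0[OF q, of "N + 2"]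
    unfolding pw1 by simp_all
  have a: "qbinom q N (Suc 0) * (1 - q * (q * x)) = qbinom q N 0 * (1 - x)"
    using qbinom_Suc_right[OF q le0, of N] unfolding add_0_right pw diff_zero x_def[symmetric] .
  have c: "qbinom q (Suc N) 0 * ((1 - q * x) * (1 - q * (q * x)))
      = qbinom q N 0 * ((1 - q * x * (q * x)) * (1 - q\<^sup>2 * x * (q * x)))"
    using qbinom_Suc_left[OF q le0, of N] unfolding diff_zero add_0_right pw .
  have "qbinom q (Suc N) 0 * ((1 - q * x) * (1 - q * (q * x)))
      = ((1 + q * x * (q * x)) * qbinom q N 0 + q * x * qbinom q N 0 + q * (q * x) * qbinom q N (Suc 0))
         * ((1 - q * x) * (1 - q * (q * x)))"
  proof -
    have a': "q * (q * x) * qbinom q N (Suc 0) * ((1 - q * x) * (1 - q * (q * x)))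
        = qbinom q N 0 * (q * (q * x) * ((1 - x) * (1 - q * x)))"
      using arg_cong[OF a, of "\<lambda>t. q * (q * x) * t * (1 - q * x)"] by (simp only: mult_ac)
    have e: "(1 - q * x * (q * x)) * (1 - q\<^sup>2 * x * (q * x))
        = (1 + q * x * (q * x) + q * x) * ((1 - q * x) * (1 - q * (q * x)))
          + q * (q * x) * ((1 - x) * (1 - q * x))"
      by (simp add: algebra_simps power2_eq_square)
    show ?thesis
      unfolding c e distrib_right[of _ _ "(1 - q * x) * (1 - q * (q * x))"] a'
        distrib_left[of "qbinom q N 0"] by (simp add: mult_ac) (simp add: algebra_simps)
  qed
  then show ?thesis unfolding pw using nz by simp
qed

text \<open>With \<open>w = z + 1/z - 2\<close>, the \<open>n\<close>-th polynomial in \<open>w\<close> is the Dirichlet kernel \<open>\<Sum> z\<^sup>i\<close>, \<open>-n \<le> i \<le> n\<close>.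
  In the variable \<open>w\<close>, expanding the triple product at \<open>z = 1\<close> amounts to comparing the coefficients
  of \<open>w\<^sup>0\<close>, \<open>w\<^sup>1\<close>, \<open>w\<^sup>2\<close> in a polynomial identity.\<close>

fun dirichlet :: "nat \<Rightarrow> complex poly" where
  "dirichlet 0 = 1"
| "dirichlet (Suc 0) = [:3, 1:]"
| "dirichlet (Suc (Suc n)) = [:2, 1:] * dirichlet (Suc n) - dirichlet n"

definition tri :: "nat \<Rightarrow> nat" where "tri n = n * (n + 1) div 2"

lemma tri_simps [simp]: "tri 0 = 0" "tri (Suc n) = tri n + Suc n"
  by (simp_all add: tri_def)

lemma dirichlet_mult:
  "[:2, 1:] * dirichlet 0 = dirichlet (Suc 0) - dirichlet 0"
  "[:2, 1:] * dirichlet (Suc n) = dirichlet (Suc (Suc n)) + dirichlet n"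
  by (simp_all add: one_pCons)

text \<open>Once the sign s = (-1)^n and the triangular powers t, t u, t u v are part of the
  coefficients, the unequal factors q^(N-n) and q^(N+3+n) of \<open>qbinom_rec\<close> both turn
  into the single factor b = q^(N+1).\<close>

lemma coeff_step_aux:
  fixes s t u v a b d :: complex
  assumes "a * u = b" "d = b * v"
  shows "- s * (t * u) * (A * g1 + a * g0 + d * g2)
       = A * (- s * (t * u) * g1) - b * (s * t * g0) - b * (s * (t * u * v) * g2)"
  unfolding assms(2) assms(1)[symmetric] by (simp add: algebra_simps)

text \<open>For w = z + 1/z - 2 the k-th factor is (1 - z q^(k+1)) (1 - q^(k+1)/z). The factor added
  in the induction step is A - B (w + 2), and multiplication by w + 2 = z + 1/z moves a Dirichlet
  kernel one step up and one step down (\<open>dirichlet_mult\<close>), so the step reduces to the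
  recurrence for the Gaussian binomials.\<close>

lemma finite_triple_product:
  assumes q: "norm q < 1"
  shows "(\<Prod>k<N. [:(1 - q ^ Suc k)\<^sup>2, - (q ^ Suc k):])
       = (\<Sum>n\<le>N. smult ((-1) ^ n * q ^ tri n * qbinom q N n) (dirichlet n))"
proof (induction N)
  case 0
  then show ?case using q by (simp add: qbinom_diag)
next
  case (Suc N)
  define c where "c M n = (-1) ^ n * q ^ tri n * qbinom q M n" for M n
  define A B where "A = 1 + q ^ (2 * N + 2)" and "B = q ^ (N + 1)"
  have c_gt: "c N n = 0" if "n > N" for n using that by (simp add: c_def qbinom_gt)
  have fac: "[:(1 - q ^ Suc N)\<^sup>2, - (q ^ Suc N):] = [:A:] - smult B [:2, 1:]"
  proof -
    have "(1 - q ^ Suc N)\<^sup>2 = A - B * 2"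
    proof -
      have "2 * N + 2 = (N + 1) + (N + 1)" by simp
      then have "A = 1 + B * B" unfolding A_def B_def by (simp only: power_add)
      then show ?thesis by (simp add: B_def power2_eq_square algebra_simps)
    qed
    moreover have "[:A:] - smult B [:2, 1:] = [:A - B * 2, - B:]" by simp
    ultimately show ?thesis by (simp only: B_def Suc_eq_plus1)
  qed
  have rec0: "c (Suc N) 0 = A * c N 0 + B * c N 0 - B * c N 1"
    unfolding c_def qbinom_rec_0[OF q] A_def B_def by (simp add: algebra_simps)
  have rec: "c (Suc N) (Suc n) = A * c N (Suc n) - B * c N n - B * c N (Suc (Suc n))" if "n \<le> N" for n
  proof -
    have 1: "q ^ (N - n) * q ^ Suc n = q ^ (N + 1)"
      using that by (subst power_add[symmetric]) simp
    have 2: "q ^ (N + 3 + n) = q ^ (N + 1) * q ^ (n + 2)"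
      by (subst power_add[symmetric]) (simp add: eval_nat_numeral)
    have 3: "c N (Suc (Suc n)) = (-1) ^ n * (q ^ tri n * q ^ Suc n * q ^ (n + 2)) * qbinom q N (Suc (Suc n))"
      by (simp add: c_def power_add mult_ac)
    have 4: "c M (Suc n) = - ((-1) ^ n) * (q ^ tri n * q ^ Suc n) * qbinom q M (Suc n)" for M
      by (simp add: c_def power_add mult_ac)
    show ?thesis
      unfolding 3 4 qbinom_rec[OF q that] unfolding c_def A_def B_def
      by (rule coeff_step_aux[OF 1 2])
  qed
  have "(\<Prod>k<Suc N. [:(1 - q ^ Suc k)\<^sup>2, - (q ^ Suc k):])
      = (\<Sum>n\<le>N. smult (c N n) (dirichlet n)) * ([:A:] - smult B [:2, 1:])"
    unfolding prod.lessThan_Suc Suc.IH fac c_def ..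
  \<comment> \<open>The terms with n > N vanish; adding two of them leaves room for both index
    shifts.\<close>
  also have "\<dots> = (\<Sum>n\<le>Suc (Suc N). smult (c N n) (dirichlet n)) * ([:A:] - smult B [:2, 1:])"
    by (simp add: c_gt)
  also have "\<dots> = (\<Sum>n\<le>Suc (Suc N). smult (A * c N n) (dirichlet n))
      - (\<Sum>n\<le>Suc (Suc N). smult (B * c N n) ([:2, 1:] * dirichlet n))"
    unfolding right_diff_distrib sum_distrib_right
    by (simp only: mult_smult_left mult_smult_right smult_smult mult.commute[of "dirichlet _"])
       (simp add: mult.commute)
  also have "(\<Sum>n\<le>Suc (Suc N). smult (B * c N n) ([:2, 1:] * dirichlet n))
      = smult (B * c N 0) (dirichlet (Suc 0) - dirichlet 0)
        + (\<Sum>n\<le>Suc N. smult (B * c N (Suc n)) (dirichlet (Suc (Suc n)) + dirichlet n))"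
    unfolding sum.atMost_Suc_shift[of _ "Suc N"] dirichlet_mult ..
  also have "\<dots> = (\<Sum>n\<le>Suc (Suc N). smult (B * c N n) (dirichlet (Suc n)))
      - smult (B * c N 0) (dirichlet 0) + (\<Sum>n\<le>Suc N. smult (B * c N (Suc n)) (dirichlet n))"
    unfolding sum.atMost_Suc_shift[of "\<lambda>n. smult (B * c N n) (dirichlet (Suc n))" "Suc N"]
    by (simp only: smult_add_right smult_diff_right sum.distrib) (simp only: algebra_simps)
  also have "(\<Sum>n\<le>Suc (Suc N). smult (B * c N n) (dirichlet (Suc n))) = (\<Sum>n\<le>N. smult (B * c N n) (dirichlet (Suc n)))"
    by (simp add: c_gt)
  also have "(\<Sum>n\<le>Suc N. smult (B * c N (Suc n)) (dirichlet n))
      = smult (B * c N 1) (dirichlet 0) + (\<Sum>n\<le>N. smult (B * c N (Suc (Suc n))) (dirichlet (Suc n)))"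
    unfolding sum.atMost_Suc_shift[of _ N] by (simp only: One_nat_def)
  also have "(\<Sum>n\<le>Suc (Suc N). smult (A * c N n) (dirichlet n))
      = smult (A * c N 0) (dirichlet 0) + (\<Sum>n\<le>N. smult (A * c N (Suc n)) (dirichlet (Suc n)))"
    unfolding sum.atMost_Suc[of _ "Suc N"] sum.atMost_Suc_shift[of _ N] by (simp add: c_gt)
  also have "smult (A * c N 0) (dirichlet 0) + (\<Sum>n\<le>N. smult (A * c N (Suc n)) (dirichlet (Suc n)))
      - ((\<Sum>n\<le>N. smult (B * c N n) (dirichlet (Suc n))) - smult (B * c N 0) (dirichlet 0)
         + (smult (B * c N 1) (dirichlet 0) + (\<Sum>n\<le>N. smult (B * c N (Suc (Suc n))) (dirichlet (Suc n)))))
      = smult (c (Suc N) 0) (dirichlet 0) + (\<Sum>n\<le>N. smult (c (Suc N) (Suc n)) (dirichlet (Suc n)))"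
    unfolding rec0 by (simp add: rec smult_diff_left smult_add_left sum_subtractf del: dirichlet.simps)
  also have "\<dots> = (\<Sum>n\<le>Suc N. smult (c (Suc N) n) (dirichlet n))"
    unfolding sum.atMost_Suc_shift[of _ N] ..
  finally show ?case unfolding c_def .
qed

section \<open>Passage to the limit in the finite identity\<close>

lemma qbinom_tendsto:
  assumes q: "norm q < 1"
  shows "(\<lambda>N. qbinom q N n) \<longlonglongrightarrow> 1 / euler q"
proof -
  have lim: "qfact q \<longlonglongrightarrow> euler q" by (rule qfact_tendsto[OF q])
  have l1: "(\<lambda>N. qfact q (2 * N + 1)) \<longlonglongrightarrow> euler q"
    by (rule filterlim_compose[OF lim]) real_asymp
  have l2: "(\<lambda>N. qfact q (N - n)) \<longlonglongrightarrow> euler q"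
    by (rule filterlim_compose[OF lim]) (rule filterlim_minus_const_nat_at_top)
  have l3: "(\<lambda>N. qfact q (N + 1 + n)) \<longlonglongrightarrow> euler q"
    using LIMSEQ_ignore_initial_segment[OF lim, of "1 + n"] by (simp add: add.assoc)
  have "(\<lambda>N. qfact q (2 * N + 1) / (qfact q (N - n) * qfact q (N + 1 + n)))
      \<longlonglongrightarrow> euler q / (euler q * euler q)"
    using euler_neq_0[OF q] by (intro tendsto_divide tendsto_mult l1 l2 l3) auto
  also have "euler q / (euler q * euler q) = 1 / euler q" using euler_neq_0[OF q] by simp
  finally show ?thesis
    by (rule Lim_transform_eventually)
       (use eventually_ge_at_top[of n] in eventually_elim, simp add: qbinom_def)
qed

lemma qbinom_bounded:
  assumes q: "norm q < 1"
  obtains B where "\<And>N n. norm (qbinom q N n) \<le> B"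
proof -
  have lim: "qfact q \<longlonglongrightarrow> euler q" by (rule qfact_tendsto[OF q])
  obtain K where K: "\<And>n. norm (qfact q n) \<le> K"
    using convergent_imp_Bseq[OF convergentI[OF lim]] unfolding Bseq_def by blast
  have "(\<lambda>n. inverse (qfact q n)) \<longlonglongrightarrow> inverse (euler q)"
    by (intro tendsto_inverse lim euler_neq_0 q)
  from convergent_imp_Bseq[OF convergentI[OF this]]
  obtain L where L: "\<And>n. norm (inverse (qfact q n)) \<le> L"
    unfolding Bseq_def by blast
  have K0: "0 \<le> K" and L0: "0 \<le> L" using K[of 0] L[of 0] by (auto intro: order_trans[OF norm_ge_zero])
  have "norm (qbinom q N n) \<le> K * (L * L)" for N n
  proof (cases "n \<le> N")
    case True
    have "norm (qbinom q N n) = norm (qfact q (2 * N + 1)) *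
        (norm (inverse (qfact q (N - n))) * norm (inverse (qfact q (N + 1 + n))))"
      using True by (simp add: qbinom_def norm_mult norm_divide norm_inverse divide_inverse)
    also have "\<dots> \<le> K * (L * L)"
      by (intro mult_mono K L K0 L0 mult_nonneg_nonneg norm_ge_zero)
    finally show ?thesis .
  next
    case False
    then show ?thesis using K0 L0 by (simp add: qbinom_def)
  qed
  then show ?thesis by (rule that)
qed

text \<open>Tannery's theorem: the terms converge one by one, and the uniform bound from
  \<open>qbinom_bounded\<close> dominates them.\<close>

lemma sum_qbinom_tendsto:
  assumes q: "norm q < 1" and c: "summable (\<lambda>k. norm (c k * q ^ tri k))"
  shows "(\<lambda>N. \<Sum>k\<le>N. c k * q ^ tri k * qbinom q N k) \<longlonglongrightarrow> (\<Sum>k. c k * q ^ tri k) / euler q"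
proof -
  obtain B where B: "\<And>N n. norm (qbinom q N n) \<le> B" using qbinom_bounded[OF q] by blast
  have "((\<lambda>N. \<Sum>k. c k * q ^ tri k * qbinom q N k) \<longlonglongrightarrow> (\<Sum>k. c k * q ^ tri k * (1 / euler q)))"
  proof (rule tannerys_theorem[THEN conjunct2, THEN conjunct2])
    show "(\<lambda>N. c k * q ^ tri k * qbinom q N k) \<longlonglongrightarrow> c k * q ^ tri k * (1 / euler q)" for k
      by (intro tendsto_mult tendsto_const qbinom_tendsto q)
    show "\<forall>\<^sub>F (k, N) in sequentially \<times>\<^sub>F sequentially.
        norm (c k * q ^ tri k * qbinom q N k) \<le> norm (c k * q ^ tri k) * B"
      by (intro always_eventually) (auto simp: norm_mult intro!: mult_left_mono B)
    show "summable (\<lambda>k. norm (c k * q ^ tri k) * B)" by (intro summable_mult2 c)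
  qed simp
  also have "(\<lambda>N. \<Sum>k. c k * q ^ tri k * qbinom q N k) = (\<lambda>N. \<Sum>k\<le>N. c k * q ^ tri k * qbinom q N k)"
    by (intro ext suminf_finite) (auto simp: qbinom_gt)
  also have "(\<Sum>k. c k * q ^ tri k * (1 / euler q)) = (\<Sum>k. c k * q ^ tri k) * (1 / euler q)"
    by (intro suminf_mult2[symmetric] summable_norm_cancel[OF c])
  finally show ?thesis by simp
qed

text \<open>Consecutive terms have ratio X |q|^(k+1), which tends to 0; the triangular exponent thus
  beats any exponential growth of coefficients, and crude bounds suffice later.\<close>

lemma summable_tri:
  fixes q :: complex and X :: real
  assumes q: "norm q < 1"
  shows "summable (\<lambda>k. X ^ k * norm q ^ tri k)"
proof -
  have lim: "(\<lambda>k. \<bar>X\<bar> * norm q ^ Suc k) \<longlonglongrightarrow> \<bar>X\<bar> * 0"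
    using q by (intro tendsto_mult tendsto_const LIMSEQ_Suc LIMSEQ_power_zero) auto
  then have "\<forall>\<^sub>F k in sequentially. \<bar>X\<bar> * norm q ^ Suc k < 1 / 2"
    by (rule order_tendstoD) simp
  then obtain K where K: "\<And>k. k \<ge> K \<Longrightarrow> \<bar>X\<bar> * norm q ^ Suc k < 1 / 2"
    by (auto simp: eventually_sequentially)
  show ?thesis
  proof (rule summable_ratio_test[of "1 / 2" K])
    fix k assume "k \<ge> K"
    have "norm (X ^ Suc k * norm q ^ tri (Suc k)) = (\<bar>X\<bar> * norm q ^ Suc k) * norm (X ^ k * norm q ^ tri k)"
      by (simp add: norm_mult norm_power power_add abs_mult power_abs)
    also have "\<dots> \<le> 1 / 2 * norm (X ^ k * norm q ^ tri k)"
      using K[OF \<open>k \<ge> K\<close>] by (intro mult_right_mono) auto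
    finally show "norm (X ^ Suc k * norm q ^ tri (Suc k)) \<le> 1 / 2 * norm (X ^ k * norm q ^ tri k)" .
  qed simp
qed

lemma summable_tri_mult:
  fixes q :: complex
  assumes q: "norm q < 1" and c: "\<And>k. norm (c k) \<le> A * X ^ k"
  shows "summable (\<lambda>k. norm (c k * q ^ tri k))"
proof (rule summable_comparison_test')
  show "summable (\<lambda>k. A * (X ^ k * norm q ^ tri k))"
    by (intro summable_mult summable_tri q)
  show "norm (norm (c k * q ^ tri k)) \<le> A * (X ^ k * norm q ^ tri k)" if "k \<ge> 0" for k
    using mult_right_mono[OF c[of k], of "norm q ^ tri k"]
    by (simp add: norm_mult norm_power mult.assoc)
qed

section \<open>Values and low coefficients of the Dirichlet kernels\<close>

lemma poly_dirichlet:
  fixes z :: complex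
  assumes z: "z \<noteq> 0"
  shows "(1 - z) * poly (dirichlet n) (z + 1 / z - 2) = (1 / z) ^ n - z ^ Suc n"
proof (induction n rule: dirichlet.induct)
  case 2
  show ?case using z by (simp add: field_simps power2_eq_square)
next
  case (3 n)
  have step: "(z + y) * (y * a - z * b) - (a - b) = y * (y * a) - z * (z * b)" if "z * y = 1" for y a b
  proof -
    have "(z + y) * (y * a - z * b) - (a - b) = (z * y) * a - z * (z * b) + y * (y * a) - (z * y) * b - (a - b)"
      by (simp add: algebra_simps)
    then show ?thesis unfolding that by simp
  qed
  have "poly (dirichlet (Suc (Suc n))) w = (w + 2) * poly (dirichlet (Suc n)) w - poly (dirichlet n) w" for w
    by (simp add: algebra_simps)
  then have "(1 - z) * poly (dirichlet (Suc (Suc n))) (z + 1 / z - 2)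
      = (z + 1 / z) * ((1 - z) * poly (dirichlet (Suc n)) (z + 1 / z - 2)) - (1 - z) * poly (dirichlet n) (z + 1 / z - 2)"
    by (simp only: diff_add_cancel right_diff_distrib mult_ac)
  also have "\<dots> = (z + 1 / z) * ((1 / z) ^ Suc n - z ^ Suc (Suc n)) - ((1 / z) ^ n - z ^ Suc n)"
    unfolding 3 ..
  also have "\<dots> = (1 / z) ^ Suc (Suc n) - z ^ Suc (Suc (Suc n))"
    unfolding power_Suc[of "1 / z"] power_Suc[of z "Suc n"] power_Suc[of z "Suc (Suc n)"] by (rule step) (use z in simp)
  finally show ?case .
qed simp

text \<open>The recurrence multiplies by at most |w| + 2 and adds an earlier term; the base |w| + 3
  absorbs both.\<close>

lemma poly_dirichlet_bound:
  "norm (poly (dirichlet n) w) \<le> (norm w + 3) ^ n"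
proof (induction n rule: dirichlet.induct)
  case 2
  show ?case using norm_triangle_ineq[of 3 w] by simp
next
  case (3 n)
  let ?r = "norm w + 3"
  have r: "?r ^ n \<le> ?r ^ Suc n" by (intro power_increasing) auto
  have "norm (poly (dirichlet (Suc (Suc n))) w) \<le> norm (2 + w) * norm (poly (dirichlet (Suc n)) w) + norm (poly (dirichlet n) w)"
    using norm_triangle_ineq4[of "(2 + w) * poly (dirichlet (Suc n)) w" "poly (dirichlet n) w"]
    unfolding norm_mult by (simp add: distrib_right)
  also have "\<dots> \<le> (norm w + 2) * ?r ^ Suc n + ?r ^ Suc n"
    using 3 r norm_triangle_ineq[of 2 w] by (intro add_mono mult_mono) auto
  also have "\<dots> = ?r ^ Suc (Suc n)" by (simp add: algebra_simps)
  finally show ?case .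
qed simp

text \<open>The coefficient of w^j in the n-th kernel is (2n+1)/(2j+1) times binom(n+j, 2j). For j =
  0, 1, 2 it is 2n+1 times a polynomial in the triangular number, and against q^(tri n) such a
  polynomial acts as a differential operator in q d/dq.\<close>

lemma coeff_dirichlet_0: "coeff (dirichlet n) 0 = of_nat (2 * n + 1)"
  by (induction n rule: dirichlet.induct) (auto simp: algebra_simps)

lemma of_nat_tri: "(of_nat (tri n) :: 'a :: field_char_0) = of_nat n * (of_nat n + 1) / 2"
  by (induction n) (auto simp: field_simps)

lemma coeff_dirichlet_Suc:
  "coeff (dirichlet (Suc (Suc n))) (Suc m) = 2 * coeff (dirichlet (Suc n)) (Suc m) + coeff (dirichlet (Suc n)) m - coeff (dirichlet n) (Suc m)"
  by simp

lemma coeff_dirichlet_1: "coeff (dirichlet n) (Suc 0) = of_nat (2 * n + 1) * of_nat (tri n) / 3"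
proof (induction n rule: dirichlet.induct)
  case (3 n)
  define x :: complex where "x = of_nat n"
  have x: "of_nat (Suc n) = x + 1" "of_nat (Suc (Suc n)) = x + 2" by (simp_all add: x_def)
  show ?case
    unfolding coeff_dirichlet_Suc 3 coeff_dirichlet_0 of_nat_tri of_nat_add of_nat_mult x x_def[symmetric]
    by (simp add: field_simps)
qed simp_all

lemma coeff_dirichlet_2:
  "coeff (dirichlet n) (Suc (Suc 0)) = of_nat (2 * n + 1) * of_nat (tri n) * (of_nat (tri n) - 1) / 30"
proof (induction n rule: dirichlet.induct)
  case (3 n)
  define x t :: complex where "x = of_nat n" and "t = of_nat (tri n)"
  have t: "2 * t = x * (x + 1)" by (simp add: x_def t_def of_nat_tri)
  have sub: "of_nat (2 * n + 1) = 2 * x + 1" "of_nat (2 * Suc n + 1) = 2 * x + 3"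
    "of_nat (2 * Suc (Suc n) + 1) = 2 * x + 5" "of_nat (tri (Suc n)) = t + x + 1"
    "of_nat (tri (Suc (Suc n))) = t + 2 * x + 3"
    by (simp_all add: x_def t_def)
  \<comment> \<open>Treating \<open>t\<close> as an unknown keeps the degree low: the two sides to
    be compared differ by a multiple of \<open>2 * t - x * (x + 1)\<close>, which is zero for the
    triangular number.\<close>
  have "2 * ((2 * x + 3) * (t + x + 1) * (t + x + 1 - 1)) + 10 * ((2 * x + 3) * (t + x + 1))
      - (2 * x + 1) * t * (t - 1) - (2 * x + 5) * (t + 2 * x + 3) * (t + 2 * x + 3 - 1)
      = (4 * x + 6) * (2 * t - x * (x + 1))"
    by (simp add: algebra_simps)
  then have "2 * ((2 * x + 3) * (t + x + 1) * (t + x + 1 - 1)) + 10 * ((2 * x + 3) * (t + x + 1))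
      - (2 * x + 1) * t * (t - 1) = (2 * x + 5) * (t + 2 * x + 3) * (t + 2 * x + 3 - 1)"
    unfolding t by simp
  then have "(2 * ((2 * x + 3) * (t + x + 1) * (t + x + 1 - 1)) + 10 * ((2 * x + 3) * (t + x + 1))
      - (2 * x + 1) * t * (t - 1)) / 30 = (2 * x + 5) * (t + 2 * x + 3) * (t + 2 * x + 3 - 1) / 30"
    by (simp only:)
  moreover have "2 * (a / 30) + b / 3 - c / 30 = (2 * a + 10 * b - c) / 30" for a b c :: complex
    by simp
  ultimately show ?case
    unfolding coeff_dirichlet_Suc 3 coeff_dirichlet_1 sub t_def[symmetric] by (simp only:)
qed simp_all

text \<open>The finite identity is evaluated at w = z + 1/z - 2 and N sent to infinity.
  Multiplication by 1 - z then completes the product (zq; q) to (z; q) and turns each kernel into a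
  difference of two powers, so z = 1 needs no exception.\<close>

lemma triple_product_nat:
  assumes q: "norm q < 1" and z: "z \<noteq> 0"
  shows "(\<lambda>k. (-1) ^ k * q ^ tri k * ((1 / z) ^ k - z ^ Suc k)) sums (qpoch_inf z q * qpoch_inf (q / z) q * euler q)"
proof -
  define w where "w = z + 1 / z - 2"
  define c where "c k = (-1) ^ k * poly (dirichlet k) w" for k
  have c: "summable (\<lambda>k. norm (c k * q ^ tri k))"
    by (rule summable_tri_mult[OF q, of _ 1 "norm w + 3"])
       (simp add: c_def norm_mult norm_power poly_dirichlet_bound)
  have "(\<lambda>N. (\<Prod>k<N. 1 - (z * q) * q ^ k) * (\<Prod>k<N. 1 - (q / z) * q ^ k)) = (\<lambda>N. \<Sum>k\<le>N. c k * q ^ tri k * qbinom q N k)"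
  proof
    fix N
    have "(\<Prod>k<N. 1 - (z * q) * q ^ k) * (\<Prod>k<N. 1 - (q / z) * q ^ k)
        = poly (\<Prod>k<N. [:(1 - q ^ Suc k)\<^sup>2, - (q ^ Suc k):]) w"
      unfolding poly_prod prod.distrib[symmetric]
    proof (rule prod.cong[OF refl])
      fix k
      have "(1 - z * y) * (1 - y / z) = (1 - y)\<^sup>2 + w * - y" for y
        using z by (simp add: w_def field_simps power2_eq_square)
      from this[of "q ^ Suc k"]
      show "(1 - z * q * q ^ k) * (1 - q / z * q ^ k) = poly [:(1 - q ^ Suc k)\<^sup>2, - (q ^ Suc k):] w"
        by (simp add: mult.assoc)
    qed
    also have "\<dots> = (\<Sum>k\<le>N. c k * q ^ tri k * qbinom q N k)"
      unfolding finite_triple_product[OF q] poly_sum by (simp add: c_def mult_ac)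
    finally show "(\<Prod>k<N. 1 - (z * q) * q ^ k) * (\<Prod>k<N. 1 - (q / z) * q ^ k)
        = (\<Sum>k\<le>N. c k * q ^ tri k * qbinom q N k)" .
  qed
  moreover have "(\<lambda>N. (\<Prod>k<N. 1 - (z * q) * q ^ k) * (\<Prod>k<N. 1 - (q / z) * q ^ k))
      \<longlonglongrightarrow> qpoch_inf (z * q) q * qpoch_inf (q / z) q"
    by (intro tendsto_mult qpoch_inf_tendsto q)
  ultimately have "(\<lambda>N. \<Sum>k\<le>N. c k * q ^ tri k * qbinom q N k) \<longlonglongrightarrow> qpoch_inf (z * q) q * qpoch_inf (q / z) q"
    by simp
  then have "qpoch_inf (z * q) q * qpoch_inf (q / z) q = (\<Sum>k. c k * q ^ tri k) / euler q"
    using sum_qbinom_tendsto[OF q c] by (rule LIMSEQ_unique)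
  then have eq: "(\<Sum>k. c k * q ^ tri k) = qpoch_inf (z * q) q * qpoch_inf (q / z) q * euler q"
    using euler_neq_0[OF q] by (simp add: field_simps)
  have head: "qpoch_inf z q = (1 - z) * qpoch_inf (z * q) q"
  proof -
    have "(\<lambda>n. \<Prod>k<Suc n. 1 - z * q ^ k) \<longlonglongrightarrow> qpoch_inf z q"
      by (intro LIMSEQ_Suc qpoch_inf_tendsto q)
    moreover have "(\<lambda>n. \<Prod>k<Suc n. 1 - z * q ^ k) = (\<lambda>n. (1 - z) * (\<Prod>k<n. 1 - (z * q) * q ^ k))"
      unfolding prod.lessThan_Suc_shift by (simp add: mult.assoc)
    moreover have "(\<lambda>n. (1 - z) * (\<Prod>k<n. 1 - (z * q) * q ^ k)) \<longlonglongrightarrow> (1 - z) * qpoch_inf (z * q) q"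
      by (intro tendsto_mult tendsto_const qpoch_inf_tendsto q)
    ultimately show ?thesis by (metis LIMSEQ_unique)
  qed
  have "(\<lambda>k. (1 - z) * (c k * q ^ tri k)) sums ((1 - z) * (qpoch_inf (z * q) q * qpoch_inf (q / z) q * euler q))"
    unfolding eq[symmetric] by (intro sums_mult summable_sums summable_norm_cancel[OF c])
  moreover have "(1 - z) * (c k * q ^ tri k) = (-1) ^ k * q ^ tri k * ((1 / z) ^ k - z ^ Suc k)" for k
    unfolding poly_dirichlet[OF z, symmetric] c_def w_def by (simp only: mult_ac)
  ultimately have "(\<lambda>k. (-1) ^ k * q ^ tri k * ((1 / z) ^ k - z ^ Suc k))
      sums ((1 - z) * (qpoch_inf (z * q) q * qpoch_inf (q / z) q * euler q))"
    by (simp only:)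
  then show ?thesis by (simp only: head mult.assoc)
qed

text \<open>With the constants \<open>u k\<close> taken out, the factors are 1 - (v/u) w, and the
  coefficients are elementary symmetric functions of the ratios. The second one is written through
  power sums, (p_1^2 - p_2)/2, because these converge to Lambert series.\<close>

lemma coeff_prod_linear:
  fixes u v :: "nat \<Rightarrow> complex"
  assumes u: "\<And>k. u k \<noteq> 0"
  shows "coeff (\<Prod>k<N. [:u k, - v k:]) 0 = (\<Prod>k<N. u k)" (is ?A)
    and "coeff (\<Prod>k<N. [:u k, - v k:]) (Suc 0) = - (\<Prod>k<N. u k) * (\<Sum>k<N. v k / u k)" (is ?B)
    and "coeff (\<Prod>k<N. [:u k, - v k:]) (Suc (Suc 0)) = (\<Prod>k<N. u k) * ((\<Sum>k<N. v k / u k)\<^sup>2 - (\<Sum>k<N. (v k / u k)\<^sup>2)) / 2" (is ?C)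
proof -
  have "?A \<and> ?B \<and> ?C"
  proof (induction N)
    case (Suc N)
    let ?P = "\<Prod>k<N. [:u k, - v k:]"
    have split: "coeff (\<Prod>k<Suc N. [:u k, - v k:]) 0 = coeff ?P 0 * u N"
      "coeff (\<Prod>k<Suc N. [:u k, - v k:]) (Suc m) = coeff ?P (Suc m) * u N - coeff ?P m * v N" for m
      by (simp_all add: mult.commute[of ?P] coeff_pCons split: nat.splits)
    have 2: "p * ((s\<^sup>2 - t) / 2) * a - (- p * s) * b = p * a * (((s + b / a)\<^sup>2 - (t + (b / a)\<^sup>2)) / 2)"
      if "a \<noteq> 0" for p s t a b :: complex
      using that by (simp add: field_simps power2_eq_square)
    have 1: "- p * s * a - p * b = - (p * a) * (s + b / a)" if "a \<noteq> 0" for p s a b :: complex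
      using that by (simp add: field_simps)
    show ?case
      unfolding split unfolding conjunct1[OF Suc.IH] conjunct1[OF conjunct2[OF Suc.IH]] conjunct2[OF conjunct2[OF Suc.IH]]
        prod.lessThan_Suc sum.lessThan_Suc times_divide_eq_right[symmetric]
      using 1[OF u[of N]] 2[OF u[of N]] by blast
  qed auto
  then show ?A ?B ?C by blast+
qed

section \<open>Lambert series and the differential equation for the Eisenstein series\<close>

text \<open>The generating function of the divisor sum sigma_1, written so that its terms are the
  ratios v/u of the linear factors in the finite triple product. Likewise \<open>lambert3\<close>
  belongs to sigma_3.\<close>

definition lambert1 :: "complex \<Rightarrow> complex" where
  "lambert1 q = (\<Sum>k. q ^ Suc k / (1 - q ^ Suc k)\<^sup>2)"

definition lambert3 :: "complex \<Rightarrow> complex" where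
  "lambert3 q = (\<Sum>k. of_nat (Suc k) ^ 3 * q ^ Suc k / (1 - q ^ Suc k))"

lemma norm_one_minus_power_ge:
  fixes q :: complex
  assumes "norm q < 1"
  shows "1 - norm q \<le> norm (1 - q ^ Suc k)"
proof -
  have "norm q ^ Suc k \<le> norm q ^ 1" using assms by (intro power_decreasing) auto
  moreover have "norm (1::complex) - norm (q ^ Suc k) \<le> norm (1 - q ^ Suc k)" by (rule norm_triangle_ineq2)
  ultimately show ?thesis unfolding norm_power by simp
qed

lemma norm_lambert_term_le:
  fixes q :: complex
  assumes q: "norm q < 1"
  shows "norm (q ^ Suc k / (1 - q ^ Suc k) ^ j) \<le> norm q ^ Suc k / (1 - norm q) ^ j"
  unfolding norm_divide norm_power[of q] norm_power[of "1 - _"]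
  using q norm_one_minus_power_ge[OF q, of k]
  by (intro divide_left_mono power_mono mult_pos_pos zero_less_power) auto

lemma summable_lambert1:
  fixes q :: complex
  assumes q: "norm q < 1"
  shows "summable (\<lambda>k. norm (q ^ Suc k / (1 - q ^ Suc k)\<^sup>2))"
proof (rule summable_comparison_test')
  have "summable (\<lambda>k. norm q ^ k)" using q by (intro summable_geometric) auto
  then show "summable (\<lambda>k. norm q ^ Suc k / (1 - norm q)\<^sup>2)"
    by (intro summable_divide) (simp only: summable_Suc_iff)
  show "norm (norm (q ^ Suc k / (1 - q ^ Suc k)\<^sup>2)) \<le> norm q ^ Suc k / (1 - norm q)\<^sup>2" for k
    using norm_lambert_term_le[OF q, of k 2] by simp
qed

lemma summable_norm_power2:
  fixes f :: "nat \<Rightarrow> complex"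
  assumes "summable (\<lambda>k. norm (f k))"
  shows "summable (\<lambda>k. norm ((f k)\<^sup>2))"
proof (rule summable_comparison_test_ev)
  have "(\<lambda>k. norm (f k)) \<longlonglongrightarrow> 0" using assms by (rule summable_LIMSEQ_zero)
  then have "\<forall>\<^sub>F k in sequentially. norm (f k) < 1" by (rule order_tendstoD) simp
  then show "\<forall>\<^sub>F k in sequentially. norm (norm ((f k)\<^sup>2)) \<le> norm (f k)"
  proof eventually_elim
    case (elim k)
    then show ?case
      using mult_left_mono[of "norm (f k)" 1 "norm (f k)"] by (simp add: norm_mult power2_eq_square)
  qed
qed fact

text \<open>From n^3 = (n-1) n (n+1) + n: the first part comes from squaring the series of (n+1)
  x^n. The field is left generic so that the same formula serves for x and for the real number |x|
  in the dominating series.\<close>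

lemma cube_series_sums:
  fixes x :: "'a :: {real_normed_field, banach}"
  assumes x: "norm x < 1"
  shows "(\<lambda>m. of_nat (Suc m) ^ 3 * x ^ Suc m) sums (6 * x\<^sup>2 / (1 - x) ^ 4 + x / (1 - x)\<^sup>2)"
    and "summable (\<lambda>m. norm (of_nat (Suc m) ^ 3 * x ^ Suc m))"
proof -
  have main: "(\<lambda>m. of_nat (Suc m) ^ 3 * x ^ Suc m) sums (6 * x\<^sup>2 / (1 - x) ^ 4 + x / (1 - x)\<^sup>2)"
    if x: "norm x < 1" for x :: "'b :: {real_normed_field, banach}"
  proof -
    have g: "(\<lambda>n. of_nat (Suc n) * x ^ n) sums (1 / (1 - x)\<^sup>2)"
      by (rule geometric_deriv_sums[OF x])
    have gn: "summable (\<lambda>n. norm (of_nat (Suc n) * x ^ n))"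
      using sums_summable[OF geometric_deriv_sums[of "norm x"]] x
      by (simp add: norm_mult norm_power del: of_nat_Suc)
    have conv: "(\<Sum>i\<le>m. of_nat (Suc i) * x ^ i * (of_nat (Suc (m - i)) * x ^ (m - i)))
        = of_nat ((m + 1) * (m + 2) * (m + 3)) / 6 * x ^ m" for m
    proof -
      have "(\<Sum>i\<le>m. Suc i * Suc (m - i)) * 6 = (m + 1) * (m + 2) * (m + 3)"
      proof (induction m)
        case (Suc m)
        have lin: "2 * (\<Sum>i\<le>m. Suc i) = (m + 1) * (m + 2)" for m
          by (induction m) auto
        have "(\<Sum>i\<le>Suc m. Suc i * Suc (Suc m - i)) = (\<Sum>i\<le>m. Suc i * Suc (Suc m - i)) + Suc (Suc m)"
          by simp
        also have "(\<Sum>i\<le>m. Suc i * Suc (Suc m - i)) = (\<Sum>i\<le>m. Suc i * Suc (m - i) + Suc i)"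
          by (intro sum.cong refl) (auto simp: Suc_diff_le)
        also have "\<dots> = (\<Sum>i\<le>m. Suc i * Suc (m - i)) + (\<Sum>i\<le>m. Suc i)"
          by (rule sum.distrib)
        finally have "(\<Sum>i\<le>Suc m. Suc i * Suc (Suc m - i)) * 6
            = (\<Sum>i\<le>m. Suc i * Suc (m - i)) * 6 + 3 * (2 * (\<Sum>i\<le>m. Suc i)) + 6 * Suc (Suc m)"
          by (simp only: algebra_simps)
        then show ?case unfolding Suc.IH lin by (simp add: algebra_simps)
      qed simp
      then have "(of_nat ((\<Sum>i\<le>m. Suc i * Suc (m - i)) * 6) :: 'b) = of_nat ((m + 1) * (m + 2) * (m + 3))"
        by (simp only:)
      then have "(of_nat (\<Sum>i\<le>m. Suc i * Suc (m - i)) :: 'b) = of_nat ((m + 1) * (m + 2) * (m + 3)) / 6"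
        by (simp add: eq_divide_eq)
      moreover have "(\<Sum>i\<le>m. of_nat (Suc i) * x ^ i * (of_nat (Suc (m - i)) * x ^ (m - i)))
          = (\<Sum>i\<le>m. of_nat (Suc i * Suc (m - i)) * x ^ m)"
      proof (intro sum.cong refl)
        fix i assume "i \<in> {..m}"
        then have "x ^ i * x ^ (m - i) = x ^ m" by (subst power_add[symmetric]) simp
        then show "of_nat (Suc i) * x ^ i * (of_nat (Suc (m - i)) * x ^ (m - i)) = of_nat (Suc i * Suc (m - i)) * x ^ m"
          unfolding of_nat_mult by (metis mult.assoc mult.left_commute)
      qed
      ultimately show ?thesis by (simp only: sum_distrib_right[symmetric] of_nat_sum[symmetric])
    qed
    have "(\<lambda>m. of_nat ((m + 1) * (m + 2) * (m + 3)) / 6 * x ^ m) sums (1 / (1 - x)\<^sup>2 * (1 / (1 - x)\<^sup>2))"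
      using Cauchy_product_sums[OF gn gn] unfolding conv sums_unique[OF g, symmetric] .
    from sums_mult[OF this, of "6 * x\<^sup>2"]
    have sh: "(\<lambda>m. 6 * x\<^sup>2 * (of_nat ((m + 1) * (m + 2) * (m + 3)) / 6 * x ^ m)) sums (6 * x\<^sup>2 / (1 - x) ^ 4)"
      by (simp add: power2_eq_square power4_eq_xxxx mult.assoc)
    have "6 * x\<^sup>2 * (of_nat ((m + 1) * (m + 2) * (m + 3)) / 6 * x ^ m)
        = of_nat (Suc m * (Suc m + 1) * (Suc m + 2)) * x ^ Suc (Suc m)" for m
    proof -
      have "6 * x\<^sup>2 * (a / 6 * x ^ m) = a * x ^ Suc (Suc m)" for a :: 'b
        by (simp add: power2_eq_square mult_ac)
      moreover have "(m + 1) * (m + 2) * (m + 3) = Suc m * (Suc m + 1) * (Suc m + 2)" by (simp add: algebra_simps)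
      ultimately show ?thesis by (simp only:)
    qed
    then have "(\<lambda>m. of_nat (Suc m * (Suc m + 1) * (Suc m + 2)) * x ^ Suc (Suc m)) sums (6 * x\<^sup>2 / (1 - x) ^ 4)"
      using sh by (simp only:)
    then have "(\<lambda>m. of_nat (m * (m + 1) * (m + 2)) * x ^ Suc m) sums (6 * x\<^sup>2 / (1 - x) ^ 4)"
      by (subst (asm) sums_Suc_iff) simp
    from sums_add[OF this sums_mult[OF g, of x]]
    show ?thesis by (simp add: algebra_simps power3_eq_cube)
  qed
  show "(\<lambda>m. of_nat (Suc m) ^ 3 * x ^ Suc m) sums (6 * x\<^sup>2 / (1 - x) ^ 4 + x / (1 - x)\<^sup>2)"
    by (rule main[OF x])
  show "summable (\<lambda>m. norm (of_nat (Suc m) ^ 3 * x ^ Suc m))"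
    using sums_summable[OF main[of "norm x"]] x
    by (simp add: norm_mult norm_power del: of_nat_Suc)
qed


text \<open>Fubini for the double series of m^3 q^(nm). Summing over n first gives
  \<open>lambert3\<close>; summing over m first gives the closed form of the cube series. This
  evaluates the power sum p_2 of the ratios v/u as (lambert3 - lambert1)/6.\<close>

lemma has_sum_cube_double:
  fixes q :: complex
  assumes q: "norm q < 1"
  shows "((\<lambda>(n, m). of_nat (Suc m) ^ 3 * q ^ (Suc n * Suc m)) has_sum lambert3 q) (UNIV \<times> UNIV)"
    and "lambert3 q = 6 * (\<Sum>k. (q ^ Suc k / (1 - q ^ Suc k)\<^sup>2)\<^sup>2) + lambert1 q"
proof -
  have qk: "norm (q ^ Suc k) < 1" for k
    unfolding norm_power using q power_strict_mono[of "norm q" 1 "Suc k"] by simp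
  let ?f = "\<lambda>(n, m). of_nat (Suc m) ^ 3 * q ^ (Suc n * Suc m) :: complex"
  let ?b = "\<lambda>n. 6 * (q ^ Suc n / (1 - q ^ Suc n)\<^sup>2)\<^sup>2 + q ^ Suc n / (1 - q ^ Suc n)\<^sup>2"
  let ?r = "norm q"
  have b_eq: "6 * x\<^sup>2 / (1 - x) ^ 4 + x / (1 - x)\<^sup>2 = 6 * (x / (1 - x)\<^sup>2)\<^sup>2 + x / (1 - x)\<^sup>2"
    for x :: "'b :: {real_normed_field, banach}"
    by (simp add: power2_eq_square power4_eq_xxxx mult.assoc)
  have inner: "((\<lambda>m. ?f (n, m)) has_sum ?b n) UNIV" for n
    using norm_summable_imp_has_sum[OF cube_series_sums(2,1)[OF qk[of n]]]
    unfolding b_eq by (simp only: power_mult prod.case)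
  have innern: "((\<lambda>m. norm (?f (n, m))) has_sum (6 * (?r ^ Suc n / (1 - ?r ^ Suc n)\<^sup>2)\<^sup>2 + ?r ^ Suc n / (1 - ?r ^ Suc n)\<^sup>2)) UNIV" for n
  proof -
    have r: "norm (?r ^ Suc n) < 1" using qk[of n] unfolding norm_power by simp
    show ?thesis
      using norm_summable_imp_has_sum[OF cube_series_sums(2,1)[OF r]]
      unfolding b_eq by (simp only: power_mult prod.case norm_mult norm_power norm_of_nat)
  qed
  \<comment> \<open>The dominating real series is the same Lambert series at |q|, so the complex
    summability lemmas are applied at \<open>of_real (norm q)\<close>.\<close>
  have sb: "summable (\<lambda>n. 6 * (?r ^ Suc n / (1 - ?r ^ Suc n)\<^sup>2)\<^sup>2 + ?r ^ Suc n / (1 - ?r ^ Suc n)\<^sup>2)"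
  proof -
    let ?c = "of_real ?r :: complex"
    have eq: "norm (?c ^ Suc n / (1 - ?c ^ Suc n)\<^sup>2) = ?r ^ Suc n / (1 - ?r ^ Suc n)\<^sup>2" for n
    proof -
      have "?c ^ Suc n / (1 - ?c ^ Suc n)\<^sup>2 = of_real (?r ^ Suc n / (1 - ?r ^ Suc n)\<^sup>2)" by simp
      then show ?thesis by (simp only: norm_of_real) simp
    qed
    have c: "norm ?c < 1" using q by simp
    show ?thesis
      using summable_lambert1[OF c] summable_norm_power2[OF summable_lambert1[OF c]]
      unfolding norm_power[of "_ / _"] eq by (intro summable_add summable_mult)
  qed
  have abs: "(\<lambda>x. norm (?f x)) summable_on (UNIV \<times> UNIV)"
  proof (rule summable_on_SigmaI[OF innern])
    show "(\<lambda>n. 6 * (?r ^ Suc n / (1 - ?r ^ Suc n)\<^sup>2)\<^sup>2 + ?r ^ Suc n / (1 - ?r ^ Suc n)\<^sup>2) summable_on UNIV"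
      using sb by (rule summable_nonneg_imp_summable_on) (intro add_nonneg_nonneg mult_nonneg_nonneg, auto)
  qed auto
  then have summ: "?f summable_on (UNIV \<times> UNIV)" by (rule abs_summable_summable)
  have hs: "(?f has_sum infsum ?f (UNIV \<times> UNIV)) (UNIV \<times> UNIV)" using summ by simp
  have "(?b has_sum infsum ?f (UNIV \<times> UNIV)) UNIV"
    by (rule has_sum_SigmaD[OF hs]) (use inner in auto)
  then have 1: "?b sums infsum ?f (UNIV \<times> UNIV)" by (rule has_sum_imp_sums)
  have "((\<lambda>(m, n). ?f (n, m)) has_sum infsum ?f (UNIV \<times> UNIV)) (UNIV \<times> UNIV)"
    using hs by (subst (asm) has_sum_swap)
  then have "((\<lambda>m. of_nat (Suc m) ^ 3 * q ^ Suc m / (1 - q ^ Suc m)) has_sum infsum ?f (UNIV \<times> UNIV)) UNIV"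
  proof (rule has_sum_SigmaD)
    fix m :: nat
    have "(\<lambda>n. (q ^ Suc m) ^ n) sums (1 / (1 - q ^ Suc m))" by (rule geometric_sums[OF qk])
    moreover have "summable (\<lambda>n. norm ((q ^ Suc m) ^ n))"
      using qk[of m] by (simp add: norm_power[of "q ^ Suc m"] summable_geometric del: power_Suc)
    ultimately have "((\<lambda>n. (q ^ Suc m) ^ n) has_sum (1 / (1 - q ^ Suc m))) UNIV"
      by (intro norm_summable_imp_has_sum)
    from has_sum_cmult_right[OF this, of "of_nat (Suc m) ^ 3 * q ^ Suc m"]
    have "((\<lambda>n. of_nat (Suc m) ^ 3 * q ^ Suc m * (q ^ Suc m) ^ n) has_sum of_nat (Suc m) ^ 3 * q ^ Suc m / (1 - q ^ Suc m)) UNIV"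
      by simp
    moreover have "of_nat (Suc m) ^ 3 * q ^ Suc m * (q ^ Suc m) ^ n = of_nat (Suc m) ^ 3 * q ^ (Suc n * Suc m)" for n
      unfolding mult.commute[of "Suc n"] power_mult by (simp only: power_Suc[of "q ^ Suc m" n] mult.assoc)
    ultimately show "((\<lambda>n. case (m, n) of (m, n) \<Rightarrow> ?f (n, m)) has_sum of_nat (Suc m) ^ 3 * q ^ Suc m / (1 - q ^ Suc m)) UNIV"
      by (simp only: prod.case)
  qed
  then have 2: "infsum ?f (UNIV \<times> UNIV) = lambert3 q"
    unfolding lambert3_def using has_sum_imp_sums sums_unique by blast
  show "(?f has_sum lambert3 q) (UNIV \<times> UNIV)" using hs unfolding 2 .
  have "?b sums (6 * (\<Sum>k. (q ^ Suc k / (1 - q ^ Suc k)\<^sup>2)\<^sup>2) + lambert1 q)"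
    unfolding lambert1_def
    by (intro sums_add sums_mult summable_sums summable_norm_cancel[OF summable_lambert1[OF q]]
        summable_norm_cancel[OF summable_norm_power2[OF summable_lambert1[OF q]]])
  then show "lambert3 q = 6 * (\<Sum>k. (q ^ Suc k / (1 - q ^ Suc k)\<^sup>2)\<^sup>2) + lambert1 q"
    using sums_unique2[OF 1] unfolding 2 by blast
qed

lemma three_power_ge: "real (2 * k + 1) \<le> 3 ^ k"
  by (induction k) auto

lemma tri_le_three_power: "real (tri k) \<le> 3 ^ k"
proof (induction k)
  case (Suc k)
  have "real (tri (Suc k)) = real (tri k) + real k + 1" by simp
  then show ?case using Suc.IH three_power_ge[of k] unfolding power_Suc by linarith
qed simp

text \<open>The limits of the coefficients of w^0, w^1, w^2 on both sides of the finite triple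
  product. The first is Jacobi's identity for the cube of the Euler product; the others weight it by
  tri and by tri (tri - 1).\<close>

lemma dirichlet_series_sums:
  fixes q :: complex
  assumes q: "norm q < 1"
  shows "(\<Sum>k. (-1) ^ k * of_nat (2 * k + 1) * q ^ tri k) = euler q ^ 3"
    and "(\<Sum>k. (-1) ^ k * of_nat (2 * k + 1) * of_nat (tri k) * q ^ tri k) = - 3 * euler q ^ 3 * lambert1 q"
    and "(\<Sum>k. (-1) ^ k * of_nat (2 * k + 1) * of_nat (tri k) * (of_nat (tri k) - 1) * q ^ tri k)
         = 15 * euler q ^ 3 * ((lambert1 q)\<^sup>2 - (lambert3 q - lambert1 q) / 6)"
proof -
  let ?u = "\<lambda>k. (1 - q ^ Suc k)\<^sup>2" and ?v = "\<lambda>k. q ^ Suc k"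
  have u: "?u k \<noteq> 0" for k using one_minus_power_neq_0[OF q, of "Suc k"] by simp
  have lim0: "(\<lambda>N. \<Prod>k<N. ?u k) \<longlonglongrightarrow> (euler q)\<^sup>2"
    using tendsto_power[OF qfact_tendsto[OF q], of 2] by (simp add: qfact_def prod_power_distrib)
  have lim1: "(\<lambda>N. \<Sum>k<N. ?v k / ?u k) \<longlonglongrightarrow> lambert1 q"
    unfolding lambert1_def by (rule summable_LIMSEQ[OF summable_norm_cancel[OF summable_lambert1[OF q]]])
  have lim2: "(\<lambda>N. \<Sum>k<N. (?v k / ?u k)\<^sup>2) \<longlonglongrightarrow> (lambert3 q - lambert1 q) / 6"
    using summable_LIMSEQ[OF summable_norm_cancel[OF summable_norm_power2[OF summable_lambert1[OF q]]]]
      has_sum_cube_double(2)[OF q] by simp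
  \<comment> \<open>The bound 27^k allows for three factors of size at most 3^k, the most that occur
    among the coefficients of index up to 2.\<close>
  have key: "(\<lambda>k. (-1) ^ k * coeff (dirichlet k) j * q ^ tri k) sums (L * euler q)"
    if L: "(\<lambda>N. coeff (\<Prod>k<N. [:?u k, - ?v k:]) j) \<longlonglongrightarrow> L"
      and b: "\<And>k. norm (coeff (dirichlet k) j) \<le> 27 ^ k" for j L
  proof -
    have summ: "summable (\<lambda>k. norm ((-1) ^ k * coeff (dirichlet k) j * q ^ tri k))"
      by (rule summable_tri_mult[OF q, of _ 1 27]) (simp add: norm_mult norm_power b)
    from sum_qbinom_tendsto[OF q summ]
    have "(\<lambda>N. \<Sum>k\<le>N. (-1) ^ k * coeff (dirichlet k) j * q ^ tri k * qbinom q N k)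
        \<longlonglongrightarrow> (\<Sum>k. (-1) ^ k * coeff (dirichlet k) j * q ^ tri k) / euler q" .
    moreover have "coeff (\<Prod>k<N. [:?u k, - ?v k:]) j = (\<Sum>k\<le>N. (-1) ^ k * coeff (dirichlet k) j * q ^ tri k * qbinom q N k)" for N
      unfolding finite_triple_product[OF q] coeff_sum by (intro sum.cong) (simp_all add: mult_ac)
    ultimately have "(\<Sum>k. (-1) ^ k * coeff (dirichlet k) j * q ^ tri k) / euler q = L"
      using L by (intro LIMSEQ_unique[of "\<lambda>N. coeff (\<Prod>k<N. [:?u k, - ?v k:]) j"]) simp_all
    then have "(\<Sum>k. (-1) ^ k * coeff (dirichlet k) j * q ^ tri k) = L * euler q"
      using euler_neq_0[OF q] by (simp add: divide_eq_eq)
    then show ?thesis using summable_sums[OF summable_norm_cancel[OF summ]] by (simp only:)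
  qed
  have p27: "(3::real) ^ k * 3 ^ k * 3 ^ k = 27 ^ k" for k by (simp only: power_mult_distrib[symmetric]) simp
  have one3: "1 \<le> (3::real) ^ k" for k by simp
  have t0: "0 \<le> real (tri k)" for k by simp
  have b0: "norm (coeff (dirichlet k) 0) \<le> 27 ^ k" for k
  proof -
    have "real (2 * k + 1) \<le> 3 ^ k" by (rule three_power_ge)
    also have "(3::real) ^ k \<le> 27 ^ k" by (intro power_mono) auto
    finally show ?thesis unfolding coeff_dirichlet_0 norm_of_nat .
  qed
  have b1: "norm (coeff (dirichlet k) (Suc 0)) \<le> 27 ^ k" for k
  proof -
    have "real (2 * k + 1) * real (tri k) / 3 \<le> real (2 * k + 1) * real (tri k) * 1" by simp
    also have "\<dots> \<le> 3 ^ k * 3 ^ k * 3 ^ k"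
      by (intro mult_mono three_power_ge tri_le_three_power one3) auto
    finally show ?thesis unfolding coeff_dirichlet_1 p27 by (simp only: norm_mult norm_divide norm_of_nat norm_numeral)
  qed
  have b2: "norm (coeff (dirichlet k) (Suc (Suc 0))) \<le> 27 ^ k" for k
  proof -
    have d: "norm (complex_of_nat (tri k) - 1) \<le> 3 ^ k"
    proof -
      have "complex_of_nat (tri k) - 1 = of_real (real (tri k) - 1)" by simp
      then have "norm (complex_of_nat (tri k) - 1) = \<bar>real (tri k) - 1\<bar>" by (simp only: norm_of_real)
      then show ?thesis using tri_le_three_power[of k] one3[of k] t0[of k] by linarith
    qed
    have "real (2 * k + 1) * real (tri k) * norm (complex_of_nat (tri k) - 1) / 30
        \<le> real (2 * k + 1) * real (tri k) * norm (complex_of_nat (tri k) - 1)" by simp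
    also have "\<dots> \<le> 3 ^ k * 3 ^ k * 3 ^ k"
      by (intro mult_mono three_power_ge tri_le_three_power d) auto
    finally show ?thesis unfolding coeff_dirichlet_2 p27 by (simp only: norm_mult norm_divide norm_of_nat norm_numeral)
  qed
  have "(\<lambda>k. (-1) ^ k * of_nat (2 * k + 1) * q ^ tri k) sums ((euler q)\<^sup>2 * euler q)"
    using key[OF _ b0, unfolded coeff_prod_linear(1)[OF u] coeff_dirichlet_0, OF lim0] .
  then show "(\<Sum>k. (-1) ^ k * of_nat (2 * k + 1) * q ^ tri k) = euler q ^ 3"
    by (simp add: sums_iff power3_eq_cube power2_eq_square)
  have "(\<lambda>k. (-1) ^ k * (of_nat (2 * k + 1) * of_nat (tri k) / 3) * q ^ tri k) sums (- ((euler q)\<^sup>2) * lambert1 q * euler q)"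
    using key[OF _ b1, unfolded coeff_prod_linear(2)[OF u] coeff_dirichlet_1, OF tendsto_mult[OF tendsto_minus[OF lim0] lim1]] .
  from sums_mult[OF this, of 3]
  have "(\<lambda>k. (-1) ^ k * of_nat (2 * k + 1) * of_nat (tri k) * q ^ tri k) sums (- 3 * euler q ^ 3 * lambert1 q)"
    by (simp add: power3_eq_cube power2_eq_square mult_ac)
  then show "(\<Sum>k. (-1) ^ k * of_nat (2 * k + 1) * of_nat (tri k) * q ^ tri k) = - 3 * euler q ^ 3 * lambert1 q"
    by (rule sums_unique[symmetric])
  have s2: "(\<lambda>k. (-1) ^ k * (of_nat (2 * k + 1) * of_nat (tri k) * (of_nat (tri k) - 1) / 30) * q ^ tri k)
      sums ((euler q)\<^sup>2 * ((lambert1 q)\<^sup>2 - (lambert3 q - lambert1 q) / 6) / 2 * euler q)"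
    by (rule key[OF _ b2, unfolded coeff_prod_linear(3)[OF u] coeff_dirichlet_2])
       (intro tendsto_divide tendsto_mult tendsto_diff tendsto_power tendsto_const lim0 lim1 lim2, simp)
  \<comment> \<open>The factor 30 clears the denominator of the kernel coefficient; the 1/2 from the
    second elementary symmetric function leaves 15.\<close>
  have "(\<lambda>k. 30 * ((-1) ^ k * (of_nat (2 * k + 1) * of_nat (tri k) * (of_nat (tri k) - 1) / 30) * q ^ tri k))
      sums (15 * euler q ^ 3 * ((lambert1 q)\<^sup>2 - (lambert3 q - lambert1 q) / 6))"
  proof -
    have "30 * (e\<^sup>2 * X / 2 * e) = 15 * e ^ 3 * X" for e X :: complex
      by (simp add: power2_eq_square power3_eq_cube)
    then show ?thesis using sums_mult[OF s2, of 30] by (simp only:)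
  qed
  moreover have "30 * ((-1) ^ k * (a / 30) * b) = (-1) ^ k * a * b" for a b :: complex and k :: nat
    by simp
  ultimately have "(\<lambda>k. (-1) ^ k * (of_nat (2 * k + 1) * of_nat (tri k) * (of_nat (tri k) - 1)) * q ^ tri k)
      sums (15 * euler q ^ 3 * ((lambert1 q)\<^sup>2 - (lambert3 q - lambert1 q) / 6))"
    by (simp only:)
  then show "(\<Sum>k. (-1) ^ k * of_nat (2 * k + 1) * of_nat (tri k) * (of_nat (tri k) - 1) * q ^ tri k)
         = 15 * euler q ^ 3 * ((lambert1 q)\<^sup>2 - (lambert3 q - lambert1 q) / 6)"
    by (simp only: sums_iff mult.assoc)
qed

section \<open>Differentiating Jacobi's series termwise\<close>

lemma tri_series_has_derivative:
  fixes c :: "nat \<Rightarrow> complex"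
  assumes q: "norm q < 1" and c: "\<And>k. norm (c k) \<le> X ^ k" and X: "0 \<le> X"
  obtains D where "((\<lambda>q. \<Sum>k. c k * q ^ tri k) has_field_derivative D) (at q)"
    and "q * D = (\<Sum>k. c k * of_nat (tri k) * q ^ tri k)"
proof -
  \<comment> \<open>A radius strictly between |q| and 1 puts q into the interior of a disc on which
    the differentiated series is dominated by its value at r.\<close>
  define r where "r = (1 + norm q) / 2"
  have r: "norm q < r" "r < 1" "0 < r" using q by (auto simp: r_def add_pos_nonneg)
  have rn: "norm (complex_of_real r) < 1" using r by simp
  define S where "S = cball (0::complex) r"
  have M: "summable (\<lambda>k. norm (c k) * real (tri k) * r ^ (tri k - 1))"
  proof (rule summable_comparison_test')
    show "summable (\<lambda>k. ((3 * X) ^ k * norm (complex_of_real r) ^ tri k) / r)"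
      by (intro summable_divide summable_tri rn)
    fix k :: nat
    have "norm (c k) * real (tri k) * r ^ (tri k - 1) = norm (c k) * real (tri k) * r ^ tri k / r"
      using r by (cases "tri k") auto
    also have "\<dots> \<le> X ^ k * 3 ^ k * r ^ tri k / r"
      using r X by (intro divide_right_mono mult_right_mono mult_mono c tri_le_three_power) auto
    also have "\<dots> = ((3 * X) ^ k * norm (complex_of_real r) ^ tri k) / r"
      using r by (simp add: power_mult_distrib mult_ac)
    finally show "norm (norm (c k) * real (tri k) * r ^ (tri k - 1)) \<le> ((3 * X) ^ k * norm (complex_of_real r) ^ tri k) / r"
      using r by simp
  qed
  have uc: "uniformly_convergent_on S (\<lambda>n x. \<Sum>k<n. c k * (of_nat (tri k) * x ^ (tri k - 1)))"
  proof (rule Weierstrass_m_test'[OF _ M])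
    fix k x assume "x \<in> S"
    then have "norm x ^ (tri k - 1) \<le> r ^ (tri k - 1)" by (intro power_mono) (auto simp: S_def)
    then show "norm (c k * (of_nat (tri k) * x ^ (tri k - 1))) \<le> norm (c k) * real (tri k) * r ^ (tri k - 1)"
      by (simp add: norm_mult norm_power mult.assoc mult_left_mono)
  qed
  have d: "((\<lambda>x. c k * x ^ tri k) has_field_derivative c k * (of_nat (tri k) * x ^ (tri k - 1))) (at x within S)" for k x
    by (auto intro!: derivative_eq_intros)
  have 0: "summable (\<lambda>k. c k * 0 ^ tri k)"
    by (rule summable_norm_cancel[OF summable_tri_mult[of 0 _ 1 X]]) (use c in auto)
  have int: "q \<in> interior S" using r by (auto simp: S_def)
  have der: "((\<lambda>q. \<Sum>k. c k * q ^ tri k) has_field_derivative (\<Sum>k. c k * (of_nat (tri k) * q ^ (tri k - 1)))) (at q)"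
    by (rule has_field_derivative_series'(2)[OF _ d uc _ 0 int]) (use r in \<open>auto simp: S_def\<close>)
  have "summable (\<lambda>k. c k * (of_nat (tri k) * q ^ (tri k - 1)))"
  proof (rule summable_comparison_test'[OF M])
    have "norm q ^ (tri k - 1) \<le> r ^ (tri k - 1)" for k using r by (intro power_mono) auto
    then show "norm (c k * (of_nat (tri k) * q ^ (tri k - 1))) \<le> norm (c k) * real (tri k) * r ^ (tri k - 1)" for k
      by (simp add: norm_mult norm_power mult.assoc mult_left_mono)
  qed
  then have "q * (\<Sum>k. c k * (of_nat (tri k) * q ^ (tri k - 1))) = (\<Sum>k. q * (c k * (of_nat (tri k) * q ^ (tri k - 1))))"
    by (rule suminf_mult[symmetric])
  \<comment> \<open>If \<open>tri k\<close> is 0, the truncated exponent \<open>tri k - 1\<close> is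
    harmless, since the factor \<open>of_nat (tri k)\<close> kills the term on both sides.\<close>
  also have "\<dots> = (\<Sum>k. c k * of_nat (tri k) * q ^ tri k)"
  proof (rule suminf_cong)
    show "q * (c k * (of_nat (tri k) * q ^ (tri k - 1))) = c k * of_nat (tri k) * q ^ tri k" for k
      by (cases "tri k") auto
  qed
  finally show ?thesis using der that by blast
qed

lemma euler_holomorphic: "euler holomorphic_on ball 0 1"
proof (rule holomorphic_uniform_sequence)
  show "(\<lambda>q. qfact q n) holomorphic_on ball 0 1" for n
    unfolding qfact_def by (intro holomorphic_intros)
  fix x :: complex assume x: "x \<in> ball 0 1"
  define d where "d = (1 - norm x) / 2"
  have d: "0 < d" "norm x + d < 1" using x by (auto simp: d_def field_simps)
  define r where "r = norm x + d"
  have sub: "norm y \<le> r" if "y \<in> cball x d" for y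
    using that norm_triangle_ineq2[of y x] unfolding r_def by (simp add: dist_norm norm_minus_commute)
  have "uniformly_convergent_on (cball x d) (\<lambda>N y. \<Prod>n<N. 1 + (- (y * y ^ n)))"
  proof (rule uniformly_convergent_on_prod)
    show "uniformly_convergent_on (cball x d) (\<lambda>N y. \<Sum>n<N. norm (- (y * y ^ n)))"
    proof (rule Weierstrass_m_test')
      have "0 \<le> r" "r < 1" using d by (auto simp: r_def)
      then have "summable (\<lambda>n. r ^ n)" by (intro summable_geometric) simp
      then show "summable (\<lambda>n. r ^ Suc n)" by (simp only: summable_Suc_iff)
      show "norm (norm (- (y * y ^ n))) \<le> r ^ Suc n" if "y \<in> cball x d" for n y
        using power_mono[OF sub[OF that], of "Suc n"] by (simp add: norm_mult norm_power)
    qed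
  qed (auto intro!: continuous_intros)
  then have "uniformly_convergent_on (cball x d) (\<lambda>N y. qfact y N)"
    by (simp add: qfact_def)
  then obtain g where g: "uniform_limit (cball x d) (\<lambda>N y. qfact y N) g sequentially"
    by (auto simp: uniformly_convergent_on_def)
  have "g y = euler y" if "y \<in> cball x d" for y
  proof -
    have "(\<lambda>N. qfact y N) \<longlonglongrightarrow> g y" by (rule tendsto_uniform_limitI[OF g that])
    moreover have "norm y < 1" using sub[OF that] d by (simp add: r_def)
    ultimately show ?thesis using qfact_tendsto LIMSEQ_unique by blast
  qed
  then have "uniform_limit (cball x d) (\<lambda>N y. qfact y N) euler sequentially"
    using g by (subst (asm) uniform_limit_cong'[of _ _ _ g euler]) auto
  moreover have "cball x d \<subseteq> ball 0 1" using sub d by (force simp: r_def)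
  ultimately show "\<exists>d>0. cball x d \<subseteq> ball 0 1 \<and> uniform_limit (cball x d) (\<lambda>n q. qfact q n) euler sequentially"
    using d by blast
qed auto

lemma euler_has_derivative:
  assumes q: "norm q < 1"
  shows "(euler has_field_derivative deriv euler q) (at q)"
  using holomorphic_derivI[OF euler_holomorphic, of q] q by simp

definition jcoeff :: "nat \<Rightarrow> complex" where "jcoeff k = (-1) ^ k * of_nat (2 * k + 1)"

lemma norm_jcoeff: "norm (jcoeff k) \<le> 3 ^ k"
  unfolding jcoeff_def norm_mult norm_of_nat norm_power using three_power_ge[of k] by simp

lemma norm_jcoeff_tri: "norm (jcoeff k * of_nat (tri k)) \<le> 9 ^ k"
proof -
  have "norm (jcoeff k * of_nat (tri k)) \<le> 3 ^ k * 3 ^ k"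
    unfolding norm_mult norm_of_nat by (intro mult_mono norm_jcoeff tri_le_three_power) auto
  also have "\<dots> = 9 ^ k" by (simp only: power_mult_distrib[symmetric]) simp
  finally show ?thesis .
qed

lemma jcoeff_sums:
  assumes q: "norm q < 1"
  shows "(\<Sum>k. jcoeff k * q ^ tri k) = euler q ^ 3"
    and "(\<Sum>k. jcoeff k * of_nat (tri k) * q ^ tri k) = - 3 * euler q ^ 3 * lambert1 q"
  using dirichlet_series_sums(1,2)[OF q] by (simp_all only: jcoeff_def)

text \<open>The logarithmic derivative of the Euler product, obtained without differentiating a
  product: Jacobi's series for its cube is differentiated termwise, and the result is the moment
  already evaluated. The factor 3 E^2 is then cancelled.\<close>

lemma euler_theta:
  assumes q: "norm q < 1"
  shows "q * deriv euler q = - euler q * lambert1 q"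
proof -
  obtain D where D: "((\<lambda>q. \<Sum>k. jcoeff k * q ^ tri k) has_field_derivative D) (at q)"
    and qD: "q * D = (\<Sum>k. jcoeff k * of_nat (tri k) * q ^ tri k)"
    using tri_series_has_derivative[OF q norm_jcoeff] by auto
  have ev: "\<forall>\<^sub>F x in nhds q. (\<Sum>k. jcoeff k * x ^ tri k) = euler x ^ 3"
    using eventually_nhds_in_open[of "ball 0 1" q] q by (auto elim!: eventually_mono simp: jcoeff_sums)
  have "((\<lambda>q. euler q ^ 3) has_field_derivative D) (at q)"
    using D DERIV_cong_ev[OF refl ev refl] by simp
  moreover have "((\<lambda>q. euler q ^ 3) has_field_derivative 3 * (euler q)\<^sup>2 * deriv euler q) (at q)"
    by (auto intro!: derivative_eq_intros euler_has_derivative q)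
  ultimately have "D = 3 * (euler q)\<^sup>2 * deriv euler q" by (rule DERIV_unique)
  then have "(3 * (euler q)\<^sup>2) * (q * deriv euler q) = q * D" by (simp only: mult_ac)
  also have "\<dots> = (3 * (euler q)\<^sup>2) * (- euler q * lambert1 q)"
    unfolding qD jcoeff_sums(2)[OF q] by (simp add: power2_eq_square power3_eq_cube)
  finally have *: "(3 * (euler q)\<^sup>2) * (q * deriv euler q) = (3 * (euler q)\<^sup>2) * (- euler q * lambert1 q)" .
  have "3 * (euler q)\<^sup>2 \<noteq> 0" using euler_neq_0[OF q] by simp
  from * show ?thesis unfolding mult_left_cancel[OF \<open>3 * (euler q)\<^sup>2 \<noteq> 0\<close>] .
qed

text \<open>Holomorphy is inherited from the Euler product, since the Lambert series is minus its
  logarithmic derivative. In the same way \<open>lambert3\<close> inherits it below from the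
  differential equation.\<close>

lemma lambert1_holomorphic: "lambert1 holomorphic_on ball 0 1"
proof -
  have "(\<lambda>q. - (q * deriv euler q) / euler q) holomorphic_on ball 0 1"
    by (intro holomorphic_intros euler_holomorphic holomorphic_deriv) (use euler_neq_0 in auto)
  moreover have "- (q * deriv euler q) / euler q = lambert1 q" if "q \<in> ball 0 1" for q
    using that euler_theta[of q] euler_neq_0[of q] by simp
  ultimately show ?thesis by (rule holomorphic_transform) auto
qed

lemma lambert1_has_derivative:
  assumes q: "norm q < 1"
  shows "(lambert1 has_field_derivative deriv lambert1 q) (at q)"
  using holomorphic_derivI[OF lambert1_holomorphic, of q] q by simp

text \<open>Ramanujan's equation \<open>12 q P'(q) = P(q)\<^sup>2 - Q(q)\<close> with \<open>P = 1 - 24 lambert1\<close> and \<open>Q = 1 + 240 lambert3\<close>.\<close>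

lemma lambert1_ode:
  assumes q: "norm q < 1"
  shows "12 * (lambert1 q)\<^sup>2 = 5 * lambert3 q + lambert1 q - 6 * (q * deriv lambert1 q)"
proof -
  obtain D where D: "((\<lambda>q. \<Sum>k. jcoeff k * of_nat (tri k) * q ^ tri k) has_field_derivative D) (at q)"
    and qD: "q * D = (\<Sum>k. jcoeff k * of_nat (tri k) * of_nat (tri k) * q ^ tri k)"
    using tri_series_has_derivative[OF q norm_jcoeff_tri] by auto
  have ev: "\<forall>\<^sub>F x in nhds q. (\<Sum>k. jcoeff k * of_nat (tri k) * x ^ tri k) = - 3 * euler x ^ 3 * lambert1 x"
    using eventually_nhds_in_open[of "ball 0 1" q] q by (auto elim!: eventually_mono simp: jcoeff_sums)
  have 1: "((\<lambda>q. - 3 * euler q ^ 3 * lambert1 q) has_field_derivative D) (at q)"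
    using D DERIV_cong_ev[OF refl ev refl] by simp
  have 2: "((\<lambda>q. - 3 * euler q ^ 3 * lambert1 q) has_field_derivative
      - 9 * (euler q)\<^sup>2 * deriv euler q * lambert1 q - 3 * euler q ^ 3 * deriv lambert1 q) (at q)"
    by (auto intro!: derivative_eq_intros euler_has_derivative lambert1_has_derivative q)
  have "q * D = - 9 * (euler q)\<^sup>2 * (q * deriv euler q) * lambert1 q - 3 * euler q ^ 3 * (q * deriv lambert1 q)"
    unfolding DERIV_unique[OF 1 2] by (simp add: algebra_simps)
  then have 3: "q * D = 9 * euler q ^ 3 * (lambert1 q)\<^sup>2 - 3 * euler q ^ 3 * (q * deriv lambert1 q)"
    unfolding euler_theta[OF q] by (simp add: algebra_simps power2_eq_square power3_eq_cube)
  have s2: "summable (\<lambda>k. jcoeff k * of_nat (tri k) * of_nat (tri k) * q ^ tri k)"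
  proof (rule summable_norm_cancel[OF summable_tri_mult[OF q, of _ 1 27]])
    fix k
    have "norm (jcoeff k * of_nat (tri k) * of_nat (tri k)) \<le> 9 ^ k * 3 ^ k"
      unfolding norm_mult[of "_ * _"] norm_of_nat using norm_jcoeff_tri[of k]
      by (intro mult_mono norm_jcoeff_tri tri_le_three_power) auto
    also have "\<dots> = 27 ^ k" by (simp only: power_mult_distrib[symmetric]) simp
    finally show "norm (jcoeff k * of_nat (tri k) * of_nat (tri k)) \<le> 1 * 27 ^ k" by simp
  qed
  have s1: "summable (\<lambda>k. jcoeff k * of_nat (tri k) * q ^ tri k)"
    by (rule summable_norm_cancel[OF summable_tri_mult[OF q, of _ 1 9]]) (use norm_jcoeff_tri in simp)
  \<comment> \<open>Subtracting the first moment from the second produces the weight tri (tri - 1)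
    of the third Dirichlet series.\<close>
  have "q * D - - 3 * euler q ^ 3 * lambert1 q
      = (\<Sum>k. jcoeff k * of_nat (tri k) * of_nat (tri k) * q ^ tri k - jcoeff k * of_nat (tri k) * q ^ tri k)"
    unfolding qD jcoeff_sums(2)[OF q, symmetric] by (rule suminf_diff[OF s2 s1])
  also have "\<dots> = (\<Sum>k. (-1) ^ k * of_nat (2 * k + 1) * of_nat (tri k) * (of_nat (tri k) - 1) * q ^ tri k)"
    by (rule suminf_cong) (simp only: jcoeff_def right_diff_distrib left_diff_distrib mult_1_right)
  finally have "9 * euler q ^ 3 * (lambert1 q)\<^sup>2 - 3 * euler q ^ 3 * (q * deriv lambert1 q) + 3 * euler q ^ 3 * lambert1 q
      = 15 * euler q ^ 3 * ((lambert1 q)\<^sup>2 - (lambert3 q - lambert1 q) / 6)"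
    unfolding dirichlet_series_sums(3)[OF q] 3 by simp
  then have "euler q ^ 3 * (9 * (lambert1 q)\<^sup>2 - 3 * (q * deriv lambert1 q) + 3 * lambert1 q)
      = euler q ^ 3 * (15 * ((lambert1 q)\<^sup>2 - (lambert3 q - lambert1 q) / 6))"
    by (simp only: algebra_simps)
  then have "9 * (lambert1 q)\<^sup>2 - 3 * (q * deriv lambert1 q) + 3 * lambert1 q = 15 * ((lambert1 q)\<^sup>2 - (lambert3 q - lambert1 q) / 6)"
    unfolding mult_left_cancel[OF power_not_zero[OF euler_neq_0[OF q]]] .
  moreover have "12 * a - (5 * d + c - 6 * b) = - 2 * ((9 * a - 3 * b + 3 * c) - 15 * (a - (d - c) / 6))"
    for a b c d :: complex by (simp add: field_simps)
  ultimately show ?thesis by (metis diff_self eq_iff_diff_eq_0 mult_zero_right)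
qed

lemma lambert3_holomorphic: "lambert3 holomorphic_on ball 0 1"
proof -
  have "(\<lambda>q. (12 * (lambert1 q)\<^sup>2 - lambert1 q + 6 * (q * deriv lambert1 q)) / 5) holomorphic_on ball 0 1"
    by (intro holomorphic_intros lambert1_holomorphic holomorphic_deriv) auto
  moreover have "(12 * (lambert1 q)\<^sup>2 - lambert1 q + 6 * (q * deriv lambert1 q)) / 5 = lambert3 q" if "q \<in> ball 0 1" for q
    using that lambert1_ode[of q] by simp
  ultimately show ?thesis by (rule holomorphic_transform) auto
qed

section \<open>Laurent coefficients on the unit circle\<close>

lemma has_sum_product:
  fixes f :: "'a \<Rightarrow> complex" and g :: "'b \<Rightarrow> complex"
  assumes f: "(f has_sum a) A" and g: "(g has_sum b) B"
  shows "((\<lambda>(x, y). f x * g y) has_sum (a * b)) (A \<times> B)"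
proof (rule has_sum_SigmaI)
  show "((\<lambda>y. case (x, y) of (x, y) \<Rightarrow> f x * g y) has_sum f x * b) B" if "x \<in> A" for x
    using has_sum_cmult_right[OF g, of "f x"] by simp
  show "((\<lambda>x. f x * b) has_sum a * b) A" by (rule has_sum_cmult_left[OF f])
  have nf: "(\<lambda>x. norm (f x)) summable_on A"
    using has_sum_imp_summable[OF f] by (simp only: summable_on_iff_abs_summable_on_complex)
  have ng: "(\<lambda>y. norm (g y)) summable_on B"
    using has_sum_imp_summable[OF g] by (simp only: summable_on_iff_abs_summable_on_complex)
  have "(\<lambda>p. norm (case p of (x, y) \<Rightarrow> f x * g y)) summable_on A \<times> B"
  proof (rule summable_on_SigmaI)
    show "((\<lambda>y. norm (case (x, y) of (x, y) \<Rightarrow> f x * g y)) has_sum norm (f x) * infsum (\<lambda>y. norm (g y)) B) B" if "x \<in> A" for x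
      using has_sum_cmult_right[OF has_sum_infsum[OF ng], of "norm (f x)"] by (simp add: norm_mult)
    show "(\<lambda>x. norm (f x) * infsum (\<lambda>y. norm (g y)) B) summable_on A"
      by (rule summable_on_cmult_left[OF nf])
  qed auto
  then show "(\<lambda>(x, y). f x * g y) summable_on A \<times> B" by (rule abs_summable_summable)
qed

text \<open>The coefficient of z^s in a product of three Laurent series. Taking three at once, with
  the last index eliminated, makes it a sum over a rank 2 lattice.\<close>

definition conv3 :: "(int \<Rightarrow> complex) \<Rightarrow> (int \<Rightarrow> complex) \<Rightarrow> (int \<Rightarrow> complex) \<Rightarrow> int \<Rightarrow> complex" where
  "conv3 f g h s = (\<Sum>\<^sub>\<infinity>(i, j)\<in>UNIV. f i * g j * h (s - i - j))"

lemma norm_power_int_1: "norm (z::complex) = 1 \<Longrightarrow> norm (z powi n) = 1"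
  by (simp add: norm_power_int)

lemma summable_on_mult_unit:
  fixes f :: "'a \<Rightarrow> complex"
  assumes "f summable_on A" and "\<And>n. n \<in> A \<Longrightarrow> norm (u n) = 1"
  shows "(\<lambda>n. f n * u n) summable_on A"
proof -
  have "(\<lambda>n. norm (f n * u n)) summable_on A \<longleftrightarrow> (\<lambda>n. norm (f n)) summable_on A"
    using assms(2) by (intro summable_on_cong) (simp add: norm_mult)
  then show ?thesis using assms(1) by (simp only: summable_on_iff_abs_summable_on_complex)
qed

lemma conv3_has_sum:
  fixes f g h :: "int \<Rightarrow> complex"
  assumes f: "((\<lambda>n. f n * z powi n) has_sum F) UNIV" and g: "((\<lambda>n. g n * z powi n) has_sum G) UNIV"
    and h: "((\<lambda>n. h n * z powi n) has_sum H) UNIV" and z: "norm z = 1"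
  shows "((\<lambda>s. conv3 f g h s * z powi s) has_sum (F * G * H)) UNIV"
    and "\<And>s. (\<lambda>(i, j). f i * g j * h (s - i - j)) summable_on UNIV"
proof -
  have z0: "z \<noteq> 0" using z by auto
  let ?p = "\<lambda>(s, i, j). (f i * g j * h (s - i - j)) * z powi s"
  have "((\<lambda>(x, y). (case x of (i, j) \<Rightarrow> (f i * z powi i) * (g j * z powi j)) * (h y * z powi y)) has_sum (F * G * H)) ((UNIV \<times> UNIV) \<times> UNIV)"
    by (intro has_sum_product f g h)
  then have "(?p has_sum (F * G * H)) UNIV"
  proof (subst has_sum_reindex_bij_witness[of UNIV "\<lambda>((i, j), k). (i + j + k, i, j)" "\<lambda>(s, i, j). ((i, j), s - i - j)" UNIV
        "\<lambda>(x, y). (case x of (i, j) \<Rightarrow> (f i * z powi i) * (g j * z powi j)) * (h y * z powi y)" _ _ "F * G * H"])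
    have "f i * z powi i * (g j * z powi j) * (h (s - i - j) * z powi (s - i - j)) = f i * g j * h (s - i - j) * z powi s" for i j s
    proof -
      have "z powi s = z powi i * z powi j * z powi (s - i - j)"
        using z0 by (simp flip: power_int_add)
      then show ?thesis by (simp add: mult_ac)
    qed
    then show "(case case a of (s, i, j) \<Rightarrow> ((i, j), s - i - j) of (x, y) \<Rightarrow> (case x of (i, j) \<Rightarrow> (f i * z powi i) * (g j * z powi j)) * (h y * z powi y)) = ?p a" for a
      by (cases a) simp
  qed auto
  then have p: "(?p has_sum (F * G * H)) (UNIV \<times> UNIV)" by simp
  have sm: "(\<lambda>(i, j). f i * g j * h (s - i - j)) summable_on UNIV" for s
  proof -
    have "(\<lambda>(s, x). ?p (s, x)) summable_on (UNIV \<times> UNIV)" using has_sum_imp_summable[OF p] by (simp add: case_prod_unfold)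
    from summable_on_SigmaD1[OF this, of s]
    have "(\<lambda>x. ?p (s, x)) summable_on UNIV" by simp
    then have "(\<lambda>x. (case x of (i, j) \<Rightarrow> f i * g j * h (s - i - j)) * z powi s) summable_on UNIV"
      by (simp add: case_prod_unfold)
    then show ?thesis by (subst (asm) summable_on_cmult_left') (use z0 in auto)
  qed
  then show "\<And>s. (\<lambda>(i, j). f i * g j * h (s - i - j)) summable_on UNIV" .
  show "((\<lambda>s. conv3 f g h s * z powi s) has_sum (F * G * H)) UNIV"
  proof (rule has_sum_SigmaD[OF p])
    fix s :: int
    show "((\<lambda>y. ?p (s, y)) has_sum conv3 f g h s * z powi s) UNIV"
      using has_sum_cmult_left[OF has_sum_infsum[OF sm[of s]], of "z powi s"]
      unfolding conv3_def by (simp add: case_prod_unfold)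
  qed
qed

lemma conv3_summable:
  assumes "f summable_on UNIV" "g summable_on UNIV" "h summable_on UNIV"
  shows "conv3 f g h summable_on UNIV" "\<And>s. (\<lambda>(i, j). f i * g j * h (s - i - j)) summable_on UNIV"
  using has_sum_imp_summable[OF conv3_has_sum(1)[of f 1 _ g _ h]] conv3_has_sum(2)[of f 1 _ g _ h] assms
  by (auto simp: summable_iff_has_sum_infsum)

lemma sum_unit_root_powers:
  assumes "0 < \<bar>d\<bar>" "\<bar>d\<bar> < int N"
  shows "(\<Sum>k<N. (cis (2 * pi / N) powi d) ^ k) = 0"
proof -
  define x where "x = cis (2 * pi / N) powi d"
  have N: "N > 0" using assms by auto
  have x: "x = cis (of_int d * (2 * pi / N))" unfolding x_def by (rule cis_power_int)
  have "x ^ N = cis (2 * pi * of_int d)"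
    unfolding x Complex.DeMoivre using N by (simp add: mult_ac)
  then have xN: "x ^ N = 1" by simp
  have "x \<noteq> 1"
  proof
    assume "x = 1"
    then have "cos (of_int d * (2 * pi / N)) = 1" unfolding x by (simp add: complex_eq_iff)
    then obtain m :: int where "of_int d * (2 * pi / N) = of_int m * 2 * pi"
      by (auto simp: cos_one_2pi_int)
    then have "of_int d = (of_int (m * int N) :: real)" using N by (simp add: field_simps)
    then have d: "d = m * int N" by linarith
    then have "m \<noteq> 0" using assms by auto
    then have "int N \<le> \<bar>d\<bar>" unfolding d abs_mult
      using mult_right_mono[of 1 "\<bar>m\<bar>" "int N"] by linarith
    then show False using assms by simp
  qed
  then show ?thesis using geometric_sum[of x N] xN by (simp add: x_def)
qed

text \<open>Averaging over the \<open>N\<close>-th roots of unity isolates the coefficients with index congruent to \<open>m\<close>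
  modulo \<open>N\<close>, and for large \<open>N\<close> only the one with index \<open>m\<close> is not in the tail of the series.\<close>

lemma laurent_unique_0:
  fixes f :: "int \<Rightarrow> complex"
  assumes f: "f summable_on UNIV"
    and 0: "\<And>z. norm z = 1 \<Longrightarrow> ((\<lambda>n. f n * z powi n) has_sum 0) UNIV"
  shows "f m = 0"
proof (rule ccontr)
  assume "f m \<noteq> 0"
  define e where "e = norm (f m) / 2"
  have e: "0 < e" using \<open>f m \<noteq> 0\<close> by (simp add: e_def)
  have nf: "(\<lambda>n. norm (f n)) summable_on UNIV" using f by (simp only: summable_on_iff_abs_summable_on_complex)
  obtain X where X: "finite X" "dist (sum (\<lambda>n. norm (f n)) X) (infsum (\<lambda>n. norm (f n)) UNIV) \<le> e / 2"
    using infsum_finite_approximation[OF nf, of "e / 2"] e by auto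
  define Y where "Y = insert m X"
  have Y: "finite Y" "m \<in> Y" using X by (auto simp: Y_def)
  have tail: "infsum (\<lambda>n. norm (f n)) (UNIV - Y) \<le> e / 2"
  proof -
    have "infsum (\<lambda>n. norm (f n)) (UNIV - Y) = infsum (\<lambda>n. norm (f n)) UNIV - sum (\<lambda>n. norm (f n)) Y"
      using infsum_Diff[OF nf summable_on_finite[OF Y(1)]] Y by simp
    also have "\<dots> \<le> infsum (\<lambda>n. norm (f n)) UNIV - sum (\<lambda>n. norm (f n)) X"
      using X Y sum_mono2[of Y X "\<lambda>n. norm (f n)"] by (auto simp: Y_def)
    also have "\<dots> \<le> e / 2" using X(2) unfolding dist_real_def by linarith
    finally show ?thesis .
  qed
  \<comment> \<open>With N larger than every distance |n - m| in \<open>Y\<close>, the only index in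
    \<open>Y\<close> congruent to m modulo N is m itself.\<close>
  define N where "N = nat (Max ((\<lambda>n. \<bar>n - m\<bar>) ` Y)) + 1"
  have N: "\<bar>n - m\<bar> < int N" if "n \<in> Y" for n
  proof -
    have "\<bar>n - m\<bar> \<le> Max ((\<lambda>n. \<bar>n - m\<bar>) ` Y)" using that Y by (intro Max_ge) auto
    then show ?thesis unfolding N_def by linarith
  qed
  have N0: "N > 0" by (simp add: N_def)
  define z where "z k = cis (2 * pi / N) ^ k" for k :: nat
  have z: "norm (z k) = 1" "z k \<noteq> 0" for k by (simp_all add: z_def norm_power)
  \<comment> \<open>The averaging weight: 1 at m, 0 at the other points of \<open>Y\<close>, and at
    most 1 in norm on the tail.\<close>
  define c where "c n = (\<Sum>k<N. z k powi (n - m)) / of_nat N" for n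
  have c_le: "norm (c n) \<le> 1" for n
  proof -
    have "norm (\<Sum>k<N. z k powi (n - m)) \<le> (\<Sum>k<N. norm (z k powi (n - m)))" by (rule norm_sum)
    also have "\<dots> = N" using z by (simp add: norm_power_int)
    finally show ?thesis using N0 by (simp add: c_def norm_divide)
  qed
  have c_m: "c m = 1" using N0 by (simp add: c_def)
  have c_0: "c n = 0" if "n \<in> Y" "n \<noteq> m" for n
  proof -
    have "z k powi (n - m) = (cis (2 * pi / N) powi (n - m)) ^ k" for k
      unfolding z_def by (simp add: power_int_power power_int_power' mult.commute)
    then show ?thesis using sum_unit_root_powers[of "n - m" N] N[OF that(1)] that(2) by (simp add: c_def)
  qed
  have "((\<lambda>n. \<Sum>k<N. f n * z k powi n * z k powi (- m)) has_sum (\<Sum>k<N. 0 * z k powi (- m))) UNIV"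
  proof -
    have "((\<lambda>n. \<Sum>k\<in>K. f n * z k powi n * z k powi (- m)) has_sum (\<Sum>k\<in>K. 0 * z k powi (- m))) UNIV" if "finite K" for K
      using that
    proof (induction K)
      case (insert k K)
      show ?case unfolding sum.insert[OF insert.hyps]
        by (intro has_sum_add has_sum_cmult_left 0 z insert.IH)
    qed simp
    then show ?thesis by blast
  qed
  moreover have "(\<Sum>k<N. f n * z k powi n * z k powi (- m)) = f n * c n * of_nat N" for n
  proof -
    have "f n * z k powi n * z k powi (- m) = f n * z k powi (n - m)" for k
      using z(2)[of k] by (simp add: power_int_diff power_int_minus divide_inverse mult.assoc)
    then have "(\<Sum>k<N. f n * z k powi n * z k powi (- m)) = f n * (\<Sum>k<N. z k powi (n - m))"
      by (simp only: sum_distrib_left)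
    then show ?thesis using N0 by (simp add: c_def)
  qed
  ultimately have "((\<lambda>n. f n * c n * of_nat N) has_sum 0) UNIV" by simp
  then have hs: "((\<lambda>n. f n * c n) has_sum 0) UNIV"
    by (subst (asm) has_sum_cmult_left_iff) (use N0 in auto)
  have fin: "((\<lambda>n. f n * c n) has_sum f m) Y"
    by (rule has_sum_finiteI[OF Y(1)]) (use Y c_0 c_m in \<open>simp add: sum.remove[of Y m]\<close>)
  have "((\<lambda>n. f n * c n) has_sum (0 - f m)) (UNIV - Y)"
    by (rule has_sum_Diff[OF hs fin]) simp
  moreover have fc: "(\<lambda>n. norm (f n * c n)) summable_on UNIV - Y"
    using has_sum_imp_summable[OF calculation] by (simp only: summable_on_iff_abs_summable_on_complex)
  ultimately have "norm (0 - f m) \<le> infsum (\<lambda>n. norm (f n * c n)) (UNIV - Y)"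
    using norm_has_sum_bound[OF has_sum_infsum[OF fc]] by blast
  also have "\<dots> \<le> infsum (\<lambda>n. norm (f n)) (UNIV - Y)"
  proof (rule infsum_mono[OF fc summable_on_subset_banach[OF nf]])
    show "norm (f n * c n) \<le> norm (f n)" for n
      using mult_left_mono[OF c_le[of n], of "norm (f n)"] by (simp add: norm_mult)
  qed auto
  finally have "norm (f m) \<le> infsum (\<lambda>n. norm (f n)) (UNIV - Y)" by simp
  then show False using tail e unfolding e_def by linarith
qed

lemma laurent_unique:
  fixes f g :: "int \<Rightarrow> complex"
  assumes f: "f summable_on UNIV" and g: "g summable_on UNIV"
    and "\<And>z. norm z = 1 \<Longrightarrow> ((\<lambda>n. f n * z powi n) has_sum S z) UNIV"
    and "\<And>z. norm z = 1 \<Longrightarrow> ((\<lambda>n. g n * z powi n) has_sum S z) UNIV"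
  shows "f m = g m"
proof -
  have "f m + - 1 * g m = 0"
  proof (rule laurent_unique_0)
    show "(\<lambda>n. f n + - 1 * g n) summable_on UNIV" by (intro summable_on_add summable_on_cmult_right f g)
    fix z :: complex assume z: "norm z = 1"
    have "((\<lambda>n. f n * z powi n + - 1 * (g n * z powi n)) has_sum (S z + - 1 * S z)) UNIV"
      by (intro has_sum_add has_sum_cmult_right assms(3,4) z)
    then show "((\<lambda>n. (f n + - 1 * g n) * z powi n) has_sum 0) UNIV" by (simp add: algebra_simps)
  qed
  then show ?thesis by simp
qed

section \<open>The Jacobi triple product as a bilateral series\<close>

definition ch2 :: "int \<Rightarrow> int" where "ch2 n = n * (n - 1) div 2"

lemma two_ch2: "2 * ch2 n = n * (n - 1)"
  unfolding ch2_def by (rule dvd_mult_div_cancel) auto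

lemma ch2_neg: "ch2 (- int k) = int (tri k)" and ch2_pos: "ch2 (int (Suc k)) = int (tri k)"
proof -
  have "2 * int (tri k) = int k * (int k + 1)" by (induction k) (auto simp: algebra_simps)
  then show "ch2 (- int k) = int (tri k)" "ch2 (int (Suc k)) = int (tri k)"
    using two_ch2[of "- int k"] two_ch2[of "int (Suc k)"] by (auto simp: algebra_simps)
qed

text \<open>The unilateral form at - z: the power (1/z)^k goes to the index -k and z^(k+1) to the
  index k+1. Both have exponent \<open>tri k\<close>, and together these indices exhaust the
  integers.\<close>

lemma triple_product:
  assumes q: "norm q < 1" and z: "z \<noteq> 0"
  shows "((\<lambda>n. q powi ch2 n * z powi n) has_sum (qpoch_inf (- z) q * qpoch_inf (- q / z) q * euler q)) UNIV"
proof -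
  let ?a = "\<lambda>k. q ^ tri k * (1 / z) ^ k" and ?b = "\<lambda>k. q ^ tri k * z ^ Suc k"
  have sa: "summable (\<lambda>k. norm (?a k))"
    using summable_tri_mult[OF q, of "\<lambda>k. (1 / z) ^ k" 1 "norm (1 / z)"] by (simp add: norm_power norm_divide mult.commute)
  have sb: "summable (\<lambda>k. norm (?b k))"
    using summable_tri_mult[OF q, of "\<lambda>k. z ^ Suc k" "norm z" "norm z"] by (simp add: norm_power norm_mult mult_ac)
  have a: "(?a has_sum suminf ?a) UNIV" and b: "(?b has_sum suminf ?b) UNIV"
    by (intro norm_summable_imp_has_sum summable_sums summable_norm_cancel[OF sa] summable_norm_cancel[OF sb] sa sb)+
  have "(\<lambda>k. ?a k + ?b k) sums (suminf ?a + suminf ?b)"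
    by (intro sums_add summable_sums summable_norm_cancel[OF sa] summable_norm_cancel[OF sb])
  moreover have "(-1) ^ k * q ^ tri k * ((1 / - z) ^ k - (- z) ^ Suc k) = ?a k + ?b k" for k
  proof -
    have "(1 / - z) ^ k = (-1) ^ k * (1 / z) ^ k" by (simp flip: power_mult_distrib)
    moreover have "(- z) ^ Suc k = - ((-1) ^ k * z ^ Suc k)" by (simp add: power_minus[of z])
    moreover have "(-1) ^ k * Q * ((-1) ^ k * x - - ((-1) ^ k * y)) = ((-1) ^ k * (-1) ^ k) * (Q * x + Q * y)" for Q x y :: complex
      by (simp add: algebra_simps)
    moreover have "(-1) ^ k * (-1) ^ k = (1::complex)" by (simp flip: power_mult_distrib)
    ultimately show ?thesis by (simp only: mult_1_left)
  qed
  ultimately have ab: "suminf ?a + suminf ?b = qpoch_inf (- z) q * qpoch_inf (- q / z) q * euler q"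
    using triple_product_nat[OF q, of "- z"] z sums_unique2 by simp
  let ?f = "\<lambda>n. q powi ch2 n * z powi n"
  have 1: "(?f has_sum suminf ?a) (range (\<lambda>k. - int k))"
    by (subst has_sum_reindex) (use a in \<open>auto simp: inj_on_def o_def ch2_neg power_int_minus power_divide inverse_eq_divide\<close>)
  have 2: "(?f has_sum suminf ?b) (range (\<lambda>k. int (Suc k)))"
    by (subst has_sum_reindex) (use b in \<open>auto simp: inj_on_def o_def ch2_pos simp del: of_nat_Suc\<close>)
  have "(?f has_sum (suminf ?a + suminf ?b)) (range (\<lambda>k. - int k) \<union> range (\<lambda>k. int (Suc k)))"
    by (rule has_sum_Un_disjoint[OF 1 2]) auto
  moreover have "range (\<lambda>k. - int k) \<union> range (\<lambda>k. int (Suc k)) = UNIV"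
  proof (intro equalityI subsetI)
    fix n :: int
    show "n \<in> range (\<lambda>k. - int k) \<union> range (\<lambda>k. int (Suc k))"
    proof (cases "n \<le> 0")
      case True
      then have "n = - int (nat (- n))" by simp
      then show ?thesis by blast
    next
      case False
      then have "n = int (Suc (nat (n - 1)))" by simp
      then show ?thesis by blast
    qed
  qed auto
  ultimately show ?thesis using ab by simp
qed

section \<open>Lattice sums of type A2\<close>

definition omega :: complex where "omega = cis (2 * pi / 3)"

lemma omega_cube: "omega ^ 3 = 1"
  unfolding omega_def Complex.DeMoivre by simp

lemma omega_neq_0 [simp]: "omega \<noteq> 0"
  by (simp add: omega_def)

lemma norm_omega [simp]: "norm omega = 1"
  by (simp add: omega_def)

lemma omega_sum: "1 + omega + omega\<^sup>2 = 0"
proof -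
  have "(\<Sum>k<3. (cis (2 * pi / real 3) powi 1) ^ k) = 0"
    by (rule sum_unit_root_powers) auto
  then show ?thesis by (simp add: omega_def eval_nat_numeral)
qed

lemma omega_factor: "(1 - x) * (1 - omega * x) * (1 - omega\<^sup>2 * x) = 1 - x ^ 3"
proof -
  have "(1 - x) * (1 - omega * x) * (1 - omega\<^sup>2 * x)
      = 1 - (1 + omega + omega\<^sup>2) * x + (omega + omega\<^sup>2 + omega ^ 3) * x\<^sup>2 - omega ^ 3 * x ^ 3"
    by (simp add: algebra_simps power2_eq_square power3_eq_cube)
  moreover have "omega + omega\<^sup>2 + omega ^ 3 = 0" using omega_sum omega_cube by (simp add: add_ac)
  ultimately show ?thesis unfolding omega_sum omega_cube by simp
qed

lemma norm_power_less_1: "norm (q::complex) < 1 \<Longrightarrow> n > 0 \<Longrightarrow> norm (q ^ n) < 1"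
  unfolding norm_power using power_strict_mono[of "norm q" 1 n] by simp

lemma qpoch_inf_cube:
  assumes q: "norm q < 1"
  shows "qpoch_inf a q * qpoch_inf (omega * a) q * qpoch_inf (omega\<^sup>2 * a) q = qpoch_inf (a ^ 3) (q ^ 3)"
proof (rule LIMSEQ_unique)
  show "(\<lambda>n. (\<Prod>k<n. 1 - a * q ^ k) * (\<Prod>k<n. 1 - omega * a * q ^ k) * (\<Prod>k<n. 1 - omega\<^sup>2 * a * q ^ k))
      \<longlonglongrightarrow> qpoch_inf a q * qpoch_inf (omega * a) q * qpoch_inf (omega\<^sup>2 * a) q"
    by (intro tendsto_mult qpoch_inf_tendsto q)
  have "(\<Prod>k<n. 1 - a * q ^ k) * (\<Prod>k<n. 1 - omega * a * q ^ k) * (\<Prod>k<n. 1 - omega\<^sup>2 * a * q ^ k)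
      = (\<Prod>k<n. 1 - a ^ 3 * (q ^ 3) ^ k)" for n
  proof -
    have "(1 - a * q ^ k) * (1 - omega * a * q ^ k) * (1 - omega\<^sup>2 * a * q ^ k) = 1 - a ^ 3 * (q ^ 3) ^ k" for k
      using omega_factor[of "a * q ^ k"]
      by (simp add: power_mult_distrib power_mult[symmetric] mult.commute[of 3 k] mult.assoc)
    then show ?thesis by (simp only: prod.distrib[symmetric])
  qed
  then show "(\<lambda>n. (\<Prod>k<n. 1 - a * q ^ k) * (\<Prod>k<n. 1 - omega * a * q ^ k) * (\<Prod>k<n. 1 - omega\<^sup>2 * a * q ^ k))
      \<longlonglongrightarrow> qpoch_inf (a ^ 3) (q ^ 3)"
    using qpoch_inf_tendsto[OF norm_power_less_1[OF q, of 3], of "a ^ 3"] by simp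
qed

lemma qpoch_inf_split3:
  assumes q: "norm q < 1"
  shows "qpoch_inf a (q ^ 3) * qpoch_inf (a * q) (q ^ 3) * qpoch_inf (a * q\<^sup>2) (q ^ 3) = qpoch_inf a q"
proof (rule LIMSEQ_unique)
  have q3: "norm (q ^ 3) < 1" by (rule norm_power_less_1[OF q]) simp
  show "(\<lambda>n. (\<Prod>k<n. 1 - a * (q ^ 3) ^ k) * (\<Prod>k<n. 1 - a * q * (q ^ 3) ^ k) * (\<Prod>k<n. 1 - a * q\<^sup>2 * (q ^ 3) ^ k))
      \<longlonglongrightarrow> qpoch_inf a (q ^ 3) * qpoch_inf (a * q) (q ^ 3) * qpoch_inf (a * q\<^sup>2) (q ^ 3)"
    by (intro tendsto_mult qpoch_inf_tendsto q3)
  have "(\<Prod>k<n. 1 - a * (q ^ 3) ^ k) * (\<Prod>k<n. 1 - a * q * (q ^ 3) ^ k) * (\<Prod>k<n. 1 - a * q\<^sup>2 * (q ^ 3) ^ k)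
      = (\<Prod>k<3 * n. 1 - a * q ^ k)" for n
  proof (induction n)
    case (Suc n)
    have "3 * Suc n = Suc (Suc (Suc (3 * n)))" by simp
    then have "(\<Prod>k<3 * Suc n. 1 - a * q ^ k) = (\<Prod>k<3 * n. 1 - a * q ^ k)
        * (1 - a * (q ^ 3) ^ n) * (1 - a * q * (q ^ 3) ^ n) * (1 - a * q\<^sup>2 * (q ^ 3) ^ n)"
      by (simp only: prod.lessThan_Suc power_Suc power_mult power2_eq_square mult.assoc)
    then show ?case unfolding Suc.IH[symmetric] prod.lessThan_Suc by (simp only: mult_ac)
  qed simp
  moreover have "(\<lambda>n. \<Prod>k<3 * n. 1 - a * q ^ k) \<longlonglongrightarrow> qpoch_inf a q"
    by (rule filterlim_compose[OF qpoch_inf_tendsto[OF q]]) real_asymp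
  ultimately show "(\<lambda>n. (\<Prod>k<n. 1 - a * (q ^ 3) ^ k) * (\<Prod>k<n. 1 - a * q * (q ^ 3) ^ k) * (\<Prod>k<n. 1 - a * q\<^sup>2 * (q ^ 3) ^ k))
      \<longlonglongrightarrow> qpoch_inf a q"
    by simp
qed

lemma theta_summable: "norm (q::complex) < 1 \<Longrightarrow> (\<lambda>n. q powi ch2 n) summable_on UNIV"
  using has_sum_imp_summable[OF triple_product[of q 1]] by simp

abbreviation qform :: "int \<Rightarrow> int \<Rightarrow> int" where "qform i j \<equiv> i * i + i * j + j * j"

text \<open>For three indices with prescribed sum the linear parts of \<open>ch2\<close> add up to a
  constant, leaving the quadratic form of A2 or, for sum 1, its translate by a dual lattice
  vector.\<close>

lemma ch2_sum: "ch2 i + ch2 j + ch2 (- i - j) = qform i j"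
  "ch2 i + ch2 j + ch2 (1 - i - j) = qform i j - i - j"
  using two_ch2[of i] two_ch2[of j] two_ch2[of "- i - j"] two_ch2[of "1 - i - j"]
  by (simp_all add: algebra_simps)

definition borwein_b :: "complex \<Rightarrow> complex" where
  "borwein_b q = (\<Sum>\<^sub>\<infinity>(i, j)\<in>UNIV. omega powi (i - j) * q powi qform i j)"

text \<open>The function c(q)/3 of the Borweins with its factor q^(1/3) removed, so that all
  exponents are integers. The linear part -2i - j is j + 2(-i-j), coming from shifts of z by 1, q
  and q^2.\<close>

definition A2K :: "complex \<Rightarrow> complex" where
  "A2K q = (\<Sum>\<^sub>\<infinity>(i, j)\<in>UNIV. q powi (3 * qform i j - 2 * i - j))"

text \<open>The constant term in \<open>z\<close> of \<open>J(z) J(\<omega>z) J(\<omega>\<^sup>2z) = (E\<^sub>1\<^sup>3 / E\<^sub>3) J(z\<^sup>3; q\<^sup>3)\<close>, where \<open>J\<close> is the triple product.\<close>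

lemma borwein_b_eq:
  assumes q: "norm q < 1" and q0: "q \<noteq> 0"
  shows "borwein_b q = euler q ^ 3 / euler (q ^ 3)"
proof -
  have q3: "norm (q ^ 3) < 1" by (rule norm_power_less_1[OF q]) simp
  define f where "f m n = q powi ch2 n * (omega ^ m) powi n" for m :: nat and n
  \<comment> \<open>Supported on multiples of 3, because the product on the right depends on z only
    through z^3.\<close>
  define g where "g s = (if 3 dvd s then (q ^ 3) powi ch2 (s div 3) * (euler q ^ 3 / euler (q ^ 3)) else 0)" for s :: int
  define J where "J q z = qpoch_inf (- z) q * qpoch_inf (- q / z) q * euler q" for q z
  have nom: "norm (omega ^ m) = 1" for m by (simp add: norm_power)
  have fs: "((\<lambda>n. f m n * z powi n) has_sum J q (omega ^ m * z)) UNIV" if "norm z = 1" for z m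
  proof -
    have "omega ^ m * z \<noteq> 0" using that by auto
    from triple_product[OF q this] show ?thesis
      by (simp add: f_def J_def power_int_mult_distrib mult.assoc)
  qed
  have fsum: "f m summable_on UNIV" for m
    unfolding f_def using theta_summable[OF q] by (rule summable_on_mult_unit) (use nom norm_power_int_1 in blast)
  have prod: "J q (omega ^ 0 * z) * J q (omega ^ 1 * z) * J q (omega ^ 2 * z) = (euler q ^ 3 / euler (q ^ 3)) * J (q ^ 3) (z ^ 3)"
    if z: "norm z = 1" for z
  proof -
    have z0: "z \<noteq> 0" using z by auto
    have i1: "- q / (omega * z) = omega\<^sup>2 * (- q / z)" and i2: "- q / (omega\<^sup>2 * z) = omega * (- q / z)"
      using omega_cube z0 by (auto simp: field_simps power2_eq_square power3_eq_cube)
    have A: "qpoch_inf (- z) q * qpoch_inf (- (omega * z)) q * qpoch_inf (- (omega\<^sup>2 * z)) q = qpoch_inf (- (z ^ 3)) (q ^ 3)"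
      using qpoch_inf_cube[OF q, of "- z"] by simp
    have B: "qpoch_inf (- q / z) q * qpoch_inf (omega * (- q / z)) q * qpoch_inf (omega\<^sup>2 * (- q / z)) q = qpoch_inf (- (q ^ 3) / z ^ 3) (q ^ 3)"
      using qpoch_inf_cube[OF q, of "- q / z"] by (simp add: power_divide)
    have "J q (omega ^ 0 * z) * J q (omega ^ 1 * z) * J q (omega ^ 2 * z)
       = (qpoch_inf (- z) q * qpoch_inf (- (omega * z)) q * qpoch_inf (- (omega\<^sup>2 * z)) q)
        * (qpoch_inf (- q / z) q * qpoch_inf (omega * (- q / z)) q * qpoch_inf (omega\<^sup>2 * (- q / z)) q) * euler q ^ 3"
      unfolding J_def power_0 power_one_right mult_1_left i1 i2 power3_eq_cube by (simp only: mult_ac)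
    also have "\<dots> = (euler q ^ 3 / euler (q ^ 3)) * J (q ^ 3) (z ^ 3)"
      unfolding A B J_def using euler_neq_0[OF q3] by simp
    finally show ?thesis .
  qed
  have gs: "((\<lambda>s. g s * z powi s) has_sum (euler q ^ 3 / euler (q ^ 3)) * J (q ^ 3) (z ^ 3)) UNIV" if z: "norm z = 1" for z
  proof -
    have z0: "z ^ 3 \<noteq> 0" using z by auto
    have calc: "((\<lambda>n. (q ^ 3) powi ch2 n * (z ^ 3) powi n * (euler q ^ 3 / euler (q ^ 3))) has_sum (J (q ^ 3) (z ^ 3) * (euler q ^ 3 / euler (q ^ 3)))) UNIV"
      unfolding J_def by (intro has_sum_cmult_left triple_product q3 z0)
    have "((\<lambda>n. g (3 * n) * z powi (3 * n)) has_sum (euler q ^ 3 / euler (q ^ 3)) * J (q ^ 3) (z ^ 3)) UNIV"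
    proof -
      have "z powi (3 * n) = (z ^ 3) powi n" for n using power_int_power[of z 3 n] by simp
      then have "g (3 * n) * z powi (3 * n) = (q ^ 3) powi ch2 n * (z ^ 3) powi n * (euler q ^ 3 / euler (q ^ 3))" for n
        by (simp add: g_def mult_ac del: power_int_mult_numeral)
      then show ?thesis using calc by (simp only: mult.commute)
    qed
    then have "((\<lambda>s. g s * z powi s) has_sum (euler q ^ 3 / euler (q ^ 3)) * J (q ^ 3) (z ^ 3)) (range ((*) 3))"
      by (subst has_sum_reindex) (auto simp: inj_on_def o_def)
    then show ?thesis
      by (rule has_sum_cong_neutral[THEN iffD1, rotated -1]) (auto simp: g_def)
  qed
  have gsum: "g summable_on UNIV" using has_sum_imp_summable[OF gs[of 1]] by simp
  have "conv3 (f 0) (f 1) (f 2) 0 = g 0"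
  proof (rule laurent_unique[OF conv3_summable(1)[OF fsum fsum fsum] gsum _ gs])
    fix z :: complex assume z: "norm z = 1"
    show "((\<lambda>n. conv3 (f 0) (f 1) (f 2) n * z powi n) has_sum (euler q ^ 3 / euler (q ^ 3)) * J (q ^ 3) (z ^ 3)) UNIV"
      unfolding prod[OF z, symmetric] by (intro conv3_has_sum(1) fs z)
  qed
  moreover have "conv3 (f 0) (f 1) (f 2) 0 = borwein_b q"
    unfolding conv3_def borwein_b_def
  proof (intro infsum_cong, safe)
    fix i j :: int
    have o: "omega powi j * (omega ^ 2) powi (- i - j) = omega powi (i - j)"
    proof -
      have "omega powi j * (omega ^ 2) powi (- i - j) = omega powi (j + 2 * (- i - j))"
        unfolding power_int_power by (subst power_int_add[symmetric]) auto
      also have "j + 2 * (- i - j) = (i - j) + 3 * (- i)" by simp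
      also have "omega powi \<dots> = omega powi (i - j) * (omega ^ 3) powi (- i)"
        unfolding power_int_power by (subst power_int_add[symmetric]) auto
      finally show ?thesis by (simp add: omega_cube)
    qed
    have e: "q powi ch2 i * q powi ch2 j * q powi ch2 (- i - j) = q powi qform i j"
      unfolding ch2_sum(1)[symmetric] using q0 by (simp add: power_int_add)
    have "f 0 i * f 1 j * f 2 (0 - i - j) = (q powi ch2 i * q powi ch2 j * q powi ch2 (- i - j)) * (omega powi j * (omega ^ 2) powi (- i - j))"
      by (simp add: f_def mult_ac)
    then show "f 0 i * f 1 j * f 2 (0 - i - j) = omega powi (i - j) * q powi qform i j"
      unfolding e o by (simp add: mult.commute)
  qed
  ultimately show ?thesis by (simp add: g_def ch2_def)
qed

text \<open>The constant term in \<open>z\<close> of \<open>J(z; q\<^sup>3) J(zq; q\<^sup>3) J(zq\<^sup>2; q\<^sup>3) = (E\<^sub>3\<^sup>3 / E\<^sub>1) J(z; q)\<close>.\<close>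

lemma A2K_eq:
  assumes q: "norm q < 1" and q0: "q \<noteq> 0"
  shows "A2K q = euler (q ^ 3) ^ 3 / euler q"
proof -
  have q3: "norm (q ^ 3) < 1" by (rule norm_power_less_1[OF q]) simp
  define f where "f m n = (q ^ 3) powi ch2 n * (q ^ m) powi n" for m :: nat and n
  define g where "g s = q powi ch2 s * (euler (q ^ 3) ^ 3 / euler q)" for s :: int
  define J where "J q z = qpoch_inf (- z) q * qpoch_inf (- q / z) q * euler q" for q z
  have fs: "((\<lambda>n. f m n * z powi n) has_sum J (q ^ 3) (q ^ m * z)) UNIV" if "norm z = 1" for z m
  proof -
    have "q ^ m * z \<noteq> 0" using that q0 by auto
    from triple_product[OF q3 this] show ?thesis
      by (simp add: f_def J_def power_int_mult_distrib mult.assoc)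
  qed
  have fsum: "f m summable_on UNIV" for m
    using has_sum_imp_summable[OF fs[of 1 m]] by simp
  have prod: "J (q ^ 3) (q ^ 0 * z) * J (q ^ 3) (q ^ 1 * z) * J (q ^ 3) (q ^ 2 * z) = J q z * (euler (q ^ 3) ^ 3 / euler q)"
    if z: "norm z = 1" for z
  proof -
    have z0: "z \<noteq> 0" using z by auto
    have i: "- (q ^ 3) / z = (- q / z) * q\<^sup>2" "- (q ^ 3) / (q * z) = (- q / z) * q" "- (q ^ 3) / (q\<^sup>2 * z) = - q / z"
      using q0 z0 by (auto simp: field_simps power2_eq_square power3_eq_cube)
    have j0: "J (q ^ 3) (q ^ 0 * z) = qpoch_inf (- z) (q ^ 3) * qpoch_inf ((- q / z) * q\<^sup>2) (q ^ 3) * euler (q ^ 3)"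
      unfolding J_def power_0 mult_1_left i(1) ..
    have j1: "J (q ^ 3) (q ^ 1 * z) = qpoch_inf (- z * q) (q ^ 3) * qpoch_inf ((- q / z) * q) (q ^ 3) * euler (q ^ 3)"
      unfolding J_def power_one_right i(2) by (simp only: mult.commute[of q z] minus_mult_left)
    have j2: "J (q ^ 3) (q ^ 2 * z) = qpoch_inf (- z * q\<^sup>2) (q ^ 3) * qpoch_inf (- q / z) (q ^ 3) * euler (q ^ 3)"
      unfolding J_def i(3) by (simp only: mult.commute[of "q\<^sup>2" z] minus_mult_left)
    have "J (q ^ 3) (q ^ 0 * z) * J (q ^ 3) (q ^ 1 * z) * J (q ^ 3) (q ^ 2 * z)
       = (qpoch_inf (- z) (q ^ 3) * qpoch_inf (- z * q) (q ^ 3) * qpoch_inf (- z * q\<^sup>2) (q ^ 3))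
        * (qpoch_inf (- q / z) (q ^ 3) * qpoch_inf ((- q / z) * q) (q ^ 3) * qpoch_inf ((- q / z) * q\<^sup>2) (q ^ 3)) * euler (q ^ 3) ^ 3"
      unfolding j0 j1 j2 power3_eq_cube[of "euler _"] by (simp only: mult_ac)
    also have "\<dots> = J q z * (euler (q ^ 3) ^ 3 / euler q)"
      unfolding qpoch_inf_split3[OF q] J_def using euler_neq_0[OF q] by simp
    finally show ?thesis .
  qed
  have gs: "((\<lambda>s. g s * z powi s) has_sum J q z * (euler (q ^ 3) ^ 3 / euler q)) UNIV" if z: "norm z = 1" for z
  proof -
    have z0: "z \<noteq> 0" using z by auto
    show ?thesis
      using has_sum_cmult_left[OF triple_product[OF q z0], of "euler (q ^ 3) ^ 3 / euler q"]
      unfolding J_def g_def by (simp add: mult_ac)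
  qed
  have gsum: "g summable_on UNIV" using has_sum_imp_summable[OF gs[of 1]] by simp
  have "conv3 (f 0) (f 1) (f 2) 0 = g 0"
  proof (rule laurent_unique[OF conv3_summable(1)[OF fsum fsum fsum] gsum _ gs])
    fix z :: complex assume z: "norm z = 1"
    show "((\<lambda>n. conv3 (f 0) (f 1) (f 2) n * z powi n) has_sum J q z * (euler (q ^ 3) ^ 3 / euler q)) UNIV"
      unfolding prod[OF z, symmetric] by (intro conv3_has_sum(1) fs z)
  qed
  moreover have "conv3 (f 0) (f 1) (f 2) 0 = A2K q"
    unfolding conv3_def A2K_def
  proof (intro infsum_cong, safe)
    fix i j :: int
    have e: "3 * qform i j - 2 * i - j = (int 3 * ch2 i + int 0 * i) + (int 3 * ch2 j + int 1 * j)
        + (int 3 * ch2 (0 - i - j) + int 2 * (0 - i - j))"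
      using ch2_sum(1)[of i j] by simp
    show "f 0 i * f 1 j * f 2 (0 - i - j) = q powi (3 * qform i j - 2 * i - j)"
      unfolding e f_def power_int_power power_int_add[OF disjI1[OF q0]] ..
  qed
  ultimately show ?thesis by (simp add: g_def ch2_def)
qed

section \<open>Dissection of lattice sums by residues modulo 3\<close>

lemma infsum_reindex_int2:
  fixes f g :: "int \<times> int \<Rightarrow> complex"
  assumes "\<And>x. i (j x) = x" "\<And>x. j (i x) = x" "\<And>x. g (j x) = f x"
  shows "infsum f UNIV = infsum g UNIV"
  by (rule infsum_reindex_bij_witness[of _ i j]) (use assms in auto)

lemma summable_on_reindex_int2:
  fixes f g :: "int \<times> int \<Rightarrow> complex"
  assumes "\<And>x. i (j x) = x" "\<And>x. j (i x) = x" "\<And>x. g (j x) = f x"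
  shows "f summable_on UNIV \<longleftrightarrow> g summable_on UNIV"
  by (rule summable_on_reindex_bij_witness[of _ i j]) (use assms in auto)

lemma int_mod_cases3: obtains (0) m where "n = 3 * m" | (1) m where "n = 3 * m + 1" | (2) m where "n = 3 * m + (2::int)"
proof -
  have "n = 3 * (n div 3) + n mod 3" by simp
  moreover have "n mod 3 = 0 \<or> n mod 3 = 1 \<or> n mod 3 = 2" by auto
  ultimately show thesis using that by (metis add.right_neutral)
qed

lemma infsum_split_snd3:
  fixes f :: "int \<times> int \<Rightarrow> complex"
  assumes f: "f summable_on UNIV"
  shows "infsum f UNIV = infsum (\<lambda>(x, y). f (x, 3 * y)) UNIV + infsum (\<lambda>(x, y). f (x, 3 * y + 1)) UNIV
           + infsum (\<lambda>(x, y). f (x, 3 * y + 2)) UNIV"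
    and "(\<lambda>(x, y). f (x, 3 * y + r)) summable_on UNIV"
proof -
  let ?h = "\<lambda>r (x, y). (x, 3 * y + r) :: int \<times> int"
  have inj: "inj (?h r)" for r by (auto simp: inj_on_def)
  have s: "f summable_on A" for A using summable_on_subset_banach[OF f] by auto
  have re: "infsum f (range (?h r)) = infsum (\<lambda>(x, y). f (x, 3 * y + r)) UNIV" for r
    by (subst infsum_reindex[OF inj]) (auto simp: o_def case_prod_unfold)
  show "(\<lambda>(x, y). f (x, 3 * y + r)) summable_on UNIV"
    using s[of "range (?h r)"] by (subst (asm) summable_on_reindex[OF inj]) (auto simp: o_def case_prod_unfold)
  have cover: "UNIV = range (?h 0) \<union> range (?h 1) \<union> range (?h 2)"
  proof (intro equalityI subsetI)
    fix p :: "int \<times> int"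
    obtain x n where p: "p = (x, n)" by (cases p)
    show "p \<in> range (?h 0) \<union> range (?h 1) \<union> range (?h 2)"
      by (cases n rule: int_mod_cases3) (force simp: p image_iff)+
  qed auto
  have "infsum f (range (?h 0) \<union> range (?h 1) \<union> range (?h 2))
      = infsum f (range (?h 0)) + infsum f (range (?h 1)) + infsum f (range (?h 2))"
  proof -
    have d1: "range (?h 0) \<inter> range (?h 1) = {}" by (auto; presburger)
    have d2: "(range (?h 0) \<union> range (?h 1)) \<inter> range (?h 2) = {}" by (auto; presburger)
    show ?thesis by (simp only: infsum_Un_disjoint[OF s s d1] infsum_Un_disjoint[OF s s d2])
  qed
  then show "infsum f UNIV = infsum (\<lambda>(x, y). f (x, 3 * y)) UNIV + infsum (\<lambda>(x, y). f (x, 3 * y + 1)) UNIV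
           + infsum (\<lambda>(x, y). f (x, 3 * y + 2)) UNIV"
    unfolding cover[symmetric] re by simp
qed

text \<open>The coefficient of \<open>z\<^sup>s\<close> in the cube of the theta series; for \<open>s = 0\<close> it is the theta series of
  the lattice \<open>A\<^sub>2\<close>, for \<open>s = 1\<close> that of a coset in the dual lattice.\<close>

definition A2th :: "complex \<Rightarrow> int \<Rightarrow> complex" where
  "A2th q = conv3 (\<lambda>n. q powi ch2 n) (\<lambda>n. q powi ch2 n) (\<lambda>n. q powi ch2 n)"

text \<open>The pairs with i congruent to j modulo 3 form a sublattice of index 3 in A2 that is
  again a copy of A2, scaled by the square root of 3; this is how q^3 enters. On each of the three
  classes \<open>omega powi (i - j)\<close> is constant.\<close>

lemma infsum_split_diff3:
  fixes f :: "int \<times> int \<Rightarrow> complex"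
  assumes f: "f summable_on UNIV"
  shows "infsum f UNIV = infsum (\<lambda>(j, x). f (j + 3 * x, j)) UNIV + infsum (\<lambda>(j, x). f (j + 3 * x + 1, j)) UNIV
           + infsum (\<lambda>(j, x). f (j + 3 * x + 2, j)) UNIV"
    and "(\<lambda>(j, x). f (j + 3 * x + r, j)) summable_on UNIV"
proof -
  have 1: "infsum f UNIV = infsum (\<lambda>(j, d). f (j + d, j)) UNIV"
    by (rule infsum_reindex_int2[of "\<lambda>(j, d). (j + d, j)" "\<lambda>(i, j). (j, i - j)"]) auto
  have 2: "(\<lambda>(j, d). f (j + d, j)) summable_on UNIV"
    using f by (subst summable_on_reindex_int2[of "\<lambda>(i, j). (j, i - j)" "\<lambda>(j, d). (j + d, j)" f]) auto
  show "infsum f UNIV = infsum (\<lambda>(j, x). f (j + 3 * x, j)) UNIV + infsum (\<lambda>(j, x). f (j + 3 * x + 1, j)) UNIV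
           + infsum (\<lambda>(j, x). f (j + 3 * x + 2, j)) UNIV"
    unfolding 1 infsum_split_snd3(1)[OF 2] by (simp add: add.assoc case_prod_unfold)
  show "(\<lambda>(j, x). f (j + 3 * x + r, j)) summable_on UNIV"
    using infsum_split_snd3(2)[OF 2, of r] by (simp add: add.assoc case_prod_unfold)
qed

lemma omega_powi_period: "omega powi (3 * n + r) = omega powi r"
proof -
  have "omega powi (3 * n) = (omega ^ 3) powi n" using power_int_power[of omega 3 n] by simp
  then show ?thesis by (simp add: power_int_add omega_cube)
qed

lemma ch2_add_1: "ch2 (n + 1) = ch2 n + n"
  using two_ch2[of n] two_ch2[of "n + 1"] by (simp add: algebra_simps)

context
  fixes q :: complex
  assumes q: "norm q < 1" and q0: "q \<noteq> 0"
begin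

text \<open>Exponents are split into pieces that may be negative, which is why q = 0 is excluded
  here and treated separately at the end.\<close>

lemma powi_add_q: "q powi a * q powi b = q powi (a + b)"
  using q0 by (simp add: power_int_add)

lemma A2th_altdef: "A2th q s = (\<Sum>\<^sub>\<infinity>(i, j)\<in>UNIV. q powi (ch2 i + ch2 j + ch2 (s - i - j)))"
  unfolding A2th_def conv3_def by (simp only: powi_add_q)

lemma A2th_terms_summable: "(\<lambda>(i, j). q powi (ch2 i + ch2 j + ch2 (s - i - j))) summable_on UNIV"
  using conv3_summable(2)[OF theta_summable[OF q] theta_summable[OF q] theta_summable[OF q], of s]
  by (simp only: powi_add_q)

lemma A2th_0: "A2th q 0 = (\<Sum>\<^sub>\<infinity>(i, j)\<in>UNIV. q powi qform i j)"
  unfolding A2th_altdef by (simp add: ch2_sum)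

lemma A2th_1: "A2th q 1 = (\<Sum>\<^sub>\<infinity>(i, j)\<in>UNIV. q powi (qform i j - i - j))"
  unfolding A2th_altdef ch2_sum(2) ..

lemma qform_summable: "(\<lambda>(i, j). q powi qform i j) summable_on UNIV"
  using A2th_terms_summable[of 0] by (simp add: ch2_sum)

lemma qform1_summable: "(\<lambda>(i, j). q powi (qform i j - i - j)) summable_on UNIV"
  using A2th_terms_summable[of 1] by (simp only: ch2_sum)

lemma A2th_cube: "A2th (q ^ 3) s = (\<Sum>\<^sub>\<infinity>(i, j)\<in>UNIV. q powi (3 * (ch2 i + ch2 j + ch2 (s - i - j))))"
  unfolding A2th_def conv3_def power_int_power by (simp only: powi_add_q distrib_left of_nat_numeral)

text \<open>The part of the A2 theta series with i - j congruent to r modulo 3.\<close>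

abbreviation A2U :: "int \<Rightarrow> complex" where
  "A2U r \<equiv> (\<Sum>\<^sub>\<infinity>(j, x)\<in>UNIV. q powi qform (j + 3 * x + r) j)"

lemma lat_U0: "(A2U 0) = A2th (q ^ 3) 0"
proof -
  have "A2th (q ^ 3) 0 = (\<Sum>\<^sub>\<infinity>(i, j)\<in>UNIV. q powi (3 * qform i j))"
    unfolding A2th_cube by (simp add: ch2_sum)
  also have "\<dots> = (A2U 0)"
    by (rule infsum_reindex_int2[of "\<lambda>(j, x). (j + x, x)" "\<lambda>(m, x). (m - x, x)"]) (auto simp: algebra_simps)
  finally show ?thesis by (rule sym)
qed

text \<open>Interchanging i and j negates i - j and so exchanges the classes 1 and 2.\<close>

lemma lat_U2: "(A2U 2) = (A2U 1)"
  by (rule infsum_reindex_int2[of "\<lambda>(j, x). (j + 3 * x + 1, - x - 1)" "\<lambda>(j, x). (j + 3 * x + 2, - x - 1)"])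
     (auto simp: algebra_simps)

lemma A2K_cube: "A2K (q ^ 3) = (\<Sum>\<^sub>\<infinity>(i, j)\<in>UNIV. q powi (9 * qform i j - 6 * i - 3 * j))"
  unfolding A2K_def power_int_power by (intro infsum_cong) (auto simp: algebra_simps)

lemma infsum_qpi_shift:
  "(\<Sum>\<^sub>\<infinity>(i, j)\<in>UNIV. q powi (e i j + c)) = q powi c * (\<Sum>\<^sub>\<infinity>(i, j)\<in>UNIV. q powi e i j)"
proof -
  have "(\<Sum>\<^sub>\<infinity>(i, j)\<in>UNIV. q powi (e i j + c)) = (\<Sum>\<^sub>\<infinity>x\<in>UNIV. q powi c * (case x of (i, j) \<Rightarrow> q powi e i j))"
    by (intro infsum_cong) (auto simp: powi_add_q add.commute)
  then show ?thesis unfolding infsum_cmult_right' .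
qed

text \<open>Class 1 is split again by j modulo 3. The rotation (i, j) -> (j, -i-j) of the lattice
  preserves the class and permutes the three residues of j cyclically, so the pieces have equal
  sums; the substitutions bring each to the normal form of \<open>A2K\<close>.\<close>

lemma lat_U1: "(A2U 1) = 3 * q * A2K (q ^ 3)"
proof -
  let ?f = "\<lambda>(x, j). q powi qform (j + 3 * x + 1) j"
  have sw: "(A2U 1) = infsum ?f UNIV"
    by (rule infsum_reindex_int2[of prod.swap prod.swap]) auto
  have "(\<lambda>(j, x). q powi qform (j + 3 * x + 1) j) summable_on UNIV"
    using infsum_split_diff3(2)[OF qform_summable, of 1] by simp
  then have fs: "?f summable_on UNIV"
    by (subst summable_on_reindex_int2[of prod.swap prod.swap "\<lambda>(j, x). q powi qform (j + 3 * x + 1) j"]) auto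
  have K: "q * A2K (q ^ 3) = (\<Sum>\<^sub>\<infinity>(i, j)\<in>UNIV. q powi (9 * qform i j - 6 * i - 3 * j + 1))"
    unfolding infsum_qpi_shift A2K_cube by simp
  have "infsum (\<lambda>(x, y). ?f (x, 3 * y)) UNIV = q * A2K (q ^ 3)" unfolding K
    by (rule infsum_reindex_int2[of "\<lambda>(i, j). (j - i, - j)" "\<lambda>(x, y). (- x - y, - y)"]) (auto simp: algebra_simps)
  moreover have "infsum (\<lambda>(x, y). ?f (x, 3 * y + 1)) UNIV = q * A2K (q ^ 3)" unfolding K
    by (rule infsum_reindex_int2[of "\<lambda>(i, j). (i + j - 1 + i, - i)" "\<lambda>(x, y). (- y, x + 2 * y + 1)"]) (auto simp: algebra_simps)
  moreover have "infsum (\<lambda>(x, y). ?f (x, 3 * y + 2)) UNIV = q * A2K (q ^ 3)" unfolding K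
    by (rule infsum_reindex_int2[of "\<lambda>(i, j). (- i - 2 * j, i + j - 1)" "\<lambda>(x, y). (x + 2 * y + 2, - x - y - 1)"]) (auto simp: algebra_simps)
  ultimately show ?thesis unfolding sw infsum_split_snd3(1)[OF fs] by simp
qed

lemma A2th_0_eq: "A2th q 0 = A2th (q ^ 3) 0 + 6 * q * A2K (q ^ 3)"
  unfolding A2th_0 infsum_split_diff3(1)[OF qform_summable] prod.case lat_U2 lat_U1 using lat_U0 by simp

text \<open>The same three pieces as in \<open>A2th_0_eq\<close>, now weighted by 1, omega and
  omega^2; the last two are equal and contribute with omega + omega^2 = -1.\<close>

lemma borwein_b_lat: "borwein_b q = A2th (q ^ 3) 0 - 3 * q * A2K (q ^ 3)"
proof -
  have s: "(\<lambda>(i, j). omega powi (i - j) * q powi qform i j) summable_on UNIV"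
  proof -
    have "(\<lambda>p. (case p of (i, j) \<Rightarrow> q powi qform i j) * omega powi (fst p - snd p)) summable_on UNIV"
      by (rule summable_on_mult_unit[OF qform_summable]) (simp add: norm_power_int_1)
    then show ?thesis by (simp add: case_prod_unfold mult.commute)
  qed
  have o: "omega powi (j + 3 * x - j) = 1" "omega powi (j + 3 * x + 1 - j) = omega" "omega powi (j + 3 * x + 2 - j) = omega\<^sup>2" for j x
    using omega_powi_period[of x 0] omega_powi_period[of x 1] omega_powi_period[of x 2] by simp_all
  have pull: "(\<Sum>\<^sub>\<infinity>(j, x)\<in>UNIV. c * e j x) = c * (\<Sum>\<^sub>\<infinity>(j, x)\<in>UNIV. e j x)" for c :: complex and e :: "int \<Rightarrow> int \<Rightarrow> complex"
    unfolding infsum_cmult_right'[symmetric] by (simp add: case_prod_unfold)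
  have "borwein_b q = (A2U 0)
      + omega * (A2U 1)
      + omega\<^sup>2 * (A2U 2)"
    unfolding borwein_b_def infsum_split_diff3(1)[OF s] prod.case o pull by simp
  also have "\<dots> = A2th (q ^ 3) 0 + (omega + omega\<^sup>2) * (3 * q * A2K (q ^ 3))"
    unfolding lat_U2 lat_U1 lat_U0 by (simp add: algebra_simps)
  also have "omega + omega\<^sup>2 = - 1" using omega_sum by (simp add: add.assoc add_eq_0_iff)
  finally show ?thesis by simp
qed

text \<open>The exponent is symmetric in the triple (i, j, 1-i-j). Permuting this triple cyclically
  changes i - j by a unit modulo 3, so the three residue classes contribute equally.\<close>

lemma A2th_1_eq: "A2th q 1 = 3 * A2K q"
proof -
  let ?f = "\<lambda>(i, j). q powi (qform i j - i - j)"
  have 0: "(\<Sum>\<^sub>\<infinity>(j, x)\<in>UNIV. ?f (j + 3 * x, j)) = A2K q"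
    unfolding A2K_def
    by (rule infsum_reindex_int2[of "\<lambda>(m, x). (m - x, x)" "\<lambda>(j, x). (j + x, x)"]) (auto simp: algebra_simps)
  have 1: "(\<Sum>\<^sub>\<infinity>(j, x)\<in>UNIV. ?f (j + 3 * x + 1, j)) = (\<Sum>\<^sub>\<infinity>(j, x)\<in>UNIV. ?f (j + 3 * x, j))"
    by (rule infsum_reindex_int2[of "\<lambda>(j, x). (3 * x + j, - 2 * x - j)" "\<lambda>(j, x). (- 2 * j - 3 * x, j + x)"]) (auto simp: algebra_simps)
  have 2: "(\<Sum>\<^sub>\<infinity>(j, x)\<in>UNIV. ?f (j + 3 * x + 2, j)) = (\<Sum>\<^sub>\<infinity>(j, x)\<in>UNIV. ?f (j + 3 * x, j))"
    by (rule infsum_reindex_int2[of "\<lambda>(j, x). (- 2 * j - 3 * x + 1, j + x - 1)" "\<lambda>(j, x). (j + 3 * x + 2, - 1 - j - 2 * x)"]) (auto simp: algebra_simps)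
  show ?thesis unfolding A2th_1 infsum_split_diff3(1)[OF qform1_summable] 1 2 0 by simp
qed

text \<open>Raising all three indices by 1 raises each \<open>ch2\<close> by its index, hence the
  total exponent by s.\<close>

lemma A2th_add_3: "A2th q (s + 3) = q powi s * A2th q s"
proof -
  have "A2th q (s + 3) = (\<Sum>\<^sub>\<infinity>(i, j)\<in>UNIV. q powi (ch2 i + ch2 j + ch2 (s - i - j) + s))"
    unfolding A2th_altdef
  proof (rule infsum_reindex_int2[of "\<lambda>(i, j). (i + 1, j + 1)" "\<lambda>(i, j). (i - 1, j - 1)"], goal_cases)
    case (3 x)
    obtain i j where x: "x = (i, j)" by (cases x)
    have e: "s + 3 - i - j = (s - (i - 1) - (j - 1)) + 1" by simp
    have "ch2 i = ch2 (i - 1) + (i - 1)" "ch2 j = ch2 (j - 1) + (j - 1)"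
      using ch2_add_1[of "i - 1"] ch2_add_1[of "j - 1"] by simp_all
    moreover have "ch2 (s + 3 - i - j) = ch2 (s - (i - 1) - (j - 1)) + (s - (i - 1) - (j - 1))"
      unfolding e by (rule ch2_add_1)
    ultimately have "ch2 (i - 1) + ch2 (j - 1) + ch2 (s - (i - 1) - (j - 1)) + s = ch2 i + ch2 j + ch2 (s + 3 - i - j)"
      by linarith
    then show ?case unfolding x prod.case by (simp only:)
  qed auto
  then show ?thesis unfolding infsum_qpi_shift A2th_altdef .
qed

text \<open>The reflection n -> 1 - n fixes \<open>ch2\<close> and takes index sum 2 to 3 - 2 =
  1.\<close>

lemma A2th_2: "A2th q 2 = A2th q 1"
  unfolding A2th_altdef
proof (rule infsum_reindex_int2[of "\<lambda>(i, j). (1 - i, 1 - j)" "\<lambda>(i, j). (1 - i, 1 - j)"], goal_cases)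
  case (3 x)
  have "ch2 (1 - n) = ch2 n" for n using two_ch2[of n] two_ch2[of "1 - n"] by (simp add: algebra_simps)
  moreover obtain i j where x: "x = (i, j)" by (cases x)
  moreover have "1 - (1 - i) - (1 - j) = 1 - (2 - i - j)" by simp
  ultimately show ?case unfolding x prod.case by (simp only:)
qed auto

lemma A2th_residue: "A2th q (3 * t + r) = q powi (3 * ch2 t + r * t) * A2th q r"
proof (induction t rule: int_induct[of _ 0])
  case base
  show ?case by (simp add: ch2_def)
next
  case (step1 t)
  have "3 * (t + 1) + r = (3 * t + r) + 3" by simp
  then have "A2th q (3 * (t + 1) + r) = q powi (3 * t + r) * (q powi (3 * ch2 t + r * t) * A2th q r)"
    by (simp only: A2th_add_3 step1)
  then show ?case unfolding ch2_add_1 mult.assoc[symmetric] powi_add_q by (simp add: algebra_simps)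
next
  case (step2 t)
  have "3 * t + r = (3 * (t - 1) + r) + 3" by simp
  then have "q powi (3 * ch2 t + r * t) * A2th q r = q powi (3 * (t - 1) + r) * A2th q (3 * (t - 1) + r)"
    using step2(2) by (simp only: A2th_add_3)
  also have "3 * ch2 t + r * t = (3 * (t - 1) + r) + (3 * ch2 (t - 1) + r * (t - 1))"
    using ch2_add_1[of "t - 1"] by (simp add: algebra_simps)
  finally show ?case
    unfolding powi_add_q[symmetric] mult.assoc mult_left_cancel[OF power_int_not_zero[OF disjI1[OF q0]]] by (rule sym)
qed


text \<open>The second cubing. Three indices of sum 0 are sorted by residues modulo 3;
  \<open>A2th_residue\<close> leaves a constant for each residue times a sum over the quotients. The
  residues (0,0,0) give the A2 theta series at q^3, (1,1,1) and (2,2,2) its coset, and the six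
  orders of (0,1,2) each give \<open>q * A2K q\<close>.\<close>

lemma A2th_square:
  "conv3 (A2th q) (A2th q) (A2th q) 0 =
     A2th q 0 ^ 3 * A2th (q ^ 3) 0 + 2 * q\<^sup>2 * A2th q 1 ^ 3 * A2th (q ^ 3) 1 + 6 * q * A2K q * A2th q 0 * (A2th q 1)\<^sup>2"
proof -
  let ?T = "A2th q"
  define f where "f = (\<lambda>(i, j). ?T i * ?T j * ?T (0 - i - j))"
  have Ts: "?T summable_on UNIV"
    unfolding A2th_def by (intro conv3_summable theta_summable q)
  have fs: "f summable_on UNIV"
    unfolding f_def by (rule conv3_summable(2)[OF Ts Ts Ts])
  have sw: "infsum g UNIV = infsum (\<lambda>(x, y). g (y, x)) UNIV" for g :: "int \<times> int \<Rightarrow> complex"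
    by (rule infsum_reindex_int2[of prod.swap prod.swap]) auto
  have sws: "g summable_on UNIV \<Longrightarrow> (\<lambda>(x, y). g (y, x)) summable_on UNIV" for g :: "int \<times> int \<Rightarrow> complex"
    by (subst summable_on_reindex_int2[of prod.swap prod.swap g]) auto
  define G where "G r s = (\<Sum>\<^sub>\<infinity>(x, y)\<in>UNIV. f (3 * x + r, 3 * y + s))" for r s
  have split: "infsum f UNIV = G 0 0 + G 1 0 + G 2 0 + (G 0 1 + G 1 1 + G 2 1) + (G 0 2 + G 1 2 + G 2 2)"
  proof -
    have row: "(\<Sum>\<^sub>\<infinity>(x, y)\<in>UNIV. f (x, 3 * y + s)) = G 0 s + G 1 s + G 2 s" for s
    proof -
      have g: "(\<lambda>(x, y). f (x, 3 * y + s)) summable_on UNIV" by (rule infsum_split_snd3(2)[OF fs])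
      show ?thesis
        unfolding sw[of "\<lambda>(x, y). f (x, 3 * y + s)"] prod.case
        unfolding infsum_split_snd3(1)[OF sws[OF g], unfolded prod.case] G_def
        unfolding sw[of "\<lambda>(x, y). f (3 * y, 3 * x + s)"] sw[of "\<lambda>(x, y). f (3 * y + 1, 3 * x + s)"]
           sw[of "\<lambda>(x, y). f (3 * y + 2, 3 * x + s)"] by simp
    qed
    show ?thesis unfolding infsum_split_snd3(1)[OF fs] using row[of 0] row[of 1] row[of 2] by simp
  qed
  have trm: "f (3 * x + r, 3 * y + s) = q powi (3 * ch2 x + r * x + (3 * ch2 y + s * y) + (3 * ch2 z + u * z)) * (?T r * ?T s * ?T u)"
    if "- (3 * x + r) - (3 * y + s) = 3 * z + u" for x y r s z u
    unfolding f_def prod.case diff_0 that A2th_residue powi_add_q[symmetric] by (simp only: mult_ac)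
  \<comment> \<open>\<open>z x y\<close> and \<open>u\<close> are quotient and residue of the third
    index, and \<open>e\<close> is the resulting exponent. Its equation is doubled so that
    \<open>ch2\<close> can enter through \<open>two_ch2\<close> without division.\<close>
  have Geq: "G r s = (?T r * ?T s * ?T u) * (\<Sum>\<^sub>\<infinity>(x, y)\<in>UNIV. q powi (e x y))"
    if z: "\<And>x y. - (3 * x + r) - (3 * y + s) = 3 * z x y + u"
      and e: "\<And>x y. 3 * (x * (x - 1)) + 2 * (r * x) + (3 * (y * (y - 1)) + 2 * (s * y))
        + (3 * (z x y * (z x y - 1)) + 2 * (u * z x y)) = 2 * e x y"
    for r s u z e
  proof -
    have e': "3 * ch2 x + r * x + (3 * ch2 y + s * y) + (3 * ch2 (z x y) + u * z x y) = e x y" for x y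
      using e[of x y] two_ch2[of x] two_ch2[of y] two_ch2[of "z x y"] by linarith
    have "G r s = (\<Sum>\<^sub>\<infinity>p\<in>UNIV. (?T r * ?T s * ?T u) * (case p of (x, y) \<Rightarrow> q powi e x y))"
      unfolding G_def trm[OF z] e' by (intro infsum_cong) (auto simp: mult.commute)
    then show ?thesis unfolding infsum_cmult_right' .
  qed
  have K1: "q * A2K q = (\<Sum>\<^sub>\<infinity>(i, j)\<in>UNIV. q powi (3 * qform i j - 2 * i - j + 1))"
    unfolding infsum_qpi_shift A2K_def by simp
  have T0c: "A2th (q ^ 3) 0 = (\<Sum>\<^sub>\<infinity>(i, j)\<in>UNIV. q powi (3 * qform i j))"
    unfolding A2th_cube by (simp add: ch2_sum)
  have T1c: "A2th (q ^ 3) 1 = (\<Sum>\<^sub>\<infinity>(i, j)\<in>UNIV. q powi (3 * (qform i j - i - j)))"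
    unfolding A2th_cube ch2_sum(2) ..
  have T1c2: "q\<^sup>2 * A2th (q ^ 3) 1 = (\<Sum>\<^sub>\<infinity>(i, j)\<in>UNIV. q powi (3 * (qform i j - i - j) + 2))"
    unfolding infsum_qpi_shift T1c by simp
  \<comment> \<open>The previous evaluation followed by a bijection of the index pairs, which brings
    each class to the normal form of \<open>A2K\<close> or \<open>A2th\<close>.\<close>
  have Gre: "G r s = ?T r * ?T s * ?T u * (\<Sum>\<^sub>\<infinity>(x, y)\<in>UNIV. q powi (e x y))"
    if ij: "\<And>p. i (j p) = p" "\<And>p. j (i p) = p" and z: "\<And>x y. - (3 * x + r) - (3 * y + s) = 3 * z x y + u"
      and e: "\<And>x y. 3 * (x * (x - 1)) + 2 * (r * x) + (3 * (y * (y - 1)) + 2 * (s * y))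
        + (3 * (z x y * (z x y - 1)) + 2 * (u * z x y)) = 2 * case_prod e (j (x, y))"
    for r s u z e and i j :: "int \<times> int \<Rightarrow> int \<times> int"
  proof -
    have "G r s = ?T r * ?T s * ?T u * (\<Sum>\<^sub>\<infinity>(x, y)\<in>UNIV. q powi (case_prod e (j (x, y))))"
      by (rule Geq[OF z e])
    also have "(\<Sum>\<^sub>\<infinity>(x, y)\<in>UNIV. q powi (case_prod e (j (x, y)))) = (\<Sum>\<^sub>\<infinity>(x, y)\<in>UNIV. q powi (e x y))"
      by (rule infsum_reindex_int2[OF ij]) (auto split: prod.splits)
    finally show ?thesis .
  qed
  have G00: "G 0 0 = ?T 0 * ?T 0 * ?T 0 * A2th (q ^ 3) 0"
    unfolding T0c by (rule Geq[where z = "\<lambda>x y. - x - y"]) (auto simp: algebra_simps)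
  have G01: "G 0 1 = ?T 0 * ?T 1 * ?T 2 * (q * A2K q)"
    unfolding K1 by (rule Gre[where z = "\<lambda>x y. - x - y - 1" and i = "\<lambda>(i, j). (- j, - i)" and j = "\<lambda>(x, y). (- y, - x)"])
       (auto simp: algebra_simps)
  have G10: "G 1 0 = ?T 1 * ?T 0 * ?T 2 * (q * A2K q)"
    unfolding K1 by (rule Gre[where z = "\<lambda>x y. - x - y - 1" and i = "\<lambda>(i, j). (- i, - j)" and j = "\<lambda>(x, y). (- x, - y)"])
       (auto simp: algebra_simps)
  have G02: "G 0 2 = ?T 0 * ?T 2 * ?T 1 * (q * A2K q)"
    unfolding K1 by (rule Gre[where z = "\<lambda>x y. - x - y - 1" and i = "\<lambda>(i, j). (j, i - 1)" and j = "\<lambda>(x, y). (y + 1, x)"])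
       (auto simp: algebra_simps)
  have G20: "G 2 0 = ?T 2 * ?T 0 * ?T 1 * (q * A2K q)"
    unfolding K1 by (rule Gre[where z = "\<lambda>x y. - x - y - 1" and i = "\<lambda>(i, j). (i - 1, j)" and j = "\<lambda>(x, y). (x + 1, y)"])
       (auto simp: algebra_simps)
  have G12: "G 1 2 = ?T 1 * ?T 2 * ?T 0 * (q * A2K q)"
    unfolding K1 by (rule Gre[where z = "\<lambda>x y. - x - y - 1" and i = "\<lambda>(i, j). (- i, i + j - 1)" and j = "\<lambda>(x, y). (- x, x + y + 1)"])
       (auto simp: algebra_simps)
  have G21: "G 2 1 = ?T 2 * ?T 1 * ?T 0 * (q * A2K q)"
    unfolding K1 by (rule Gre[where z = "\<lambda>x y. - x - y - 1" and i = "\<lambda>(i, j). (i + j - 1, - i)" and j = "\<lambda>(x, y). (- y, x + y + 1)"])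
       (auto simp: algebra_simps)
  have G11: "G 1 1 = ?T 1 * ?T 1 * ?T 1 * (q\<^sup>2 * A2th (q ^ 3) 1)"
    unfolding T1c2 by (rule Gre[where z = "\<lambda>x y. - x - y - 1" and i = "\<lambda>(i, j). (- i, - j)" and j = "\<lambda>(x, y). (- x, - y)"])
       (auto simp: algebra_simps)
  have G22: "G 2 2 = ?T 2 * ?T 2 * ?T 2 * (q\<^sup>2 * A2th (q ^ 3) 1)"
    unfolding T1c2 by (rule Gre[where z = "\<lambda>x y. - x - y - 2" and i = "\<lambda>(i, j). (i - 1, j - 1)" and j = "\<lambda>(x, y). (x + 1, y + 1)"])
       (auto simp: algebra_simps)
  have "conv3 ?T ?T ?T 0 = infsum f UNIV" unfolding conv3_def f_def ..
  then show ?thesis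
    unfolding split G00 G01 G02 G10 G11 G12 G20 G21 G22 A2th_2
    by (simp add: algebra_simps power2_eq_square power3_eq_cube)
qed

end

section \<open>Generalized Frobenius partitions as charged pairs of sets\<close>

lemma colored_less_trans: "colored_less x y \<Longrightarrow> colored_less y z \<Longrightarrow> colored_less x z"
  by (auto simp: colored_less_def)

lemma colored_less_total: "x \<noteq> y \<Longrightarrow> colored_less x y \<or> colored_less y x"
  by (cases x; cases y) (auto simp: colored_less_def)

lemma ex_frobenius_row:
  assumes "finite A" "A \<subseteq> UNIV \<times> {1..k}"
  obtains xs where "frobenius_row k xs" "set xs = A"
proof -
  have "\<exists>xs. set xs = A \<and> sorted_wrt (\<lambda>x y. colored_less y x) xs"
    using assms(1)
  proof (induction A)
    case (insert a A)
    then obtain xs where xs: "set xs = A" "sorted_wrt (\<lambda>x y. colored_less y x) xs" by blast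
    let ?ys = "filter (\<lambda>x. colored_less a x) xs @ a # filter (\<lambda>x. colored_less x a) xs"
    have "x = a \<or> colored_less a x \<or> colored_less x a" for x
      using colored_less_total[of x a] by blast
    then have "set ?ys = insert a A" unfolding xs(1)[symmetric] by auto
    moreover have "sorted_wrt (\<lambda>x y. colored_less y x) ?ys"
      using xs(2) by (auto simp: sorted_wrt_append sorted_wrt_filter intro: colored_less_trans)
    ultimately show ?case by blast
  qed simp
  then show ?thesis using assms(2) that by (fastforce simp: frobenius_row_def)
qed

definition colored_sets :: "nat \<Rightarrow> colored_nat set set" where
  "colored_sets k = {A. finite A \<and> A \<subseteq> UNIV \<times> {1..k}}"

text \<open>A finite family of sets lies in the power set of its union, over which the sum factors
  into a product of terms 1 + |g|; this is at most the exponential of the total of |g|.\<close>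

lemma summable_on_prod_sets:
  fixes g :: "'a \<Rightarrow> complex"
  assumes g: "(\<lambda>x. norm (g x)) summable_on U"
  shows "(\<lambda>A. \<Prod>x\<in>A. g x) summable_on {A. finite A \<and> A \<subseteq> U}"
proof (rule abs_summable_summable, rule nonneg_bdd_above_summable_on)
  show "bdd_above (sum (\<lambda>A. norm (\<Prod>x\<in>A. g x)) ` {F. F \<subseteq> {A. finite A \<and> A \<subseteq> U} \<and> finite F})"
  proof (rule bdd_aboveI2)
    fix F assume F: "F \<in> {F. F \<subseteq> {A. finite A \<and> A \<subseteq> U} \<and> finite F}"
    have V: "finite (\<Union>F)" "\<Union>F \<subseteq> U" using F by auto
    have "(\<Sum>A\<in>F. norm (\<Prod>x\<in>A. g x)) \<le> (\<Sum>A\<in>Pow (\<Union>F). norm (\<Prod>x\<in>A. g x))"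
      using V F by (intro sum_mono2) auto
    also have "\<dots> = (\<Prod>x\<in>\<Union>F. norm (g x) + 1)"
      using prod_add[OF V(1), of "\<lambda>x. norm (g x)" "\<lambda>_. 1"] by (simp add: prod_norm)
    also have "\<dots> \<le> exp (\<Sum>x\<in>\<Union>F. norm (g x))"
      using prod_le_exp_sum[of "\<Union>F" "\<lambda>x. norm (g x)"] by (simp add: add.commute)
    also have "\<dots> \<le> exp (infsum (\<lambda>x. norm (g x)) U)"
      using finite_sum_le_infsum[OF g V] by simp
    finally show "(\<Sum>A\<in>F. norm (\<Prod>x\<in>A. g x)) \<le> exp (infsum (\<lambda>x. norm (g x)) U)" .
  qed
qed auto

text \<open>Expanding the k-th power of the product means choosing, for each number and each colour,
  either 1 or the other summand, that is, choosing a finite set of coloured numbers.\<close>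

lemma colored_sets_has_sum:
  fixes q :: complex
  assumes q: "norm q < 1"
  shows "((\<lambda>A. \<Prod>x\<in>A. - a * q ^ fst x) has_sum qpoch_inf a q ^ k) (colored_sets k)"
proof -
  let ?g = "\<lambda>x::colored_nat. - a * q ^ fst x"
  have "((\<lambda>(l, c). norm q ^ l * norm a) has_sum (1 / (1 - norm q) * (real k * norm a))) (UNIV \<times> {1..k})"
  proof (rule has_sum_SigmaI)
    show "((\<lambda>c. case (l, c) of (l, c) \<Rightarrow> norm q ^ l * norm a) has_sum norm q ^ l * (real k * norm a)) {1..k}" for l
      by (simp add: has_sum_finite_iff)
    have gs: "(\<lambda>l. norm q ^ l) sums (1 / (1 - norm q))" using q by (intro geometric_sums) auto
    then have "((\<lambda>l. norm q ^ l) has_sum (1 / (1 - norm q))) UNIV" by (rule sums_nonneg_imp_has_sum) simp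
    then show gh: "((\<lambda>l. norm q ^ l * (real k * norm a)) has_sum (1 / (1 - norm q) * (real k * norm a))) UNIV"
      by (rule has_sum_cmult_left)
    show "(\<lambda>(l, c). norm q ^ l * norm a) summable_on UNIV \<times> {1..k}"
    proof (rule summable_on_SigmaI)
      show "((\<lambda>c. case (l, c) of (l, c) \<Rightarrow> norm q ^ l * norm a) has_sum norm q ^ l * (real k * norm a)) {1..k}" for l
        by (simp add: has_sum_finite_iff)
      show "(\<lambda>l. norm q ^ l * (real k * norm a)) summable_on UNIV" using gh by (rule has_sum_imp_summable)
    qed auto
  qed
  then have g: "(\<lambda>x. norm (?g x)) summable_on UNIV \<times> {1..k}"
    using has_sum_imp_summable by (force simp: case_prod_unfold norm_mult norm_power mult.commute)
  have "(\<lambda>A. \<Prod>x\<in>A. ?g x) summable_on colored_sets k"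
    unfolding colored_sets_def by (rule summable_on_prod_sets[OF g])
  then have hs: "((\<lambda>A. \<Prod>x\<in>A. ?g x) has_sum infsum (\<lambda>A. \<Prod>x\<in>A. ?g x) (colored_sets k)) (colored_sets k)" by simp
  \<comment> \<open>The power sets of \<open>V n\<close> exhaust the finite coloured sets, and over
    each of them the sum factors; a limit along this sequence evaluates the unordered sum.\<close>
  define V where "V n = {..<n} \<times> {1..k}" for n :: nat
  have "filterlim (\<lambda>n. Pow (V n)) (finite_subsets_at_top (colored_sets k)) sequentially"
    unfolding filterlim_finite_subsets_at_top
  proof (intro allI impI)
    fix X assume X: "finite X \<and> X \<subseteq> colored_sets k"
    then have fin: "finite (\<Union>X)" by (auto simp: colored_sets_def)
    obtain N where N: "\<And>x. x \<in> \<Union>X \<Longrightarrow> fst x < N"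
    proof
      show "fst x < Suc (Max (fst ` \<Union>X))" if "x \<in> \<Union>X" for x
        using Max_ge[of "fst ` \<Union>X" "fst x"] fin that by (auto simp: less_Suc_eq_le)
    qed
    show "\<forall>\<^sub>F n in sequentially. finite (Pow (V n)) \<and> X \<subseteq> Pow (V n) \<and> Pow (V n) \<subseteq> colored_sets k"
      using eventually_ge_at_top[of N]
    proof eventually_elim
      case (elim n)
      have "A \<subseteq> V n" if "A \<in> X" for A
      proof
        fix x assume x: "x \<in> A"
        then have "fst x < n" using N[OF UnionI[OF that x]] elim by simp
        moreover have "x \<in> UNIV \<times> {1..k}" using x that X by (auto simp: colored_sets_def)
        ultimately show "x \<in> V n" by (auto simp: V_def mem_Times_iff)
      qed
      moreover have "finite (V n)" by (simp add: V_def)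
      ultimately show ?case by (auto simp: colored_sets_def V_def intro: finite_subset)
    qed
  qed
  then have "(\<lambda>n. \<Sum>A\<in>Pow (V n). \<Prod>x\<in>A. ?g x) \<longlonglongrightarrow> infsum (\<lambda>A. \<Prod>x\<in>A. ?g x) (colored_sets k)"
    using hs unfolding has_sum_def by (rule filterlim_compose[rotated])
  moreover have "(\<Sum>A\<in>Pow (V n). \<Prod>x\<in>A. ?g x) = (\<Prod>l<n. 1 - a * q ^ l) ^ k" for n
  proof -
    have "(\<Sum>A\<in>Pow (V n). \<Prod>x\<in>A. ?g x) = (\<Prod>x\<in>V n. ?g x + 1)"
      using prod_add[of "V n" ?g "\<lambda>_. 1"] by (simp add: V_def)
    also have "\<dots> = (\<Prod>l<n. \<Prod>c\<in>{1..k}. 1 - a * q ^ l)"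
      unfolding V_def by (subst prod.cartesian_product) (auto intro!: prod.cong)
    finally show ?thesis by (simp add: prod_power_distrib)
  qed
  moreover have "(\<lambda>n. (\<Prod>l<n. 1 - a * q ^ l) ^ k) \<longlonglongrightarrow> qpoch_inf a q ^ k"
    by (intro tendsto_power qpoch_inf_tendsto q)
  ultimately have "infsum (\<lambda>A. \<Prod>x\<in>A. ?g x) (colored_sets k) = qpoch_inf a q ^ k"
    by (simp only: LIMSEQ_unique)
  then show ?thesis using hs by simp
qed

text \<open>The number of columns in the size of a symbol is charged to the first row, hence the
  \<open>Suc\<close> there. The charge is the exponent of z and vanishes exactly when both rows have
  the same length.\<close>

definition pair_weight :: "colored_nat set \<times> colored_nat set \<Rightarrow> nat" where
  "pair_weight p = (\<Sum>x\<in>fst p. Suc (fst x)) + (\<Sum>x\<in>snd p. fst x)"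

definition pair_charge :: "colored_nat set \<times> colored_nat set \<Rightarrow> int" where
  "pair_charge p = int (card (snd p)) - int (card (fst p))"

definition charged_pairs :: "nat \<Rightarrow> int \<Rightarrow> (colored_nat set \<times> colored_nat set) set" where
  "charged_pairs k s = {p \<in> colored_sets k \<times> colored_sets k. pair_charge p = s}"

lemma colored_pairs_has_sum:
  fixes q z :: complex
  assumes q: "norm q < 1" and z: "z \<noteq> 0"
  shows "((\<lambda>p. q ^ pair_weight p * z powi pair_charge p) has_sum (qpoch_inf (- q / z) q ^ k * qpoch_inf (- z) q ^ k))
          (colored_sets k \<times> colored_sets k)"
proof -
  have "((\<lambda>(A, B). (\<Prod>x\<in>A. - (- q / z) * q ^ fst x) * (\<Prod>x\<in>B. - (- z) * q ^ fst x)) has_sum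
      (qpoch_inf (- q / z) q ^ k * qpoch_inf (- z) q ^ k)) (colored_sets k \<times> colored_sets k)"
    by (intro has_sum_product colored_sets_has_sum q)
  moreover have "(\<Prod>x\<in>A. - (- q / z) * q ^ fst x) * (\<Prod>x\<in>B. - (- z) * q ^ fst x)
      = q ^ pair_weight (A, B) * z powi pair_charge (A, B)" for A B :: "colored_nat set"
  proof -
    have "(\<Prod>x\<in>A. - (- q / z) * q ^ fst x) = (\<Prod>x\<in>A. q ^ Suc (fst x)) * (\<Prod>x\<in>A. inverse z)"
      unfolding prod.distrib[symmetric] by (simp add: divide_inverse mult_ac)
    also have "\<dots> = q ^ (\<Sum>x\<in>A. Suc (fst x)) * inverse z ^ card A"
      by (simp only: power_sum prod_constant)
    finally have 1: "(\<Prod>x\<in>A. - (- q / z) * q ^ fst x) = q ^ (\<Sum>x\<in>A. Suc (fst x)) * inverse z ^ card A" .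
    have 2: "(\<Prod>x\<in>B. - (- z) * q ^ fst x) = q ^ (\<Sum>x\<in>B. fst x) * z ^ card B"
      by (simp add: prod.distrib power_sum mult.commute)
    have "z powi pair_charge (A, B) = inverse z ^ card A * z ^ card B"
      using z by (simp add: pair_charge_def power_int_diff power_inverse divide_inverse mult.commute)
    then show ?thesis unfolding 1 2 by (simp add: pair_weight_def power_add mult_ac)
  qed
  ultimately show ?thesis by (simp add: case_prod_unfold)
qed

lemma charged_pairs_has_sum:
  fixes q z :: complex
  assumes q: "norm q < 1" and z: "z \<noteq> 0"
  shows "((\<lambda>s. infsum (\<lambda>p. q ^ pair_weight p) (charged_pairs k s) * z powi s) has_sum
           (qpoch_inf (- q / z) q ^ k * qpoch_inf (- z) q ^ k)) UNIV"
    and "\<And>s. (\<lambda>p. q ^ pair_weight p) summable_on charged_pairs k s"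
proof -
  let ?P = "colored_sets k \<times> colored_sets k"
  have s1: "(\<lambda>p. q ^ pair_weight p) summable_on ?P"
    using has_sum_imp_summable[OF colored_pairs_has_sum[OF q, of 1 k]] by simp
  then show s: "\<And>s. (\<lambda>p. q ^ pair_weight p) summable_on charged_pairs k s"
    by (rule summable_on_subset_banach) (auto simp: charged_pairs_def)
  have "((\<lambda>(s, p). q ^ pair_weight p * z powi s) has_sum (qpoch_inf (- q / z) q ^ k * qpoch_inf (- z) q ^ k))
      (Sigma UNIV (charged_pairs k))"
    using colored_pairs_has_sum[OF q z, of k]
    by (subst has_sum_reindex_bij_witness[of _ "\<lambda>p. (pair_charge p, p)" snd ?P "\<lambda>p. q ^ pair_weight p * z powi pair_charge p"])
       (auto simp: charged_pairs_def)
  then show "((\<lambda>s. infsum (\<lambda>p. q ^ pair_weight p) (charged_pairs k s) * z powi s) has_sum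
           (qpoch_inf (- q / z) q ^ k * qpoch_inf (- z) q ^ k)) UNIV"
    by (rule has_sum_SigmaD) (use s in \<open>auto intro!: has_sum_cmult_left\<close>)
qed

text \<open>A row is strictly decreasing, so its set of entries determines it; a symbol is therefore
  a pair of sets of charge 0. Grouping these pairs by weight recovers the generating
  function.\<close>

lemma CPhi_eq_charged_pairs:
  fixes q :: complex
  assumes q: "norm q < 1"
  shows "CPhi k q = infsum (\<lambda>p. q ^ pair_weight p) (charged_pairs k 0)"
proof -
  let ?h = "\<lambda>s::colored_nat list \<times> colored_nat list. (set (fst s), set (snd s))"
  let ?S = "{s. frobenius_symbol k s}"
  let ?c = "infsum (\<lambda>p. q ^ pair_weight p) (charged_pairs k 0)"
  have row_card: "card (set xs) = length xs" if "frobenius_row k xs" for xs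
    using frobenius_row_distinct[OF that] by (rule distinct_card)
  have row_sub: "set xs \<in> colored_sets k" if "frobenius_row k xs" for xs
    using that by (auto simp: frobenius_row_def colored_sets_def)
  have img: "?h ` ?S = charged_pairs k 0"
  proof (intro equalityI subsetI)
    fix p assume "p \<in> ?h ` ?S"
    then show "p \<in> charged_pairs k 0"
      by (auto simp: frobenius_symbol_def charged_pairs_def pair_charge_def row_card row_sub)
  next
    fix p assume "p \<in> charged_pairs k 0"
    then have p: "finite (fst p)" "fst p \<subseteq> UNIV \<times> {1..k}" "finite (snd p)" "snd p \<subseteq> UNIV \<times> {1..k}"
      "card (snd p) = card (fst p)"
      by (auto simp: charged_pairs_def colored_sets_def pair_charge_def)
    obtain xs ys where xs: "frobenius_row k xs" "set xs = fst p" and ys: "frobenius_row k ys" "set ys = snd p"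
      using ex_frobenius_row[OF p(1,2)] ex_frobenius_row[OF p(3,4)] by metis
    have "frobenius_symbol k (xs, ys)"
      using xs ys p(5) row_card[OF xs(1)] row_card[OF ys(1)] by (simp add: frobenius_symbol_def)
    moreover have "p = ?h (xs, ys)" using xs ys by (simp add: prod_eq_iff)
    ultimately show "p \<in> ?h ` ?S" by blast
  qed
  have wt: "pair_weight (?h s) = frobenius_size s" if "frobenius_symbol k s" for s
  proof -
    have d: "distinct (fst s)" "distinct (snd s)"
      using that frobenius_row_distinct by (auto simp: frobenius_symbol_def)
    have "pair_weight (?h s) = (\<Sum>x\<in>set (fst s). 1 + fst x) + (\<Sum>x\<in>set (snd s). fst x)"
      by (simp add: pair_weight_def)
    also have "\<dots> = card (set (fst s)) + (\<Sum>x\<in>set (fst s). fst x) + (\<Sum>x\<in>set (snd s). fst x)"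
      by (simp only: sum.distrib card_eq_sum)
    finally show ?thesis
      using d by (simp add: frobenius_size_def distinct_card sum_list_distinct_conv_sum_set)
  qed
  have "((\<lambda>p. q ^ pair_weight p) has_sum ?c) (?h ` ?S)"
    unfolding img using charged_pairs_has_sum(2)[OF q, of 1 k 0] by simp
  then have "((\<lambda>s. q ^ frobenius_size s) has_sum ?c) ?S"
    by (subst (asm) has_sum_reindex[OF inj_on_frobenius_sets])
       (erule has_sum_cong[THEN iffD1, rotated], simp add: wt o_def)
  then have "((\<lambda>(n, s). q ^ n) has_sum ?c) (Sigma UNIV (frobenius_partitions k))"
    by (subst has_sum_reindex_bij_witness[of _ "\<lambda>s. (frobenius_size s, s)" snd ?S "\<lambda>s. q ^ frobenius_size s"])
       (auto simp: frobenius_partitions_def)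
  then have "((\<lambda>n. of_nat (cphi k n) * q ^ n) has_sum ?c) UNIV"
  proof (rule has_sum_SigmaD)
    show "((\<lambda>y. case (n, y) of (n, s) \<Rightarrow> q ^ n) has_sum of_nat (cphi k n) * q ^ n) (frobenius_partitions k n)" for n
      using finite_frobenius_partitions[of k n] by (simp add: has_sum_finite_iff cphi_def)
  qed
  then show ?thesis unfolding CPhi_def using has_sum_imp_sums sums_unique by metis
qed

text \<open>Since 9 = 3 * 3, the ninth power of the triple product is reached by cubing twice. Both
  families are then the Laurent coefficients of the same function on the unit circle, and only index
  0 is needed.\<close>

lemma CPhi_9_eq:
  fixes q :: complex
  assumes q: "norm q < 1" and q0: "q \<noteq> 0"
  shows "CPhi 9 q = conv3 (A2th q) (A2th q) (A2th q) 0 / euler q ^ 9"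
proof -
  let ?c = "\<lambda>s. infsum (\<lambda>p. q ^ pair_weight p) (charged_pairs 9 s)"
  let ?d = "\<lambda>s. conv3 (A2th q) (A2th q) (A2th q) s / euler q ^ 9"
  have Ts: "A2th q summable_on UNIV"
    unfolding A2th_def by (intro conv3_summable theta_summable q)
  have "?c 0 = ?d 0"
  proof (rule laurent_unique[where S = "\<lambda>z. qpoch_inf (- q / z) q ^ 9 * qpoch_inf (- z) q ^ 9"])
    show "?c summable_on UNIV" using has_sum_imp_summable[OF charged_pairs_has_sum(1)[OF q, of 1 9]] by simp
    have "(\<lambda>s. conv3 (A2th q) (A2th q) (A2th q) s * inverse (euler q ^ 9)) summable_on UNIV"
      by (intro summable_on_cmult_left conv3_summable Ts)
    then show "?d summable_on UNIV" by (simp add: divide_inverse)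
    fix z :: complex assume z: "norm z = 1"
    then have z0: "z \<noteq> 0" by auto
    show "((\<lambda>n. ?c n * z powi n) has_sum (qpoch_inf (- q / z) q ^ 9 * qpoch_inf (- z) q ^ 9)) UNIV"
      by (rule charged_pairs_has_sum(1)[OF q z0])
    let ?J = "qpoch_inf (- z) q * qpoch_inf (- q / z) q * euler q"
    have T: "((\<lambda>s. A2th q s * z powi s) has_sum (?J * ?J * ?J)) UNIV"
      unfolding A2th_def by (intro conv3_has_sum(1) triple_product q z0 z)
    have "((\<lambda>s. conv3 (A2th q) (A2th q) (A2th q) s * z powi s / euler q ^ 9) has_sum
        ((?J * ?J * ?J) * (?J * ?J * ?J) * (?J * ?J * ?J) / euler q ^ 9)) UNIV"
      by (intro has_sum_divide_const conv3_has_sum(1) T z)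
    moreover have "(a * b * e * (a * b * e) * (a * b * e)) * (a * b * e * (a * b * e) * (a * b * e)) * (a * b * e * (a * b * e) * (a * b * e)) / e ^ 9
        = b ^ 9 * a ^ 9" if "e \<noteq> 0" for a b e :: complex
    proof -
      have "(a * b * e * (a * b * e) * (a * b * e)) * (a * b * e * (a * b * e) * (a * b * e)) * (a * b * e * (a * b * e) * (a * b * e))
         = (a * b * e) ^ 9" by (simp add: eval_nat_numeral mult_ac)
      then show ?thesis using that by (simp add: power_mult_distrib)
    qed
    ultimately show "((\<lambda>n. ?d n * z powi n) has_sum (qpoch_inf (- q / z) q ^ 9 * qpoch_inf (- z) q ^ 9)) UNIV"
      using euler_neq_0[OF q] by simp
  qed
  then show ?thesis using CPhi_eq_charged_pairs[OF q, of 9] by simp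
qed

section \<open>The cubic modular equation\<close>

lemma tri_mod_3: "tri (3 * m) mod 3 = 0" "tri (3 * m + 2) mod 3 = 0" "tri (3 * m + 1) = 9 * tri m + 1"
proof -
  have 2: "2 * tri n = n * (n + 1)" for n by (induction n) auto
  have "2 * tri (3 * m) = 3 * (m * (3 * m + 1))" "2 * tri (3 * m + 2) = 3 * ((3 * m + 2) * (m + 1))"
    unfolding 2 by (simp_all add: algebra_simps)
  then show "tri (3 * m) mod 3 = 0" "tri (3 * m + 2) mod 3 = 0" by presburger+
  have "2 * tri (3 * m + 1) = 9 * (2 * tri m) + 2" unfolding 2 by (simp add: algebra_simps)
  then show "tri (3 * m + 1) = 9 * tri m + 1" by simp
qed

lemma omega_power_mod: "omega ^ n = omega ^ (n mod 3)"
proof -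
  have "omega ^ n = omega ^ (3 * (n div 3) + n mod 3)" by simp
  also have "\<dots> = omega ^ (n mod 3)" unfolding power_add power_mult omega_cube by simp
  finally show ?thesis .
qed

lemma omega_power_simps: "omega ^ 9 = 1" "omega ^ 4 = omega" "(omega\<^sup>2) ^ 3 = 1" "(omega\<^sup>2) ^ 9 = 1" "(omega\<^sup>2)\<^sup>2 = omega"
  using omega_power_mod[of 9] omega_power_mod[of 4] omega_power_mod[of 6] omega_power_mod[of 18]
  by (simp_all flip: power_mult)

text \<open>A triangular number is 1 modulo 3 only for indices 3m + 1, where it equals 9 tri m + 1.
  Only these terms of Jacobi's series feel the substitution q -> w q, and they add up to -3 q
  E(q^9)^3.\<close>

lemma euler_cube_dissection:
  assumes q: "norm q < 1" and w: "w = omega \<or> w = omega\<^sup>2"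
  shows "euler (w * q) ^ 3 + 3 * (w * q) * euler (q ^ 9) ^ 3 = euler q ^ 3 + 3 * q * euler (q ^ 9) ^ 3"
proof -
  have q9: "norm (q ^ 9) < 1" by (rule norm_power_less_1[OF q]) simp
  have nw: "norm w = 1" using w by (auto simp: norm_power)
  have wq: "norm (w * q) < 1" using q nw by (simp add: norm_mult)
  have w3: "w ^ 3 = 1" using w omega_cube omega_power_simps by auto
  have wmod: "w ^ n = w ^ (n mod 3)" for n
  proof -
    have "w ^ n = w ^ (3 * (n div 3) + n mod 3)" by simp
    also have "\<dots> = w ^ (n mod 3)" unfolding power_add power_mult w3 by simp
    finally show ?thesis .
  qed
  have s: "summable (\<lambda>k. jcoeff k * x ^ tri k)" if "norm x < 1" for x
    by (rule summable_norm_cancel[OF summable_tri_mult[OF that, of _ 1 3]]) (use norm_jcoeff in simp)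
  let ?f = "\<lambda>k. jcoeff k * (w * q) ^ tri k - jcoeff k * q ^ tri k"
  have "euler (w * q) ^ 3 - euler q ^ 3 = suminf ?f"
    unfolding jcoeff_sums(1)[OF q, symmetric] jcoeff_sums(1)[OF wq, symmetric] by (rule suminf_diff[OF s[OF wq] s[OF q]])
  also have "\<dots> = (\<Sum>m. ?f (3 * m + 1))"
  proof (rule suminf_mono_reindex[symmetric])
    show "strict_mono (\<lambda>m::nat. 3 * m + 1)" by (auto simp: strict_mono_def)
    fix n :: nat assume n: "n \<notin> range (\<lambda>m. 3 * m + 1)"
    have "n mod 3 \<noteq> 1"
    proof
      assume "n mod 3 = 1"
      then have "n = 3 * (n div 3) + 1" by presburger
      then show False using n by blast
    qed
    then have "n = 3 * (n div 3) \<or> n = 3 * (n div 3) + 2" by presburger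
    then have "tri n mod 3 = 0" using tri_mod_3(1,2) by metis
    then have "w ^ tri n = 1" using wmod[of "tri n"] by simp
    then show "?f n = 0" by (simp add: power_mult_distrib)
  qed
  also have "\<dots> = (\<Sum>m. - 3 * q * (w - 1) * (jcoeff m * (q ^ 9) ^ tri m))"
  proof (rule suminf_cong)
    fix m
    have "(9 * tri m + 1) mod 3 = 1" by presburger
    then have "w ^ tri (3 * m + 1) = w" unfolding tri_mod_3 using wmod[of "9 * tri m + 1"]
      by (simp only: power_one_right)
    moreover have "jcoeff (3 * m + 1) = - 3 * jcoeff m"
    proof -
      have "(-1 :: complex) ^ (3 * m + 1) = - ((-1) ^ m)"
        by (simp add: power_mult)
      then show ?thesis unfolding jcoeff_def by (simp add: algebra_simps)
    qed
    moreover have "q ^ tri (3 * m + 1) = q * (q ^ 9) ^ tri m"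
      unfolding tri_mod_3 power_add power_mult by simp
    ultimately show "?f (3 * m + 1) = - 3 * q * (w - 1) * (jcoeff m * (q ^ 9) ^ tri m)"
      unfolding power_mult_distrib by (simp only:) (simp add: algebra_simps)
  qed
  also have "\<dots> = - 3 * q * (w - 1) * euler (q ^ 9) ^ 3"
    unfolding jcoeff_sums(1)[OF q9, symmetric] by (rule suminf_mult[OF s[OF q9]])
  finally show ?thesis by (simp add: algebra_simps)
qed

text \<open>For m prime to 3 the three factors at q, omega q and omega^2 q multiply to 1 - q^(3m);
  for m divisible by 3 they coincide and give a cube.\<close>

lemma euler_omega_prod:
  assumes q: "norm q < 1"
  shows "euler q * euler (omega * q) * euler (omega\<^sup>2 * q) * euler (q ^ 9) = euler (q ^ 3) ^ 4"
proof (rule LIMSEQ_unique)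
  have q3: "norm (q ^ 3) < 1" and q9: "norm (q ^ 9) < 1" by (rule norm_power_less_1[OF q], simp)+
  have o1: "norm (omega * q) < 1" and o2: "norm (omega\<^sup>2 * q) < 1" using q by (simp_all add: norm_mult norm_power)
  have t3: "filterlim (\<lambda>n::nat. 3 * n) at_top at_top" by real_asymp
  let ?L = "\<lambda>n. qfact q (3 * n) * qfact (omega * q) (3 * n) * qfact (omega\<^sup>2 * q) (3 * n) * qfact (q ^ 9) n"
  show "?L \<longlonglongrightarrow> euler q * euler (omega * q) * euler (omega\<^sup>2 * q) * euler (q ^ 9)"
    by (intro tendsto_mult filterlim_compose[OF qfact_tendsto t3] qfact_tendsto q o1 o2 q9)
  have "(\<lambda>n. qfact (q ^ 3) (3 * n) * qfact (q ^ 3) n ^ 3) \<longlonglongrightarrow> euler (q ^ 3) * euler (q ^ 3) ^ 3"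
    by (intro tendsto_mult tendsto_power filterlim_compose[OF qfact_tendsto t3] qfact_tendsto q3)
  moreover have "?L n = qfact (q ^ 3) (3 * n) * qfact (q ^ 3) n ^ 3" for n
  proof (induction n)
    case (Suc n)
    have S3: "3 * Suc n = Suc (Suc (Suc (3 * n)))" by simp
    have fac: "(1 - x ^ m) * (1 - (omega * x) ^ m) * (1 - (omega\<^sup>2 * x) ^ m) = 1 - (x ^ 3) ^ m" if "m mod 3 = 1 \<or> m mod 3 = 2" for x m
    proof -
      have c: "(x ^ 3) ^ m = (x ^ m) ^ 3" by (simp only: power_mult[symmetric] mult.commute)
      have d: "(omega\<^sup>2) ^ m = (omega ^ m)\<^sup>2" by (simp only: power_mult[symmetric] mult.commute)
      have "omega ^ m = omega \<or> omega ^ m = omega\<^sup>2"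
        using that omega_power_mod[of m] by (auto simp only: power_one_right)
      then have "omega ^ m = omega \<and> (omega\<^sup>2) ^ m = omega\<^sup>2 \<or> omega ^ m = omega\<^sup>2 \<and> (omega\<^sup>2) ^ m = omega"
        unfolding d using omega_power_simps(5) by auto
      then show ?thesis unfolding c omega_factor[symmetric] power_mult_distrib by (auto simp: mult_ac)
    qed
    define t where "t m = (1 - q ^ m) * (1 - (omega * q) ^ m) * (1 - (omega\<^sup>2 * q) ^ m)" for m
    have f1: "t (Suc (3 * n)) = 1 - (q ^ 3) ^ Suc (3 * n)"
      unfolding t_def by (rule fac) presburger
    have f2: "t (Suc (Suc (3 * n))) = 1 - (q ^ 3) ^ Suc (Suc (3 * n))"
      unfolding t_def by (rule fac) presburger
    have f3: "t (3 * Suc n) * (1 - (q ^ 9) ^ Suc n) = (1 - (q ^ 3) ^ (3 * Suc n)) * (1 - (q ^ 3) ^ Suc n) ^ 3"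
    proof -
      have "(omega * q) ^ 3 = q ^ 3" "(omega\<^sup>2 * q) ^ 3 = q ^ 3"
        by (simp_all only: power_mult_distrib omega_cube omega_power_simps(3) mult_1_left)
      moreover have "(q ^ 3) ^ 3 = q ^ 9" by (simp only: power_mult[symmetric]) simp
      ultimately have "t (3 * Suc n) = (1 - (q ^ 3) ^ Suc n) ^ 3" "(q ^ 3) ^ (3 * Suc n) = (q ^ 9) ^ Suc n"
        by (simp_all only: t_def power_mult power3_eq_cube[of "1 - _"])
      then show ?thesis by (simp only: mult.commute)
    qed
    have "?L (Suc n) = ?L n * t (Suc (3 * n)) * t (Suc (Suc (3 * n))) * (t (3 * Suc n) * (1 - (q ^ 9) ^ Suc n))"
      unfolding t_def S3 qfact_Suc by (simp only: mult_ac)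
    also have "\<dots> = qfact (q ^ 3) (3 * Suc n) * qfact (q ^ 3) (Suc n) ^ 3"
      unfolding f1 f2 f3 Suc.IH unfolding S3 qfact_Suc power_mult_distrib by (simp only: mult_ac)
    finally show ?case .
  qed simp
  ultimately show "?L \<longlonglongrightarrow> euler (q ^ 3) ^ 4" by (simp add: eval_nat_numeral)
qed

text \<open>The product formula is cubed and the dissection inserted: with P = u + 3v the three
  cubes are P - 3v, P - 3 omega v and P - 3 omega^2 v, whose product is P^3 - (3v)^3.\<close>

lemma euler_modular_eq:
  assumes q: "norm q < 1"
  shows "euler (q ^ 3) ^ 12 = euler q ^ 3 * euler (q ^ 9) ^ 3 *
     ((euler q ^ 3)\<^sup>2 + 9 * euler q ^ 3 * (q * euler (q ^ 9) ^ 3) + 27 * (q * euler (q ^ 9) ^ 3)\<^sup>2)"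
proof -
  define u where "u = euler q ^ 3"
  define v where "v = q * euler (q ^ 9) ^ 3"
  define P where "P = u + 3 * v"
  have o1: "euler (omega * q) ^ 3 = P - 3 * (omega * v)"
    using euler_cube_dissection[OF q, of omega] by (simp add: P_def u_def v_def algebra_simps)
  have o2: "euler (omega\<^sup>2 * q) ^ 3 = P - 3 * (omega\<^sup>2 * v)"
    using euler_cube_dissection[OF q, of "omega\<^sup>2"] by (simp add: P_def u_def v_def algebra_simps)
  have hom: "(p - y) * (p - omega * y) * (p - omega\<^sup>2 * y) = p ^ 3 - y ^ 3" for p y
  proof -
    have "(p - y) * (p - omega * y) * (p - omega\<^sup>2 * y)
      = p ^ 3 - (1 + omega + omega\<^sup>2) * (p\<^sup>2 * y) + omega * (1 + omega + omega\<^sup>2) * (p * y\<^sup>2) - omega ^ 3 * y ^ 3"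
      by (simp add: algebra_simps power2_eq_square power3_eq_cube)
    then show ?thesis unfolding omega_sum omega_cube by simp
  qed
  have "euler (q ^ 3) ^ 12 = (euler (q ^ 3) ^ 4) ^ 3" by (simp flip: power_mult)
  also have "\<dots> = (euler q ^ 3 * euler (omega * q) ^ 3 * euler (omega\<^sup>2 * q) ^ 3) * euler (q ^ 9) ^ 3"
    unfolding euler_omega_prod[OF q, symmetric] power_mult_distrib ..
  also have "euler q ^ 3 * euler (omega * q) ^ 3 * euler (omega\<^sup>2 * q) ^ 3 = P ^ 3 - (3 * v) ^ 3"
    unfolding o1 o2 hom[symmetric] by (simp add: P_def u_def mult_ac)
  also have "P ^ 3 - (3 * v) ^ 3 = u * (u\<^sup>2 + 9 * u * v + 27 * v\<^sup>2)"
    unfolding P_def by (simp add: algebra_simps power2_eq_square power3_eq_cube)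
  finally show ?thesis unfolding u_def v_def by (simp only: mult_ac)
qed

text \<open>In the notation of the Borweins, these are \<open>b(q)\<close>, \<open>c(q\<^sup>3) / 3\<close> and \<open>a(q)\<close>.\<close>

definition cubic_b :: "complex \<Rightarrow> complex" where "cubic_b q = euler q ^ 3 / euler (q ^ 3)"
definition cubic_k :: "complex \<Rightarrow> complex" where "cubic_k q = q * euler (q ^ 9) ^ 3 / euler (q ^ 3)"
definition cubic_a :: "complex \<Rightarrow> complex" where "cubic_a q = cubic_b q + 9 * cubic_k q"
text \<open>The cofactor in a^3 - b^3 = 27 k w. It turns out to be the weight 2 Eisenstein series
  \<open>eis2_9\<close>.\<close>

definition cubic_w :: "complex \<Rightarrow> complex" where "cubic_w q = (cubic_b q)\<^sup>2 + 9 * cubic_b q * cubic_k q + 27 * (cubic_k q)\<^sup>2"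

lemma power_3_3: "(x ^ 3) ^ 3 = (x ^ 9 :: complex)"
  by (simp only: power_mult[symmetric]) simp

lemma euler_0: "euler 0 = 1"
  by (simp add: qpoch_inf_def)

lemma lat_eqs:
  assumes q: "norm q < 1" and q0: "q \<noteq> 0"
  shows "q * A2K (q ^ 3) = cubic_k q" "A2th q 0 = cubic_a q" "A2th (q ^ 3) 0 = cubic_b q + 3 * cubic_k q"
proof -
  have q3: "norm (q ^ 3) < 1" by (rule norm_power_less_1[OF q]) simp
  have "q ^ 3 \<noteq> 0" using q0 by simp
  from A2K_eq[OF q3 this] show k: "q * A2K (q ^ 3) = cubic_k q"
    unfolding power_3_3 cubic_k_def by simp
  have b: "borwein_b q = cubic_b q" unfolding cubic_b_def by (rule borwein_b_eq[OF q q0])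
  show t: "A2th (q ^ 3) 0 = cubic_b q + 3 * cubic_k q"
    using borwein_b_lat[OF q q0] unfolding b mult.assoc k by simp
  show "A2th q 0 = cubic_a q"
    using A2th_0_eq[OF q q0] unfolding t mult.assoc k cubic_a_def by simp
qed

lemma cubic_a_cube:
  assumes q: "norm q < 1"
  shows "cubic_a (q ^ 3) = cubic_b q + 3 * cubic_k q"
proof (cases "q = 0")
  case True
  then show ?thesis by (simp add: cubic_a_def cubic_b_def cubic_k_def euler_0)
next
  case False
  have q3: "norm (q ^ 3) < 1" by (rule norm_power_less_1[OF q]) simp
  show ?thesis using lat_eqs(2)[OF q3] lat_eqs(3)[OF q False] False by simp
qed

text \<open>The modular equation with its denominators cleared. It makes k w equal to c(q)^3/27 and
  b w equal to b(q^3)^3, both products of Euler functions.\<close>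

lemma cubic_w_eq:
  assumes q: "norm q < 1"
  shows "cubic_w q * (euler (q ^ 3))\<^sup>2 = (euler q ^ 3)\<^sup>2 + 9 * euler q ^ 3 * (q * euler (q ^ 9) ^ 3) + 27 * (q * euler (q ^ 9) ^ 3)\<^sup>2"
    and "euler (q ^ 3) ^ 10 = euler q ^ 3 * euler (q ^ 9) ^ 3 * cubic_w q" and "cubic_w q \<noteq> 0"
    and "q * euler (q ^ 3) ^ 9 / euler q ^ 3 = cubic_k q * cubic_w q" and "cubic_b (q ^ 3) ^ 3 = cubic_b q * cubic_w q"
proof -
  have q3: "norm (q ^ 3) < 1" and q9: "norm (q ^ 9) < 1" by (rule norm_power_less_1[OF q], simp)+
  have nz: "euler q \<noteq> 0" "euler (q ^ 3) \<noteq> 0" "euler (q ^ 9) \<noteq> 0"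
    using euler_neq_0[OF q] euler_neq_0[OF q3] euler_neq_0[OF q9] .
  show 1: "cubic_w q * (euler (q ^ 3))\<^sup>2 = (euler q ^ 3)\<^sup>2 + 9 * euler q ^ 3 * (q * euler (q ^ 9) ^ 3) + 27 * (q * euler (q ^ 9) ^ 3)\<^sup>2"
  proof -
    have "((u / e)\<^sup>2 + 9 * (u / e) * (v / e) + 27 * (v / e)\<^sup>2) * e\<^sup>2 = u\<^sup>2 + 9 * u * v + 27 * v\<^sup>2"
      if "e \<noteq> 0" for u v e :: complex
      using that by (simp add: field_simps power2_eq_square)
    from this[OF nz(2)] show ?thesis unfolding cubic_w_def cubic_b_def cubic_k_def .
  qed
  have "euler (q ^ 3) ^ 10 * (euler (q ^ 3))\<^sup>2 = euler (q ^ 3) ^ 12" by (simp flip: power_add)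
  also have "\<dots> = (euler q ^ 3 * euler (q ^ 9) ^ 3 * cubic_w q) * (euler (q ^ 3))\<^sup>2"
    unfolding euler_modular_eq[OF q] 1[symmetric] by (simp only: mult.assoc)
  finally show 2: "euler (q ^ 3) ^ 10 = euler q ^ 3 * euler (q ^ 9) ^ 3 * cubic_w q"
    unfolding mult_right_cancel[OF power_not_zero[OF nz(2)]] .
  show "cubic_w q \<noteq> 0" using 2 nz by auto
  have t: "e ^ 10 = x * y * w \<Longrightarrow> e \<noteq> 0 \<Longrightarrow> x \<noteq> 0 \<Longrightarrow> r * e ^ 9 / x = (r * y / e) * w" for e x y w r :: complex
  proof -
    assume h: "e ^ 10 = x * y * w" "e \<noteq> 0" "x \<noteq> 0"
    have "(r * e ^ 9 / x) * (x * e) = r * e ^ 10" using h by (simp add: eval_nat_numeral)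
    also have "\<dots> = ((r * y / e) * w) * (x * e)" unfolding h(1) using h by simp
    finally have *: "(r * e ^ 9 / x) * (x * e) = ((r * y / e) * w) * (x * e)" .
    have xe: "x * e \<noteq> 0" using h by simp
    from * show ?thesis unfolding mult_right_cancel[OF xe] .
  qed
  show "q * euler (q ^ 3) ^ 9 / euler q ^ 3 = cubic_k q * cubic_w q"
    unfolding cubic_k_def by (rule t[OF 2 nz(2)]) (use nz in simp)
  have t2: "e ^ 10 = x * y * w \<Longrightarrow> e \<noteq> 0 \<Longrightarrow> y \<noteq> 0 \<Longrightarrow> e ^ 9 / y = (x / e) * w" for e x y w :: complex
    using t[of e y x w 1] by (simp add: mult.commute)
  have "cubic_b (q ^ 3) ^ 3 = euler (q ^ 3) ^ 9 / euler (q ^ 9) ^ 3"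
    unfolding cubic_b_def power_3_3 power_divide ..
  also have "\<dots> = cubic_b q * cubic_w q"
    unfolding cubic_b_def by (rule t2[OF 2 nz(2)]) (use nz in simp)
  finally show "cubic_b (q ^ 3) ^ 3 = cubic_b q * cubic_w q" .
qed

text \<open>The operator q d/dq as a relation, so that differentiability and value travel together:
  derivatives are assembled by composing rules, and \<open>theta_at_cong\<close> leaves one
  algebraic identity to check.\<close>

definition theta_at :: "(complex \<Rightarrow> complex) \<Rightarrow> complex \<Rightarrow> complex \<Rightarrow> bool" where
  "theta_at f q d \<longleftrightarrow> (\<exists>D. (f has_field_derivative D) (at q) \<and> q * D = d)"

lemma theta_at_cong: "theta_at f q d \<Longrightarrow> d = d' \<Longrightarrow> theta_at f q d'"
  by simp

lemma theta_at_const: "theta_at (\<lambda>_. c) q 0"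
  unfolding theta_at_def by (rule exI[of _ 0]) simp

lemma theta_at_id: "theta_at (\<lambda>x. x) q q"
  unfolding theta_at_def by (rule exI[of _ 1]) simp

lemma theta_at_add: "theta_at f q a \<Longrightarrow> theta_at g q b \<Longrightarrow> theta_at (\<lambda>x. f x + g x) q (a + b)"
  unfolding theta_at_def by (metis DERIV_add distrib_left)

lemma theta_at_mult:
  assumes "theta_at f q a" "theta_at g q b"
  shows "theta_at (\<lambda>x. f x * g x) q (a * g q + f q * b)"
proof -
  obtain D E where "(f has_field_derivative D) (at q)" "q * D = a" "(g has_field_derivative E) (at q)" "q * E = b"
    using assms unfolding theta_at_def by blast
  then show ?thesis
    unfolding theta_at_def by (intro exI[of _ "D * g q + E * f q"] conjI DERIV_mult') (auto simp: algebra_simps intro!: derivative_eq_intros)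
qed

lemma theta_at_power:
  assumes "theta_at f q a"
  shows "theta_at (\<lambda>x. f x ^ n) q (of_nat n * f q ^ (n - 1) * a)"
proof -
  obtain D where "(f has_field_derivative D) (at q)" "q * D = a"
    using assms unfolding theta_at_def by blast
  then show ?thesis
    unfolding theta_at_def by (intro exI[of _ "of_nat n * (D * f q ^ (n - 1))"] conjI DERIV_power) (auto simp: algebra_simps intro!: derivative_eq_intros)
qed

lemma theta_at_compose_power:
  assumes "(f has_field_derivative D) (at (q ^ n))" "n > 0"
  shows "theta_at (\<lambda>x. f (x ^ n)) q (of_nat n * (q ^ n * D))"
  unfolding theta_at_def
proof (intro exI conjI)
  show "((\<lambda>x. f (x ^ n)) has_field_derivative D * (of_nat n * (1 * q ^ (n - 1)))) (at q)"
    by (rule DERIV_chain2[of f D "\<lambda>x. x ^ n" q, OF assms(1)]) (auto intro!: derivative_eq_intros)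
  show "q * (D * (of_nat n * (1 * q ^ (n - 1)))) = of_nat n * (q ^ n * D)"
    using assms(2) by (cases n) auto
qed

lemma theta_at_euler:
  assumes "norm q < 1" "n > 0"
  shows "theta_at (\<lambda>x. euler (x ^ n)) q (- of_nat n * euler (q ^ n) * lambert1 (q ^ n))"
proof -
  have qn: "norm (q ^ n) < 1" by (rule norm_power_less_1[OF assms])
  show ?thesis
    using theta_at_compose_power[OF euler_has_derivative[OF qn] assms(2)] unfolding euler_theta[OF qn] by (simp add: mult.assoc)
qed

lemma theta_at_lambert1:
  assumes "norm q < 1" "n > 0"
  shows "theta_at (\<lambda>x. lambert1 (x ^ n)) q (of_nat n * (q ^ n * deriv lambert1 (q ^ n)))"
  by (rule theta_at_compose_power[OF lambert1_has_derivative[OF norm_power_less_1[OF assms]] assms(2)])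

lemma theta_at_unique:
  assumes f: "theta_at f q a" and g: "theta_at g q b" and q: "norm q < 1"
    and eq: "\<And>x. norm x < 1 \<Longrightarrow> f x = g x"
  shows "a = b"
proof -
  obtain D E where D: "(f has_field_derivative D) (at q)" "q * D = a" and E: "(g has_field_derivative E) (at q)" "q * E = b"
    using f g unfolding theta_at_def by blast
  have "\<forall>\<^sub>F x in nhds q. f x = g x"
    using eventually_nhds_in_open[of "ball 0 1" q] q by (auto elim!: eventually_mono simp: eq)
  then have "(g has_field_derivative D) (at q)" using D(1) DERIV_cong_ev[OF refl _ refl] by blast
  then have "D = E" using E(1) by (rule DERIV_unique)
  then show ?thesis using D(2) E(2) by simp
qed

lemma theta_uv:
  assumes q: "norm q < 1"
  shows "theta_at (\<lambda>x. euler x ^ 3) q (- 3 * lambert1 q * euler q ^ 3)"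
    and "theta_at (\<lambda>x. x * euler (x ^ 9) ^ 3) q ((1 - 27 * lambert1 (q ^ 9)) * (q * euler (q ^ 9) ^ 3))"
  subgoal
    by (rule theta_at_cong[OF theta_at_power[OF theta_at_euler[OF q, of 1, simplified]]])
       (simp add: power2_eq_square power3_eq_cube)
  subgoal
    by (rule theta_at_cong[OF theta_at_mult[OF theta_at_id theta_at_power[OF theta_at_euler[OF q, of 9]]]])
       (simp_all add: power2_eq_square power3_eq_cube algebra_simps)
  done

text \<open>The logarithmic derivative of the modular equation.\<close>

lemma lambert1_relation:
  assumes q: "norm q < 1"
  defines "G \<equiv> 1 + 3 * lambert1 q - 27 * lambert1 (q ^ 9)"
  shows "(9 * lambert1 q - 36 * lambert1 (q ^ 3) + 27 * lambert1 (q ^ 9)) * cubic_w q = 9 * cubic_k q * (cubic_b q + 6 * cubic_k q) * G"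
proof -
  have q3: "norm (q ^ 3) < 1" and q9: "norm (q ^ 9) < 1" by (rule norm_power_less_1[OF q], simp)+
  define u where "u = euler q ^ 3"
  define v where "v = q * euler (q ^ 9) ^ 3"
  define e where "e = euler (q ^ 9) ^ 3"
  define V where "V = u\<^sup>2 + 9 * u * v + 27 * v\<^sup>2"
  define F1 F3 F9 where "F1 = lambert1 q" and "F3 = lambert1 (q ^ 3)" and "F9 = lambert1 (q ^ 9)"
  have nz: "euler q \<noteq> 0" "euler (q ^ 3) \<noteq> 0" "euler (q ^ 9) \<noteq> 0"
    using euler_neq_0[OF q] euler_neq_0[OF q3] euler_neq_0[OF q9] .
  have L: "theta_at (\<lambda>x. euler (x ^ 3) ^ 12) q (- 36 * F3 * euler (q ^ 3) ^ 12)"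
    by (rule theta_at_cong[OF theta_at_power[OF theta_at_euler[OF q, of 3]]])
       (simp_all add: F3_def eval_nat_numeral)
  note tu = theta_uv(1)[OF q] and tv = theta_uv(2)[OF q]
  have te: "theta_at (\<lambda>x. euler (x ^ 9) ^ 3) q (- 27 * F9 * e)"
    by (rule theta_at_cong[OF theta_at_power[OF theta_at_euler[OF q, of 9]]])
       (simp_all add: F9_def e_def power2_eq_square power3_eq_cube)
  have tV: "theta_at (\<lambda>x. (euler x ^ 3)\<^sup>2 + 9 * (euler x ^ 3 * (x * euler (x ^ 9) ^ 3)) + 27 * (x * euler (x ^ 9) ^ 3)\<^sup>2) q
      (- 6 * F1 * u\<^sup>2 + 9 * u * v * (1 - 3 * F1 - 27 * F9) + 54 * v\<^sup>2 * (1 - 27 * F9))"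
    by (rule theta_at_cong[OF theta_at_add[OF theta_at_add[OF theta_at_power[OF tu, of 2]
          theta_at_mult[OF theta_at_const theta_at_mult[OF tu tv]]]
          theta_at_mult[OF theta_at_const theta_at_power[OF tv, of 2]]]])
       (simp add: u_def[symmetric] v_def[symmetric] F1_def F9_def, simp add: algebra_simps power2_eq_square)
  have R: "theta_at (\<lambda>x. euler x ^ 3 * euler (x ^ 9) ^ 3 *
      ((euler x ^ 3)\<^sup>2 + 9 * (euler x ^ 3 * (x * euler (x ^ 9) ^ 3)) + 27 * (x * euler (x ^ 9) ^ 3)\<^sup>2)) q
      (((- 3 * F1 * u) * e + u * (- 27 * F9 * e)) * V
       + u * e * (- 6 * F1 * u\<^sup>2 + 9 * u * v * (1 - 3 * F1 - 27 * F9) + 54 * v\<^sup>2 * (1 - 27 * F9)))"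
    by (rule theta_at_cong[OF theta_at_mult[OF theta_at_mult[OF tu te] tV]])
       (simp add: u_def v_def e_def V_def F1_def mult.assoc)
  have "- 36 * F3 * euler (q ^ 3) ^ 12 = ((- 3 * F1 * u) * e + u * (- 27 * F9 * e)) * V
       + u * e * (- 6 * F1 * u\<^sup>2 + 9 * u * v * (1 - 3 * F1 - 27 * F9) + 54 * v\<^sup>2 * (1 - 27 * F9))"
    by (rule theta_at_unique[OF L R q]) (simp add: euler_modular_eq mult.assoc)
  also have "euler (q ^ 3) ^ 12 = (u * e) * V"
    unfolding euler_modular_eq[OF q] u_def v_def e_def V_def ..
  \<comment> \<open>\<open>G\<close> is the logarithmic derivative of v/u. As V is homogeneous of
    degree 2 in u and v, its logarithmic derivative is twice that of u plus v (9u + 54v)/V times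
    \<open>G\<close>.\<close>
  finally have "(u * e) * ((9 * F1 - 36 * F3 + 27 * F9) * V) = (u * e) * (9 * v * (u + 6 * v) * G)"
    unfolding V_def G_def F1_def[symmetric] F9_def[symmetric] by (simp add: algebra_simps power2_eq_square)
  moreover have "u * e \<noteq> 0" using nz by (simp add: u_def e_def)
  ultimately have main: "(9 * F1 - 36 * F3 + 27 * F9) * V = 9 * v * (u + 6 * v) * G"
    using mult_left_cancel by blast
  have V: "V = cubic_w q * (euler (q ^ 3))\<^sup>2" unfolding cubic_w_eq(1)[OF q] V_def u_def v_def ..
  have u: "u = cubic_b q * euler (q ^ 3)" and v: "v = cubic_k q * euler (q ^ 3)"
    unfolding u_def v_def cubic_b_def cubic_k_def using nz by simp_all
  have "((9 * F1 - 36 * F3 + 27 * F9) * cubic_w q) * (euler (q ^ 3))\<^sup>2 = (9 * cubic_k q * (cubic_b q + 6 * cubic_k q) * G) * (euler (q ^ 3))\<^sup>2"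
    using main unfolding V u v by (simp add: algebra_simps power2_eq_square)
  then show ?thesis
    unfolding mult_right_cancel[OF power_not_zero[OF nz(2)]] F1_def F3_def F9_def .
qed

section \<open>Eisenstein series in terms of the cubic theta functions\<close>

lemma holomorphic_compose_power:
  assumes "f holomorphic_on ball 0 1" "n > 0"
  shows "(\<lambda>q. f (q ^ n)) holomorphic_on ball 0 (1::real)"
proof -
  have "f \<circ> (\<lambda>q. q ^ n) holomorphic_on ball 0 1"
    by (rule holomorphic_on_compose_gen[OF _ assms(1)])
       (use assms(2) norm_power_less_1 in \<open>auto intro!: holomorphic_intros\<close>)
  then show ?thesis by (simp add: o_def)
qed

lemma cubic_b_holomorphic: "cubic_b holomorphic_on ball 0 1" and cubic_k_holomorphic: "cubic_k holomorphic_on ball 0 1"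
proof -
  have h: "euler holomorphic_on ball 0 1" "(\<lambda>q. euler (q ^ 3)) holomorphic_on ball 0 1" "(\<lambda>q. euler (q ^ 9)) holomorphic_on ball 0 1"
    by (auto intro!: holomorphic_compose_power euler_holomorphic)
  have nz: "euler (q ^ 3) \<noteq> 0" if "q \<in> ball 0 1" for q
    using euler_neq_0[OF norm_power_less_1[of q 3]] that by simp
  show "cubic_b holomorphic_on ball 0 1" "cubic_k holomorphic_on ball 0 1"
    unfolding cubic_b_def[abs_def] cubic_k_def[abs_def]
    by (intro holomorphic_on_divide holomorphic_on_mult holomorphic_on_power holomorphic_on_ident h nz; assumption)+
qed

lemma cubic_a_holomorphic: "cubic_a holomorphic_on ball 0 1" and cubic_w_holomorphic: "cubic_w holomorphic_on ball 0 1"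
  unfolding cubic_a_def[abs_def] cubic_w_def[abs_def] by (intro holomorphic_intros cubic_b_holomorphic cubic_k_holomorphic)+

lemma values_at_0: "lambert1 0 = 0" "lambert3 0 = 0" "cubic_b 0 = 1" "cubic_k 0 = 0" "cubic_a 0 = 1"
  by (simp_all add: lambert1_def lambert3_def cubic_b_def cubic_k_def cubic_a_def euler_0)

text \<open>With P = 1 - 24 lambert1 this is (3 P(q^3) - P(q))/2, and \<open>eis2_9\<close> is (9
  P(q^9) - P(q))/8. The latter is also the logarithmic derivative of v/u in the modular
  equation.\<close>

definition eis2_3 :: "complex \<Rightarrow> complex" where "eis2_3 q = 1 + 12 * lambert1 q - 36 * lambert1 (q ^ 3)"
definition eis2_9 :: "complex \<Rightarrow> complex" where "eis2_9 q = 1 + 3 * lambert1 q - 27 * lambert1 (q ^ 9)"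

lemma eis2_3_holomorphic: "eis2_3 holomorphic_on ball 0 1" and eis2_9_holomorphic: "eis2_9 holomorphic_on ball 0 1"
  unfolding eis2_3_def[abs_def] eis2_9_def[abs_def]
  by (auto intro!: holomorphic_intros lambert1_holomorphic holomorphic_compose_power)

text \<open>With d the left-hand combination in \<open>lambert1_relation\<close>, eis2_3(q) is
  \<open>eis2_9\<close> plus d and 3 eis2_3(q^3) is 3 \<open>eis2_9\<close> minus d. The quadratic
  forms then become perfect squares: w + 9k(b + 6k) = (b + 9k)^2 and 3w - 9k(b + 6k) = 3(b +
  3k)^2.\<close>

lemma eis2_3_cubic_w:
  assumes q: "norm q < 1"
  shows "eis2_3 q * cubic_w q = eis2_9 q * (cubic_a q)\<^sup>2" and "eis2_3 (q ^ 3) * cubic_w q = eis2_9 q * (cubic_a (q ^ 3))\<^sup>2"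
proof -
  define d where "d = 9 * lambert1 q - 36 * lambert1 (q ^ 3) + 27 * lambert1 (q ^ 9)"
  have r: "d * cubic_w q = 9 * cubic_k q * (cubic_b q + 6 * cubic_k q) * eis2_9 q"
    using lambert1_relation[OF q] unfolding d_def eis2_9_def .
  have "eis2_3 q = eis2_9 q + d" by (simp add: eis2_3_def eis2_9_def d_def)
  then have "eis2_3 q * cubic_w q = eis2_9 q * cubic_w q + d * cubic_w q" by (simp add: algebra_simps)
  also have "\<dots> = eis2_9 q * (cubic_a q)\<^sup>2"
    unfolding r unfolding cubic_w_def cubic_a_def by (simp add: algebra_simps power2_eq_square)
  finally show "eis2_3 q * cubic_w q = eis2_9 q * (cubic_a q)\<^sup>2" .
  have "3 * eis2_3 (q ^ 3) = 3 * eis2_9 q - d" by (simp add: eis2_3_def eis2_9_def d_def power_3_3)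
  then have "3 * (eis2_3 (q ^ 3) * cubic_w q) = 3 * eis2_9 q * cubic_w q - d * cubic_w q"
    by (simp only: mult.assoc[symmetric] left_diff_distrib)
  also have "\<dots> = 3 * (eis2_9 q * (cubic_a (q ^ 3))\<^sup>2)"
    unfolding r unfolding cubic_a_cube[OF q] cubic_w_def by (simp add: algebra_simps power2_eq_square)
  finally show "eis2_3 (q ^ 3) * cubic_w q = eis2_9 q * (cubic_a (q ^ 3))\<^sup>2" by simp
qed

text \<open>Near \<open>0\<close> the quotient \<open>eis2_3 / cubic_a\<^sup>2\<close> is invariant under \<open>q \<mapsto> q\<^sup>3\<close> and continuous, so it is
  constant. Stating the result without \<open>cubic_a\<close>, which has zeros in the disc, makes analytic continuation possible.\<close>

lemma eis2_9_eq_cubic_w: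
  assumes q: "norm q < 1"
  shows "eis2_9 q = cubic_w q"
proof -
  have cont: "isCont cubic_a 0" "isCont eis2_3 0"
    using holomorphic_on_imp_continuous_on[OF cubic_a_holomorphic] holomorphic_on_imp_continuous_on[OF eis2_3_holomorphic]
    by (auto simp: continuous_on_eq_continuous_at)
  obtain d where d: "d > 0" "\<And>x. norm x < d \<Longrightarrow> cubic_a x \<noteq> 0"
    using continuous_at_avoid[OF cont(1), of 0] by (auto simp: values_at_0 dist_norm)
  define e where "e = min d 1"
  have e: "0 < e" "e \<le> 1" "e \<le> d" using d by (auto simp: e_def)
  have small: "eis2_9 x = cubic_w x" if x: "norm x < e" for x
  proof -
    have x1: "norm x < 1" using x e by simp
    define r where "r y = eis2_3 y / (cubic_a y)\<^sup>2" for y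
    have step: "r (y ^ 3) = r y" if y: "norm y < e" for y
    proof -
      have y1: "norm y < 1" using y e by simp
      have "norm (y ^ 3) \<le> norm y"
        unfolding norm_power using power_decreasing[of 1 3 "norm y"] y1 by simp
      then have nz: "cubic_a y \<noteq> 0" "cubic_a (y ^ 3) \<noteq> 0" using d y e by auto
      have "(eis2_3 y * (cubic_a (y ^ 3))\<^sup>2) * cubic_w y = (eis2_3 (y ^ 3) * (cubic_a y)\<^sup>2) * cubic_w y"
        using eis2_3_cubic_w[OF y1] by (metis mult.assoc mult.commute)
      then have "eis2_3 y * (cubic_a (y ^ 3))\<^sup>2 = eis2_3 (y ^ 3) * (cubic_a y)\<^sup>2"
        unfolding mult_right_cancel[OF cubic_w_eq(3)[OF y1]] .
      then show ?thesis unfolding r_def using nz by (simp add: divide_eq_eq eq_divide_eq)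
    qed
    have iter: "r (x ^ (3 ^ n)) = r x" for n
    proof (induction n)
      case (Suc n)
      have "norm (x ^ (3 ^ n)) \<le> norm x"
        unfolding norm_power using power_decreasing[of 1 "3 ^ n" "norm x"] x1 by simp
      then have "r ((x ^ 3 ^ n) ^ 3) = r (x ^ 3 ^ n)" using x by (intro step) simp
      moreover have "(x ^ 3 ^ n) ^ 3 = x ^ 3 ^ Suc n" by (simp only: power_mult[symmetric] power_Suc2)
      ultimately show ?case using Suc.IH by simp
    qed simp
    have "isCont r 0" unfolding r_def by (intro continuous_intros cont) (simp add: values_at_0)
    moreover have "(\<lambda>n. x ^ (3 ^ n)) \<longlonglongrightarrow> 0"
    proof (rule filterlim_compose[of "\<lambda>m. x ^ m"])
      show "(\<lambda>m. x ^ m) \<longlonglongrightarrow> 0" by (rule LIMSEQ_power_zero[OF x1])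
      show "filterlim (\<lambda>n::nat. 3 ^ n :: nat) at_top at_top" by real_asymp
    qed
    ultimately have "(\<lambda>n. r (x ^ (3 ^ n))) \<longlonglongrightarrow> r 0" by (rule isCont_tendsto_compose)
    then have "r x = r 0" unfolding iter by (simp add: LIMSEQ_const_iff)
    also have "r 0 = 1" by (simp add: r_def eis2_3_def values_at_0)
    finally have "eis2_3 x = (cubic_a x)\<^sup>2" using d(2)[of x] x e by (simp add: r_def)
    then have "cubic_w x * (cubic_a x)\<^sup>2 = eis2_9 x * (cubic_a x)\<^sup>2" using eis2_3_cubic_w(1)[OF x1] by (simp add: mult.commute)
    moreover have "(cubic_a x)\<^sup>2 \<noteq> 0" using d(2)[of x] x e by simp
    ultimately show ?thesis using mult_right_cancel by metis
  qed
  show ?thesis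
    by (rule analytic_continuation_open[of "ball 0 e" "ball 0 1" eis2_9 cubic_w])
       (use e q small in \<open>auto intro!: eis2_9_holomorphic cubic_w_holomorphic\<close>)
qed

lemma eis2_3_eq:
  assumes q: "norm q < 1"
  shows "eis2_3 q = (cubic_a q)\<^sup>2"
proof -
  have "eis2_3 q * cubic_w q = (cubic_a q)\<^sup>2 * cubic_w q" using eis2_3_cubic_w(1)[OF q] unfolding eis2_9_eq_cubic_w[OF q] by (simp only: mult.commute)
  then show ?thesis unfolding mult_right_cancel[OF cubic_w_eq(3)[OF q]] .
qed

definition eis4 :: "complex \<Rightarrow> complex" where "eis4 q = 1 + 240 * lambert3 q"

text \<open>Applying q d/dq to the equation \<open>eis2_3_eq\<close> gives 12 D1 - 108 D3 on the
  Eisenstein side, and \<open>lambert1_ode\<close> converts D1 and D3 into \<open>eis4\<close> at q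
  and q^3; this explains the weights 1 and -9.\<close>

lemma eis4_relation:
  assumes q: "norm q < 1"
  shows "eis4 q - 9 * eis4 (q ^ 3) = - 8 * cubic_a q ^ 4 + 432 * cubic_a q * cubic_k q * cubic_w q"
proof -
  have q3: "norm (q ^ 3) < 1" by (rule norm_power_less_1[OF q]) simp
  define a b k w where "a = cubic_a q" and "b = cubic_b q" and "k = cubic_k q" and "w = cubic_w q"
  define F1 F3 F9 where "F1 = lambert1 q" and "F3 = lambert1 (q ^ 3)" and "F9 = lambert1 (q ^ 9)"
  define D1 D3 where "D1 = q * deriv lambert1 q" and "D3 = q ^ 3 * deriv lambert1 (q ^ 3)"
  define E where "E = euler (q ^ 3)"
  have E: "E \<noteq> 0" unfolding E_def by (rule euler_neq_0[OF q3])
  have a: "a = b + 9 * k" by (simp add: a_def b_def k_def cubic_a_def)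
  have aa: "1 + 12 * F1 - 36 * F3 = a\<^sup>2" using eis2_3_eq[OF q] by (simp add: eis2_3_def a_def F1_def F3_def)
  have G: "1 - 27 * F9 = w - 3 * F1" using eis2_9_eq_cubic_w[OF q] by (simp add: eis2_9_def w_def F1_def F9_def algebra_simps)
  have l1: "theta_at lambert1 q D1" using theta_at_lambert1[OF q, of 1] by (simp add: D1_def)
  have l3: "theta_at (\<lambda>x. lambert1 (x ^ 3)) q (3 * D3)" using theta_at_lambert1[OF q, of 3] by (simp add: D3_def)
  have e3: "theta_at (\<lambda>x. euler (x ^ 3)) q (- 3 * E * F3)" using theta_at_euler[OF q, of 3] by (simp add: E_def F3_def)
  \<comment> \<open>Multiplying by the square of E(q^3) clears the denominator of a: the other side
    becomes (u + 9v)^2, whose derivative is known.\<close>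
  have L: "theta_at (\<lambda>x. (1 + 12 * lambert1 x + (- 36) * lambert1 (x ^ 3)) * euler (x ^ 3) ^ 2) q
      ((12 * D1 - 108 * D3) * E\<^sup>2 - 6 * F3 * a\<^sup>2 * E\<^sup>2)"
    by (rule theta_at_cong[OF theta_at_mult[OF theta_at_add[OF theta_at_add[OF theta_at_const theta_at_mult[OF theta_at_const l1]]
        theta_at_mult[OF theta_at_const l3]] theta_at_power[OF e3, of 2]]])
       (simp add: aa[symmetric] F1_def F3_def E_def, simp add: algebra_simps power2_eq_square)
  have R: "theta_at (\<lambda>x. (euler x ^ 3 + 9 * (x * euler (x ^ 9) ^ 3)) ^ 2) q
      (2 * (euler q ^ 3 + 9 * (q * euler (q ^ 9) ^ 3)) * (- 3 * F1 * euler q ^ 3 + 9 * ((1 - 27 * F9) * (q * euler (q ^ 9) ^ 3))))"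
    by (rule theta_at_cong[OF theta_at_power[OF theta_at_add[OF theta_uv(1)[OF q] theta_at_mult[OF theta_at_const theta_uv(2)[OF q]]], where n = 2]])
       (simp add: F1_def F9_def)
  have "(12 * D1 - 108 * D3) * E\<^sup>2 - 6 * F3 * a\<^sup>2 * E\<^sup>2
      = 2 * (euler q ^ 3 + 9 * (q * euler (q ^ 9) ^ 3)) * (- 3 * F1 * euler q ^ 3 + 9 * ((1 - 27 * F9) * (q * euler (q ^ 9) ^ 3)))"
  proof (rule theta_at_unique[OF L R q])
    fix x :: complex assume x: "norm x < 1"
    have nz: "euler (x ^ 3) \<noteq> 0" by (rule euler_neq_0[OF norm_power_less_1[OF x]]) simp
    have "cubic_a x * euler (x ^ 3) = euler x ^ 3 + 9 * (x * euler (x ^ 9) ^ 3)"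
      unfolding cubic_a_def cubic_b_def cubic_k_def using nz by (simp add: field_simps)
    then show "(1 + 12 * lambert1 x + (- 36) * lambert1 (x ^ 3)) * euler (x ^ 3) ^ 2 = (euler x ^ 3 + 9 * (x * euler (x ^ 9) ^ 3)) ^ 2"
      using eis2_3_eq[OF x] unfolding eis2_3_def by (metis add_uminus_conv_diff mult_minus_left power_mult_distrib)
  qed
  also have "euler q ^ 3 = b * E" using E by (simp add: b_def cubic_b_def E_def)
  also have "q * euler (q ^ 9) ^ 3 = k * E" using E by (simp add: k_def cubic_k_def E_def)
  finally have "(12 * D1 - 108 * D3 - 6 * F3 * a\<^sup>2) * E\<^sup>2 = (2 * a * (- 3 * F1 * b + 9 * (w - 3 * F1) * k)) * E\<^sup>2"
    unfolding G a by (simp add: algebra_simps power2_eq_square)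
  then have D: "12 * D1 - 108 * D3 = 6 * F3 * a\<^sup>2 + 2 * a * (- 3 * F1 * b + 9 * (w - 3 * F1) * k)"
    unfolding mult_right_cancel[OF power_not_zero[OF E]] by (simp add: algebra_simps)
  have X: "- 3 * F1 * b + 9 * (w - 3 * F1) * k = - 3 * F1 * a + 9 * w * k"
    unfolding a by (simp add: algebra_simps)
  have D': "12 * D1 - 108 * D3 = 6 * (F3 - F1) * a\<^sup>2 + 18 * a * k * w"
    unfolding D X by (simp add: algebra_simps power2_eq_square)
  \<comment> \<open>The factor 48 is 240/5, as the differential equation determines 5
    lambert3.\<close>
  have Q1: "eis4 q = 1 + 48 * (12 * F1\<^sup>2 - F1 + 6 * D1)"
    using lambert1_ode[OF q] unfolding eis4_def F1_def D1_def by simp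
  have Q3: "eis4 (q ^ 3) = 1 + 48 * (12 * F3\<^sup>2 - F3 + 6 * D3)"
    using lambert1_ode[OF q3] unfolding eis4_def F3_def D3_def by simp
  have "eis4 q - 9 * eis4 (q ^ 3) = - 8 + 48 * (12 * F1\<^sup>2 - F1 - 108 * F3\<^sup>2 + 9 * F3) + 24 * (12 * D1 - 108 * D3)"
    unfolding Q1 Q3 by (simp add: algebra_simps)
  also have "\<dots> = - 8 * (a\<^sup>2)\<^sup>2 + 432 * a * k * w"
    unfolding D' unfolding aa[symmetric] by (simp add: algebra_simps power2_eq_square)
  finally show ?thesis unfolding a_def k_def w_def by (simp flip: power_mult)
qed

text \<open>The difference D of the two sides satisfies D(x) = 9 D(x^3) and D(0) = 0. Near 0 it is
  bounded by a multiple of |x|, and cubing x shrinks this bound faster than the factor 9 enlarges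
  it, so D vanishes near 0 and hence on the disc.\<close>

lemma eis4_eq:
  assumes q: "norm q < 1"
  shows "eis4 q = cubic_a q ^ 4 + 216 * cubic_a q * cubic_k q * cubic_w q"
proof -
  define D where "D x = eis4 x - (cubic_a x ^ 4 + 216 * cubic_a x * cubic_k x * cubic_w x)" for x
  have cub: "27 * k * (b\<^sup>2 + 9 * b * k + 27 * k\<^sup>2) = (b + 9 * k) ^ 3 - b ^ 3" for b k :: complex
    by (simp add: algebra_simps power2_eq_square power3_eq_cube)
  have step: "D x = 9 * D (x ^ 3)" if x: "norm x < 1" for x
  proof -
    define b k where "b = cubic_b x" and "k = cubic_k x"
    have A: "cubic_a (x ^ 3) = b + 3 * k" unfolding b_def k_def by (rule cubic_a_cube[OF x])
    have a: "cubic_a x = b + 9 * k" by (simp add: cubic_a_def b_def k_def)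
    have w: "cubic_w x = b\<^sup>2 + 9 * b * k + 27 * k\<^sup>2" by (simp add: cubic_w_def b_def k_def)
    \<comment> \<open>The cubic identity at x^3: there b^3 equals b w, and (b + 3k)^3 - b w = 27
      k^3.\<close>
    have "27 * cubic_k (x ^ 3) * cubic_w (x ^ 3) = cubic_a (x ^ 3) ^ 3 - cubic_b (x ^ 3) ^ 3"
      unfolding cubic_a_def cubic_w_def by (rule cub)
    also have "\<dots> = 27 * k ^ 3"
      unfolding A cubic_w_eq(5)[OF x] w b_def[symmetric] by (simp add: algebra_simps power2_eq_square power3_eq_cube)
    finally have c: "cubic_k (x ^ 3) * cubic_w (x ^ 3) = k ^ 3" by simp
    have "D x - 9 * D (x ^ 3) = (eis4 x - 9 * eis4 (x ^ 3)) - (cubic_a x ^ 4 + 216 * cubic_a x * (cubic_k x * cubic_w x))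
        + 9 * (cubic_a (x ^ 3) ^ 4 + 216 * cubic_a (x ^ 3) * (cubic_k (x ^ 3) * cubic_w (x ^ 3)))"
      unfolding D_def by (simp add: algebra_simps)
    also have "\<dots> = 0"
      unfolding eis4_relation[OF x] c A a w k_def[symmetric]
      by (simp add: algebra_simps power2_eq_square power3_eq_cube power4_eq_xxxx)
    finally show ?thesis by simp
  qed
  have hol: "D holomorphic_on ball 0 1"
    unfolding D_def[abs_def] eis4_def
    by (intro holomorphic_intros lambert3_holomorphic cubic_a_holomorphic cubic_k_holomorphic cubic_w_holomorphic)
  have D0: "D 0 = 0" by (simp add: D_def eis4_def values_at_0)
  obtain d B where d: "0 < d" and B: "0 \<le> B" "\<And>x. norm x < d \<Longrightarrow> norm (D x) \<le> B * norm x"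
  proof -
    have "(D has_field_derivative deriv D 0) (at 0)" using holomorphic_derivI[OF hol, of 0] by simp
    then have "((\<lambda>x. D x / x) \<longlongrightarrow> deriv D 0) (at 0)" by (simp add: has_field_derivative_iff D0)
    then have "((\<lambda>x. norm (D x / x)) \<longlongrightarrow> norm (deriv D 0)) (at 0)" by (rule tendsto_norm)
    then have "\<forall>\<^sub>F x in at 0. norm (D x / x) < norm (deriv D 0) + 1" by (rule order_tendstoD) simp
    then obtain d where d: "d > 0" "\<And>x. x \<noteq> 0 \<Longrightarrow> norm x < d \<Longrightarrow> norm (D x / x) < norm (deriv D 0) + 1"
      by (auto simp: eventually_at)
    show thesis
    proof (rule that[of d "norm (deriv D 0) + 1"])
      fix x :: complex assume x: "norm x < d"
      show "norm (D x) \<le> (norm (deriv D 0) + 1) * norm x"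
      proof (cases "x = 0")
        case False
        then have "norm (D x) / norm x < norm (deriv D 0) + 1" using d(2)[OF False x] by (simp add: norm_divide)
        then show ?thesis using False by (simp add: divide_less_eq)
      qed (simp add: D0)
    qed (use d in auto)
  qed
  \<comment> \<open>For |x| at most 1/10 the cube has norm at most |x|/100, so each iteration gains
    the factor 9/100.\<close>
  define e where "e = min d (1 / 10)"
  have e: "0 < e" "e \<le> d" "e \<le> 1 / 10" using d by (auto simp: e_def)
  have small: "norm (D x) \<le> (9 / 100) ^ n * (B * norm x)" if "norm x < e" for x n
    using that
  proof (induction n arbitrary: x)
    case 0
    then show ?case using B(2)[of x] e by simp
  next
    case (Suc n)
    have x1: "norm x < 1" "norm x \<le> 1 / 10" using Suc.prems e by auto
    have "norm x * norm x \<le> 1 / 10 * (1 / 10)" using x1 by (intro mult_mono) auto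
    then have "norm x * norm x * norm x \<le> 1 / 100 * norm x"
      by (intro mult_right_mono) auto
    then have sq: "norm (x ^ 3) \<le> 1 / 100 * norm x"
      by (simp add: norm_mult power3_eq_cube)
    then have "norm (x ^ 3) < e" using Suc.prems norm_ge_zero[of x] by linarith
    then have "norm (D (x ^ 3)) \<le> (9 / 100) ^ n * (B * norm (x ^ 3))" by (rule Suc.IH)
    also have "\<dots> \<le> (9 / 100) ^ n * (B * (1 / 100 * norm x))" using B(1) sq by (intro mult_left_mono) auto
    finally show ?case unfolding step[OF x1(1)] norm_mult by (simp add: mult_ac)
  qed
  have zero: "D x = 0" if x: "norm x < e" for x
  proof -
    have "(\<lambda>n. (9 / 100 :: real) ^ n * (B * norm x)) \<longlonglongrightarrow> 0 * (B * norm x)"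
      by (intro tendsto_mult tendsto_const LIMSEQ_power_zero) simp
    then have "norm (D x) \<le> 0 * (B * norm x)"
      by (rule LIMSEQ_le_const) (use small[OF x] in auto)
    then show ?thesis by simp
  qed
  have "D q = 0"
    by (rule analytic_continuation_open[of "ball 0 e" "ball 0 1" D "\<lambda>_. 0"]) (use e q zero hol in auto)
  then show ?thesis by (simp add: D_def)
qed

text \<open>At q^3 the product k w is the cube of k(q), so both values are polynomials in a(q^3) and
  k(q). The second comes from solving \<open>eis4_relation\<close> at q^3 for its last term.\<close>

lemma eis4_cube:
  assumes q: "norm q < 1"
  shows "eis4 (q ^ 3) = cubic_a (q ^ 3) ^ 4 + 216 * cubic_a (q ^ 3) * cubic_k q ^ 3"
    and "eis4 (q ^ 9) = cubic_a (q ^ 3) ^ 4 - 24 * cubic_a (q ^ 3) * cubic_k q ^ 3"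
proof -
  have q3: "norm (q ^ 3) < 1" by (rule norm_power_less_1[OF q]) simp
  have "27 * cubic_k (q ^ 3) * cubic_w (q ^ 3) = cubic_a (q ^ 3) ^ 3 - cubic_b (q ^ 3) ^ 3"
    unfolding cubic_a_def cubic_w_def by (simp add: algebra_simps power2_eq_square power3_eq_cube)
  also have "\<dots> = 27 * cubic_k q ^ 3"
    unfolding cubic_a_cube[OF q] cubic_w_eq(5)[OF q] cubic_w_def by (simp add: algebra_simps power2_eq_square power3_eq_cube)
  finally have c: "cubic_k (q ^ 3) * cubic_w (q ^ 3) = cubic_k q ^ 3" by simp
  show 1: "eis4 (q ^ 3) = cubic_a (q ^ 3) ^ 4 + 216 * cubic_a (q ^ 3) * cubic_k q ^ 3"
    unfolding eis4_eq[OF q3] c[symmetric] by (simp only: mult.assoc)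
  have "eis4 (q ^ 3) - 9 * eis4 (q ^ 9) = - 8 * cubic_a (q ^ 3) ^ 4 + 432 * cubic_a (q ^ 3) * cubic_k q ^ 3"
    using eis4_relation[OF q3] unfolding power_3_3 c[symmetric] by (simp only: mult.assoc)
  then have "9 * eis4 (q ^ 9) = 9 * (cubic_a (q ^ 3) ^ 4 - 24 * cubic_a (q ^ 3) * cubic_k q ^ 3)"
    unfolding 1 by (simp add: algebra_simps)
  then show "eis4 (q ^ 9) = cubic_a (q ^ 3) ^ 4 - 24 * cubic_a (q ^ 3) * cubic_k q ^ 3"
    by (subst (asm) mult_left_cancel) simp_all
qed

section \<open>The theorem\<close>

text \<open>The absolutely convergent double series is regrouped by the product (n+1)(m+1), the
  divisor being m+1; all indices start at 0, hence the shifts.\<close>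

lemma lambert3_divisor_has_sum:
  fixes x :: complex
  assumes x: "norm x < 1"
  shows "((\<lambda>n. \<Sum>d | d dvd Suc n. of_nat d ^ 3 * x ^ Suc n) has_sum lambert3 x) UNIV"
proof -
  let ?g = "\<lambda>(N, d). of_nat d ^ 3 * x ^ Suc N :: complex"
  have "(?g has_sum lambert3 x) (Sigma UNIV (\<lambda>N. {d. d dvd Suc N}))
      \<longleftrightarrow> ((\<lambda>(n, m). of_nat (Suc m) ^ 3 * x ^ (Suc n * Suc m)) has_sum lambert3 x) (UNIV \<times> UNIV)"
  proof (rule has_sum_reindex_bij_witness[of _ "\<lambda>(n, m). (Suc n * Suc m - 1, Suc m)" "\<lambda>(N, d). (Suc N div d - 1, d - 1)"], goal_cases)
    case (1 a)
    then obtain N d where a: "a = (N, d)" "d dvd Suc N" by auto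
    then obtain c where c: "Suc N = d * c" by (auto elim: dvdE)
    have "d * c \<noteq> 0" unfolding c[symmetric] by simp
    then have "d > 0" "c > 0" by simp_all
    then have "Suc N div d = c" "Suc (c - 1) = c" "Suc (d - 1) = d" unfolding c by simp_all
    moreover have "c * d = Suc N" using c by (simp only: mult.commute)
    then have "c * d - 1 = N" by (simp only: diff_Suc_1)
    ultimately show ?case unfolding a prod.case by (simp only:)
  next
    case (3 b)
    obtain n m where b: "b = (n, m)" by (cases b)
    have "Suc (Suc n * Suc m - 1) = Suc n * Suc m" by simp
    moreover have "Suc n * Suc m div Suc m = Suc n" by (rule nonzero_mult_div_cancel_right) simp
    ultimately show ?case unfolding b prod.case by (simp only: diff_Suc_1)
  next
    case (4 b)
    obtain n m where b: "b = (n, m)" by (cases b)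
    have "Suc (Suc n * Suc m - 1) = Suc n * Suc m" by simp
    then show ?case unfolding b prod.case by (simp only: mem_Sigma_iff mem_Collect_eq dvd_triv_right UNIV_I simp_thms)
  next
    case (5 a)
    then obtain N d where a: "a = (N, d)" "d dvd Suc N" by auto
    then obtain c where c: "Suc N = d * c" by (auto elim: dvdE)
    have "d * c \<noteq> 0" unfolding c[symmetric] by simp
    then have "d > 0" "c > 0" by simp_all
    then have "Suc N div d = c" "Suc (c - 1) = c" "Suc (d - 1) = d" unfolding c by simp_all
    moreover have "c * d = Suc N" using c by (simp only: mult.commute)
    ultimately show ?case unfolding a prod.case by (simp only:)
  qed auto
  then have "(?g has_sum lambert3 x) (Sigma UNIV (\<lambda>N. {d. d dvd Suc N}))"
    using has_sum_cube_double(1)[OF x] by blast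
  then show ?thesis
    by (rule has_sum_SigmaD) (simp add: has_sum_finite_iff)
qed

text \<open>The nontrivial character modulo 3 written through additive characters.\<close>

lemma omega_Legendre: "omega ^ N - (omega\<^sup>2) ^ N = (omega - omega\<^sup>2) * of_int (Legendre (int N) 3)"
proof -
  have sq: "(omega\<^sup>2) ^ N = (omega ^ N)\<^sup>2" by (simp only: power_mult[symmetric] mult.commute)
  have not2: "\<not> QuadRes 3 a" if "a mod 3 = 2" for a :: int
  proof
    assume "QuadRes 3 a"
    then obtain y where "y\<^sup>2 mod 3 = a mod 3" by (auto simp: QuadRes_def cong_def)
    moreover have "y\<^sup>2 mod 3 = (y mod 3)\<^sup>2 mod 3" by (simp add: power_mod)
    moreover have "y mod 3 = 0 \<or> y mod 3 = 1 \<or> y mod 3 = 2" by presburger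
    ultimately show False using that by (auto simp: power2_eq_square)
  qed
  consider "N mod 3 = 0" | "N mod 3 = 1" | "N mod 3 = 2" by linarith
  then show ?thesis
  proof cases
    case 1
    then have "int N mod 3 = 0" by presburger
    then show ?thesis unfolding sq using 1 omega_power_mod[of N] by (simp add: Legendre_def cong_def)
  next
    case 2
    then have m: "int N mod 3 = 1" by presburger
    have "QuadRes 3 (int N)" unfolding QuadRes_def cong_def by (rule exI[of _ 1]) (simp add: m)
    then have "Legendre (int N) 3 = 1" using m by (simp add: Legendre_def cong_def)
    then show ?thesis unfolding sq using 2 omega_power_mod[of N] by simp
  next
    case 3
    then have m: "int N mod 3 = 2" by presburger
    then have "Legendre (int N) 3 = - 1" using not2[OF m] by (simp add: Legendre_def cong_def)
    moreover have "omega ^ N = omega\<^sup>2" using 3 omega_power_mod[of N] by simp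
    ultimately show ?thesis unfolding sq using omega_power_simps(5) by simp
  qed
qed

lemma omega_diff_neq_0: "omega - omega\<^sup>2 \<noteq> 0"
proof
  assume "omega - omega\<^sup>2 = 0"
  then have "omega = 1" by (simp add: power2_eq_square)
  then show False using omega_sum by simp
qed

text \<open>Twisting by the character amounts to comparing the untwisted series at omega q and at
  omega^2 q.\<close>

lemma E94_omega:
  assumes q: "norm q < 1"
  shows "(omega - omega\<^sup>2) * E94 q = lambert3 (omega * q) - lambert3 (omega\<^sup>2 * q)"
proof -
  have o1: "norm (omega * q) < 1" and o2: "norm (omega\<^sup>2 * q) < 1" using q by (simp_all add: norm_mult norm_power)
  note nz = omega_diff_neq_0
  let ?t = "\<lambda>x n. \<Sum>d | d dvd Suc n. of_nat d ^ 3 * x ^ Suc n :: complex"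
  have "(\<lambda>n. ?t (omega * q) n - ?t (omega\<^sup>2 * q) n) sums (lambert3 (omega * q) - lambert3 (omega\<^sup>2 * q))"
    by (intro sums_diff has_sum_imp_sums lambert3_divisor_has_sum o1 o2)
  moreover have "?t (omega * q) n - ?t (omega\<^sup>2 * q) n = (omega - omega\<^sup>2) * (of_int (Legendre (int (Suc n)) 3) * ?t q n)" for n
  proof -
    have "?t (y * q) n = y ^ Suc n * ?t q n" for y
      unfolding sum_distrib_left power_mult_distrib by (intro sum.cong refl) (simp only: mult_ac)
    then have "?t (omega * q) n - ?t (omega\<^sup>2 * q) n = (omega ^ Suc n - (omega\<^sup>2) ^ Suc n) * ?t q n"
      by (simp only: left_diff_distrib)
    then show ?thesis unfolding omega_Legendre by (simp only: mult.assoc)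
  qed
  ultimately have "(\<lambda>n. (omega - omega\<^sup>2) * (of_int (Legendre (int (Suc n)) 3) * ?t q n)) sums (lambert3 (omega * q) - lambert3 (omega\<^sup>2 * q))"
    by (simp only:)
  then have "(\<lambda>n. (omega - omega\<^sup>2) * (of_int (Legendre (int (Suc n)) 3) * ?t q n) / (omega - omega\<^sup>2))
      sums ((lambert3 (omega * q) - lambert3 (omega\<^sup>2 * q)) / (omega - omega\<^sup>2))"
    by (rule sums_divide)
  then have "(\<lambda>n. of_int (Legendre (int (Suc n)) 3) * ?t q n) sums ((lambert3 (omega * q) - lambert3 (omega\<^sup>2 * q)) / (omega - omega\<^sup>2))"
    unfolding nonzero_mult_div_cancel_left[OF nz] .
  then have "E94 q = (lambert3 (omega * q) - lambert3 (omega\<^sup>2 * q)) / (omega - omega\<^sup>2)"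
    unfolding E94_def by (rule sums_unique[symmetric])
  then show ?thesis using nz by simp
qed

text \<open>In powers of k with coefficients in a(q^3), the terms of degree j in k carry exactly the
  q-exponents congruent to j modulo 3.\<close>

lemma eis4_expand:
  assumes x: "norm x < 1"
  shows "eis4 x = cubic_a (x ^ 3) ^ 4 + 240 * cubic_a (x ^ 3) ^ 3 * cubic_k x + 2160 * (cubic_a (x ^ 3))\<^sup>2 * (cubic_k x)\<^sup>2
           + 6696 * cubic_a (x ^ 3) * cubic_k x ^ 3 + 12960 * cubic_k x ^ 4"
  unfolding eis4_eq[OF x] cubic_a_cube[OF x] unfolding cubic_a_def cubic_w_def
  by (simp add: algebra_simps power2_eq_square power3_eq_cube power4_eq_xxxx)

text \<open>Under the twist the terms in k and k^4 survive with sign +, the term in k^2 with sign -,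
  and the rest cancels: 240, -2160 and 12960 divided by 240 are 1, -9 and 54.\<close>

lemma E94_eq:
  assumes q: "norm q < 1"
  shows "E94 q = cubic_a (q ^ 3) ^ 3 * cubic_k q - 9 * (cubic_a (q ^ 3))\<^sup>2 * (cubic_k q)\<^sup>2 + 54 * cubic_k q ^ 4"
proof -
  have o1: "norm (omega * q) < 1" and o2: "norm (omega\<^sup>2 * q) < 1" using q by (simp_all add: norm_mult norm_power)
  note nz = omega_diff_neq_0
  define A k where "A = cubic_a (q ^ 3)" and "k = cubic_k q"
  have c: "(omega * q) ^ 3 = q ^ 3" "(omega\<^sup>2 * q) ^ 3 = q ^ 3" "(omega * q) ^ 9 = q ^ 9" "(omega\<^sup>2 * q) ^ 9 = q ^ 9"
    by (simp_all only: power_mult_distrib omega_cube omega_power_simps mult_1_left)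
  have k1: "cubic_k (omega * q) = omega * k" and k2: "cubic_k (omega\<^sup>2 * q) = omega\<^sup>2 * k"
    unfolding cubic_k_def k_def c by simp_all
  have p: "omega ^ 3 = 1" "omega ^ 4 = omega" "(omega\<^sup>2)\<^sup>2 = omega" "(omega\<^sup>2) ^ 3 = 1" "(omega\<^sup>2) ^ 4 = omega\<^sup>2"
    using omega_cube omega_power_simps omega_power_mod[of 8] by (simp_all flip: power_mult)
  have "240 * ((omega - omega\<^sup>2) * E94 q) = eis4 (omega * q) - eis4 (omega\<^sup>2 * q)"
    unfolding E94_omega[OF q] eis4_def by (simp add: algebra_simps)
  also have "\<dots> = 240 * ((omega - omega\<^sup>2) * (A ^ 3 * k - 9 * A\<^sup>2 * k\<^sup>2 + 54 * k ^ 4))"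
    unfolding eis4_expand[OF o1] eis4_expand[OF o2] c k1 k2
    unfolding A_def[symmetric] unfolding power_mult_distrib p
    by (simp add: algebra_simps)
  finally have "(omega - omega\<^sup>2) * E94 q = (omega - omega\<^sup>2) * (A ^ 3 * k - 9 * A\<^sup>2 * k\<^sup>2 + 54 * k ^ 4)" by simp
  then show ?thesis unfolding mult_left_cancel[OF nz] A_def k_def .
qed

lemma E9_eqs: "E91 q = eis4 q / 240" "E92 q = eis4 (q ^ 3) / 240" "E93 q = eis4 (q ^ 9) / 240"
  unfolding E91_def E92_def E93_def eis4_def lambert3_def power_mult by (simp_all add: add_divide_distrib)

text \<open>In \<open>A2th_square\<close> the coset terms occur only as q K^3, which is k w, and as
  q times the coset series at q^3, which is 3k. The constants 54 are 2 * 27 and 6 * 9, from A2th q 1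
  = 3 K.\<close>

lemma CPhi_9_eq_poly:
  assumes q: "norm q < 1" and q0: "q \<noteq> 0"
  shows "CPhi 9 q = (cubic_b q ^ 4 + 84 * cubic_b q ^ 3 * cubic_k q + 1458 * (cubic_b q)\<^sup>2 * (cubic_k q)\<^sup>2 + 8748 * cubic_b q * cubic_k q ^ 3
           + 19683 * cubic_k q ^ 4) / euler q ^ 9"
proof -
  have q3: "norm (q ^ 3) < 1" by (rule norm_power_less_1[OF q]) simp
  have q30: "q ^ 3 \<noteq> 0" using q0 by simp
  define b k w where "b = cubic_b q" and "k = cubic_k q" and "w = cubic_w q"
  define K where "K = A2K q"
  have cK: "q * K ^ 3 = k * w"
    using cubic_w_eq(4)[OF q] unfolding K_def A2K_eq[OF q q0] k_def w_def power_divide by (simp flip: power_mult)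
  have T1: "A2th q 1 = 3 * K" unfolding K_def by (rule A2th_1_eq[OF q q0])
  have T13: "q * A2th (q ^ 3) 1 = 3 * k"
    using lat_eqs(1)[OF q q0] unfolding A2th_1_eq[OF q3 q30] k_def by simp
  have T0: "A2th q 0 = b + 9 * k" "A2th (q ^ 3) 0 = b + 3 * k"
    unfolding lat_eqs(2,3)[OF q q0] cubic_a_def b_def k_def by simp_all
  have w: "w = b\<^sup>2 + 9 * b * k + 27 * k\<^sup>2" by (simp add: w_def b_def k_def cubic_w_def)
  have "conv3 (A2th q) (A2th q) (A2th q) 0
      = (b + 9 * k) ^ 3 * (b + 3 * k) + 54 * (q * K ^ 3) * (q * A2th (q ^ 3) 1) + 54 * (q * K ^ 3) * (b + 9 * k)"
    unfolding A2th_square[OF q q0] T0 T1 K_def[symmetric]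
    by (simp add: power_mult_distrib) (simp add: algebra_simps power2_eq_square power3_eq_cube)
  also have "\<dots> = b ^ 4 + 84 * b ^ 3 * k + 1458 * b\<^sup>2 * k\<^sup>2 + 8748 * b * k ^ 3 + 19683 * k ^ 4"
    unfolding cK T13 w by (simp add: algebra_simps power2_eq_square power3_eq_cube power4_eq_xxxx)
  finally show ?thesis unfolding CPhi_9_eq[OF q q0] b_def k_def by simp
qed

theorem theorem5p1:
  fixes q :: complex
  assumes "norm q < 1"
  shows "CPhi 9 q =
           324 * q * (qpoch_inf (q^3) (q^3) ^ 8 / qpoch_inf q q ^ 9)
         + 19683 * q^4 * (qpoch_inf (q^9) (q^9) ^ 12 / (qpoch_inf q q ^ 9 * qpoch_inf (q^3) (q^3) ^ 4))
         - 240 * q * (qpoch_inf (q^9) (q^9) ^ 3 / qpoch_inf (q^3) (q^3) ^ 4)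
         - 1458 * q^2 * (qpoch_inf (q^9) (q^9) ^ 6 / (qpoch_inf q q ^ 3 * qpoch_inf (q^3) (q^3) ^ 4))
         + qpoch_inf q q ^ 3 / qpoch_inf (q^3) (q^3) ^ 4
         \<and> CPhi 9 q =
           1 / qpoch_inf q q ^ 9
         * (81 * E91 q - 84 * E92 q + 243 * E93 q - 3 * E94 q - 6 * q * qpoch_inf (q^3) (q^3) ^ 8)"
proof (cases "q = 0")
  case True
  \<comment> \<open>The lattice sums exclude q = 0. There the Eisenstein side is 1 because 81 - 84 +
    243 = 240.\<close>
  have "CPhi 9 0 = 1" unfolding CPhi_def using powser_zero[of "\<lambda>n. of_nat (cphi 9 n) :: complex"] by (simp add: cphi_0)
  then show ?thesis using True by (simp add: euler_0 E9_eqs E94_eq eis4_def values_at_0)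
next
  case False
  have q: "norm q < 1" by fact
  have q3: "norm (q ^ 3) < 1" and q9: "norm (q ^ 9) < 1" by (rule norm_power_less_1[OF q], simp)+
  define b k w where "b = cubic_b q" and "k = cubic_k q" and "w = cubic_w q"
  define x y z where "x = euler q" and "y = euler (q ^ 3)" and "z = euler (q ^ 9)"
  have nz: "x \<noteq> 0" "y \<noteq> 0" "z \<noteq> 0"
    unfolding x_def y_def z_def using euler_neq_0[OF q] euler_neq_0[OF q3] euler_neq_0[OF q9] .
  have b: "b = x ^ 3 / y" and k: "k = q * z ^ 3 / y"
    by (simp_all add: b_def k_def cubic_b_def cubic_k_def x_def y_def z_def)
  have w: "w = b\<^sup>2 + 9 * b * k + 27 * k\<^sup>2" by (simp add: w_def b_def k_def cubic_w_def)
  have A: "cubic_a (q ^ 3) = b + 3 * k" unfolding b_def k_def by (rule cubic_a_cube[OF q])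
  have C: "CPhi 9 q = (b ^ 4 + 84 * b ^ 3 * k + 1458 * b\<^sup>2 * k\<^sup>2 + 8748 * b * k ^ 3 + 19683 * k ^ 4) / x ^ 9"
    unfolding b_def k_def x_def by (rule CPhi_9_eq_poly[OF q False])
  have y8: "q * y ^ 8 = b * (k * w)"
  proof -
    have "k * w = q * y ^ 9 / x ^ 3" using cubic_w_eq(4)[OF q] by (simp add: k_def w_def x_def y_def)
    moreover have "y ^ 9 = y * y ^ 8" by (simp flip: power_Suc)
    ultimately show ?thesis unfolding b using nz by simp
  qed
  have pw: "(x ^ 3) ^ 3 = x ^ 9" "(x ^ 3)\<^sup>2 = x ^ 6" "(x ^ 3) ^ 4 = x ^ 12" "(z ^ 3)\<^sup>2 = z ^ 6" "(z ^ 3) ^ 4 = z ^ 12"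
    "y ^ 4 = y ^ 3 * y"
    unfolding power_mult[symmetric] by (simp_all add: power_Suc2 eval_nat_numeral)
  have pw2: "x ^ 9 = x ^ 3 * x ^ 6" "x ^ 12 = x ^ 9 * x ^ 3" "y ^ 4 = y\<^sup>2 * y\<^sup>2"
    by (simp_all flip: power_add)
  \<comment> \<open>Each of the five quotients is a monomial in b, k and w over the ninth power of
    E(q).\<close>
  have t1: "q * (y ^ 8 / x ^ 9) = b * (k * w) / x ^ 9" using y8 by simp
  have t2: "q ^ 4 * (z ^ 12 / (x ^ 9 * y ^ 4)) = k ^ 4 / x ^ 9"
    unfolding k power_divide power_mult_distrib pw(5) by simp
  have t3: "q * (z ^ 3 / y ^ 4) = b ^ 3 * k / x ^ 9"
    unfolding k b power_divide pw(1,6) using nz by simp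
  have t4: "q\<^sup>2 * (z ^ 6 / (x ^ 3 * y ^ 4)) = b\<^sup>2 * k\<^sup>2 / x ^ 9"
  proof -
    have gen: "Q * (Z / (X * (Y * Y))) = (X' / Y) * (Q * Z / Y) / (X * X')" if "X' \<noteq> 0" for Q Z X X' Y :: complex
      using that by simp
    show ?thesis unfolding k b power_divide power_mult_distrib pw(2,4) pw2(1,3) by (rule gen[OF power_not_zero[OF nz(1)]])
  qed
  have t5: "x ^ 3 / y ^ 4 = b ^ 4 / x ^ 9"
  proof -
    have gen: "X / Y = (X' * X / Y) / X'" if "X' \<noteq> 0" for X X' Y :: complex
      using that by simp
    show ?thesis unfolding b power_divide pw(3) pw2(2) by (rule gen[OF power_not_zero[OF nz(1)]])
  qed
  have "CPhi 9 q = 324 * (b * (k * w) / x ^ 9) + 19683 * (k ^ 4 / x ^ 9) - 240 * (b ^ 3 * k / x ^ 9)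
      - 1458 * (b\<^sup>2 * k\<^sup>2 / x ^ 9) + b ^ 4 / x ^ 9"
  proof -
    \<comment> \<open>Only 324 b k w needs expanding: 324 - 240 = 84, 9 * 324 - 1458 = 1458 and 27 *
      324 = 8748.\<close>
    have "b ^ 4 + 84 * b ^ 3 * k + 1458 * b\<^sup>2 * k\<^sup>2 + 8748 * b * k ^ 3 + 19683 * k ^ 4
      = 324 * (b * (k * w)) + 19683 * k ^ 4 - 240 * (b ^ 3 * k) - 1458 * (b\<^sup>2 * k\<^sup>2) + b ^ 4"
      unfolding w by (simp add: algebra_simps power2_eq_square power3_eq_cube power4_eq_xxxx)
    then show ?thesis unfolding C by (simp only: add_divide_distrib diff_divide_distrib times_divide_eq_right)
  qed
  then have 1: "CPhi 9 q = 324 * q * (y ^ 8 / x ^ 9) + 19683 * q ^ 4 * (z ^ 12 / (x ^ 9 * y ^ 4)) - 240 * q * (z ^ 3 / y ^ 4)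
      - 1458 * q\<^sup>2 * (z ^ 6 / (x ^ 3 * y ^ 4)) + x ^ 3 / y ^ 4"
    unfolding t1[symmetric] t2[symmetric] t3[symmetric] t4[symmetric] t5[symmetric] by (simp only: mult.assoc)
  have cancel: "240 * M / 240 = M" for M :: complex by simp
  have "81 * E91 q - 84 * E92 q + 243 * E93 q - 3 * E94 q - 6 * q * y ^ 8
      = (81 * eis4 q - 84 * eis4 (q ^ 3) + 243 * eis4 (q ^ 9)) / 240 - 3 * E94 q - 6 * (q * y ^ 8)"
    unfolding E9_eqs by (simp add: add_divide_distrib diff_divide_distrib)
  \<comment> \<open>In powers of a(q^3) = b + 3k and k every coefficient is divisible by 240, which
    cancels the normalisation of the Eisenstein series.\<close>
  also have "81 * eis4 q - 84 * eis4 (q ^ 3) + 243 * eis4 (q ^ 9) = 240 * ((b + 3 * k) ^ 4 + 81 * (b + 3 * k) ^ 3 * k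
      + 729 * (b + 3 * k)\<^sup>2 * k\<^sup>2 + 2160 * (b + 3 * k) * k ^ 3 + 4374 * k ^ 4)"
    unfolding eis4_expand[OF q] eis4_cube[OF q] A k_def[symmetric] by (simp add: algebra_simps)
  finally have "81 * E91 q - 84 * E92 q + 243 * E93 q - 3 * E94 q - 6 * q * y ^ 8
      = ((b + 3 * k) ^ 4 + 81 * (b + 3 * k) ^ 3 * k + 729 * (b + 3 * k)\<^sup>2 * k\<^sup>2 + 2160 * (b + 3 * k) * k ^ 3 + 4374 * k ^ 4)
       - 3 * E94 q - 6 * (q * y ^ 8)" unfolding cancel .
  also have "\<dots> = b ^ 4 + 84 * b ^ 3 * k + 1458 * b\<^sup>2 * k\<^sup>2 + 8748 * b * k ^ 3 + 19683 * k ^ 4"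
    unfolding y8 E94_eq[OF q] A k_def[symmetric] w
    by (simp add: algebra_simps power2_eq_square power3_eq_cube power4_eq_xxxx)
  finally have 2: "CPhi 9 q = 1 / x ^ 9 * (81 * E91 q - 84 * E92 q + 243 * E93 q - 3 * E94 q - 6 * q * y ^ 8)"
    unfolding C by simp
  from 1 2 show ?thesis unfolding x_def y_def z_def by (rule conjI)
qed

end
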